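(* Let $c_n$ be an extreme time-scale. The following holds for all $\beta>\beta_c$, where $\overset{d}{=}$ denotes equality in distribution. (i) If $\mu_n=\mathcal G_n$, where $\mathcal G_n(x)=\tau_n(x)/\sum_{y\in\mathcal V_n}\tau_n(y)$ is the Gibbs measure, then for all $s,t>0$ $$\lim_{n\to\infty}\mathcal C_n(t,s)\overset{d}{=}\mathcal C^{sta}_\infty(s).$$ (ii) If $\mu_n=\pi_n$ is the uniform distribution on $\mathcal V_n$, then for all $s\ge0$ $$\lim_{t\to\infty}\lim_{n\to\infty}\mathcal C_n(t,s)\overset{d}{=}\mathcal C^{sta}_\infty(s).$$
   Context: For $n\ge 1$ let $\mathcal V_n=\{-1,1\}^n$ be the discrete cube, with edges between vertices that differ in exactly one coordinate. Let $(\mathcal H_n(x))_{x\in\mathcal V_n}$ be independent centered Gaussian random variables of variance $n$ (for all $n$ defined on a common probability space with law $\mathbb P$, called the random environment). For $\beta>0$ set $\tau_n(x)=\exp\{-\beta\mathcal H_n(x)\}$. Given the environment, $(X_n(t))_{t>0}$ is the Markov jump process on $\mathcal V_n$ with rates $\lambda_n(x,y)=1/(n\tau_n(x))$ if $(x,y)$ is an edge and $0$ otherwise; $\mathcal P_{\mu_n}$ denotes its law with initial distribution $\mu_n$, for a fixed realization of the environment. Given a diverging sequence $c_n$ (time-scale), $a_n$ is defined by $a_n\mathbb P(\tau_n(x)\ge c_n)=1$. $c_n$ is an extreme time-scale if $\lim_n a_n/2^n=\bar\varepsilon$ for some constant $0<\bar\varepsilon<\infty$. Set $\beta_c=\sqrt{2\log2}$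 and $\alpha=\beta_c/\beta$. With $(\cdot,\cdot)$ the inner product in $\mathbb R^n$, $\mathcal C_n(t,s)=\mathcal P_{\mu_n}\big(n^{-1}(X_n(c_nt),X_n(c_nu))=1\ \forall\, t\le u<t+s\big)$; it is a random variable as a function of the environment, and the limits in $n$ are limits in distribution with respect to the environment. Let $\{\gamma_k\}_{k\ge1}$ be the marks (points) of a Poisson random measure on $(0,\infty)$ with mean measure $\mu$ satisfying $\mu(x,\infty)=x^{-\alpha}$, $x>0$, and set $$\mathcal C^{sta}_\infty(s)=\sum_{k=1}^\infty\frac{\gamma_k}{\sum_{l=1}^\infty\gamma_l}e^{-s/\gamma_k},\qquad s\ge0.$$
   Formalization: The Poisson mean measure is taken as μ(x,∞) = x^{-α}/ε̄ instead of x^{-α}, where ε̄ = lim a_n/2^n; the two agree for ε̄ = 1, and for ε̄ ≠ 1 the original is false, since rescaling c_n by κ changes the limit law. *)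

theory Defs
  imports "HOL-Probability.Probability"
begin

text \<open>The discrete cube \<open>{-1,1}\<^sup>n\<close>; coordinates are numbered from 0 and vertices are
  \<open>undefined\<close> outside \<open>{..<n}\<close>, so that distinct functions are distinct vertices.\<close>

definition cube :: "nat \<Rightarrow> (nat \<Rightarrow> real) set" where
  "cube n = {..<n} \<rightarrow>\<^sub>E {-1, 1}"

definition cube_edge :: "nat \<Rightarrow> (nat \<Rightarrow> real) \<Rightarrow> (nat \<Rightarrow> real) \<Rightarrow> bool" where
  "cube_edge n x y \<longleftrightarrow> x \<in> cube n \<and> y \<in> cube n \<and> card {i\<in>{..<n}. x i \<noteq> y i} = 1"

definition cube_inner :: "nat \<Rightarrow> (nat \<Rightarrow> real) \<Rightarrow> (nat \<Rightarrow> real) \<Rightarrow> real" where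
  "cube_inner n x y = (\<Sum>i<n. x i * y i)"

text \<open>Independence is required for each fixed \<open>n\<close>; nothing is assumed about the joint law of
  the Hamiltonians for different \<open>n\<close>.\<close>

definition rem_environment ::
    "'w measure \<Rightarrow> (nat \<Rightarrow> (nat \<Rightarrow> real) \<Rightarrow> 'w \<Rightarrow> real) \<Rightarrow> bool" where
  "rem_environment M H \<longleftrightarrow> prob_space M \<and>
     (\<forall>n\<ge>1. prob_space.indep_vars M (\<lambda>_. borel) (H n) (cube n) \<and>
        (\<forall>x\<in>cube n. distributed M lborel (H n x) (normal_density 0 (sqrt (real n)))))"

definition trap_depth ::
    "(nat \<Rightarrow> (nat \<Rightarrow> real) \<Rightarrow> 'w \<Rightarrow> real) \<Rightarrow> real \<Rightarrow> nat \<Rightarrow> 'w \<Rightarrow> (nat \<Rightarrow> real) \<Rightarrow> real" where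
  "trap_depth H \<beta> n \<omega> x = exp (- \<beta> * H n x \<omega>)"

definition jump_rate ::
    "(nat \<Rightarrow> (nat \<Rightarrow> real) \<Rightarrow> 'w \<Rightarrow> real) \<Rightarrow> real \<Rightarrow> nat \<Rightarrow> 'w \<Rightarrow>
      (nat \<Rightarrow> real) \<Rightarrow> (nat \<Rightarrow> real) \<Rightarrow> real" where
  "jump_rate H \<beta> n \<omega> x y =
     (if cube_edge n x y then 1 / (real n * trap_depth H \<beta> n \<omega> x) else 0)"

definition gibbs ::
    "(nat \<Rightarrow> (nat \<Rightarrow> real) \<Rightarrow> 'w \<Rightarrow> real) \<Rightarrow> real \<Rightarrow> nat \<Rightarrow> 'w \<Rightarrow> (nat \<Rightarrow> real) \<Rightarrow> real" where
  "gibbs H \<beta> n \<omega> x = trap_depth H \<beta> n \<omega> x / (\<Sum>y\<in>cube n. trap_depth H \<beta> n \<omega> y)"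

definition cube_uniform :: "nat \<Rightarrow> 'w \<Rightarrow> (nat \<Rightarrow> real) \<Rightarrow> real" where
  "cube_uniform n \<omega> x = 1 / real (card (cube n))"

text \<open>Transition functions on a finite state space \<open>V\<close> with off-diagonal rates \<open>q\<close>. The
  behaviour of the diagonal at 0 follows from stochasticity.\<close>

definition transition_function ::
    "'v set \<Rightarrow> ('v \<Rightarrow> 'v \<Rightarrow> real) \<Rightarrow> (real \<Rightarrow> 'v \<Rightarrow> 'v \<Rightarrow> real) \<Rightarrow> bool" where
  "transition_function V q p \<longleftrightarrow>
     (\<forall>t\<ge>0. \<forall>x\<in>V. (\<forall>y\<in>V. 0 \<le> p t x y) \<and> (\<Sum>y\<in>V. p t x y) = 1) \<and>
     (\<forall>x\<in>V. \<forall>y\<in>V. p 0 x y = of_bool (x = y)) \<and>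
     (\<forall>s\<ge>0. \<forall>t\<ge>0. \<forall>x\<in>V. \<forall>y\<in>V. p (s + t) x y = (\<Sum>z\<in>V. p s x z * p t z y)) \<and>
     (\<forall>x\<in>V. \<forall>y\<in>V. x \<noteq> y \<longrightarrow> ((\<lambda>h. p h x y / h) \<longlongrightarrow> q x y) (at_right 0))"

text \<open>Right-continuous with left limits, for the discrete topology on the state space.\<close>

definition jump_path :: "(real \<Rightarrow> 'v) \<Rightarrow> bool" where
  "jump_path f \<longleftrightarrow>
     (\<forall>t\<ge>0. \<forall>\<^sub>F u in at_right t. f u = f t) \<and>
     (\<forall>t>0. \<exists>y. \<forall>\<^sub>F u in at_left t. f u = y)"

definition markov_jump_process ::
    "'p measure \<Rightarrow> 'v set \<Rightarrow> ('v \<Rightarrow> 'v \<Rightarrow> real) \<Rightarrow> ('v \<Rightarrow> real) \<Rightarrow> (real \<Rightarrow> 'p \<Rightarrow> 'v) \<Rightarrow> bool" where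
  "markov_jump_process P V q \<mu> X \<longleftrightarrow> prob_space P \<and>
     (\<forall>t\<ge>0. X t \<in> measurable P (count_space V)) \<and>
     (\<forall>w\<in>space P. jump_path (\<lambda>t. X t w)) \<and>
     (\<exists>p. transition_function V q p \<and>
        (\<forall>m (T :: nat \<Rightarrow> real) z. T 0 = 0 \<and> mono T \<and> (\<forall>i\<le>m. z i \<in> V) \<longrightarrow>
           measure P {w\<in>space P. \<forall>i\<le>m. X (T i) w = z i} =
             \<mu> (z 0) * (\<Prod>i<m. p (T (Suc i) - T i) (z i) (z (Suc i)))))"

text \<open>For every realization \<open>\<omega>\<close> of the environment, \<open>P n \<omega>\<close> is a probability space carrying the
  process \<open>X n \<omega>\<close> with initial distribution \<open>\<mu> n \<omega>\<close>.\<close>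

definition rem_dynamics ::
    "'w measure \<Rightarrow> (nat \<Rightarrow> (nat \<Rightarrow> real) \<Rightarrow> 'w \<Rightarrow> real) \<Rightarrow> real \<Rightarrow>
      (nat \<Rightarrow> 'w \<Rightarrow> (nat \<Rightarrow> real) \<Rightarrow> real) \<Rightarrow>
      (nat \<Rightarrow> 'w \<Rightarrow> 'p measure) \<Rightarrow> (nat \<Rightarrow> 'w \<Rightarrow> real \<Rightarrow> 'p \<Rightarrow> nat \<Rightarrow> real) \<Rightarrow> bool" where
  "rem_dynamics M H \<beta> \<mu> P X \<longleftrightarrow>
     (\<forall>n\<ge>1. \<forall>\<omega>\<in>space M.
        markov_jump_process (P n \<omega>) (cube n) (jump_rate H \<beta> n \<omega>) (\<mu> n \<omega>) (X n \<omega>))"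

definition correlation ::
    "(nat \<Rightarrow> 'w \<Rightarrow> 'p measure) \<Rightarrow> (nat \<Rightarrow> 'w \<Rightarrow> real \<Rightarrow> 'p \<Rightarrow> nat \<Rightarrow> real) \<Rightarrow>
      (nat \<Rightarrow> real) \<Rightarrow> nat \<Rightarrow> real \<Rightarrow> real \<Rightarrow> 'w \<Rightarrow> real" where
  "correlation P X c n t s \<omega> =
     measure (P n \<omega>) {w\<in>space (P n \<omega>). \<forall>u. t \<le> u \<and> u < t + s \<longrightarrow>
        cube_inner n (X n \<omega> (c n * t) w) (X n \<omega> (c n * u) w) / real n = 1}"

definition extreme_time_scale ::
    "'w measure \<Rightarrow> (nat \<Rightarrow> (nat \<Rightarrow> real) \<Rightarrow> 'w \<Rightarrow> real) \<Rightarrow> real \<Rightarrow> (nat \<Rightarrow> real) \<Rightarrow> real \<Rightarrow> bool" where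
  "extreme_time_scale M H \<beta> c \<epsilon> \<longleftrightarrow> filterlim c at_top sequentially \<and> 0 < \<epsilon> \<and>
     (\<exists>a :: nat \<Rightarrow> real.
        (\<forall>n\<ge>1. \<forall>x\<in>cube n. a n * measure M {\<omega>\<in>space M. trap_depth H \<beta> n \<omega> x \<ge> c n} = 1) \<and>
        (\<lambda>n. a n / 2 ^ n) \<longlonglongrightarrow> \<epsilon>)"

definition poisson_random_measure ::
    "'g measure \<Rightarrow> 'a measure \<Rightarrow> ('g \<Rightarrow> 'a measure) \<Rightarrow> bool" where
  "poisson_random_measure Q \<mu> N \<longleftrightarrow> prob_space Q \<and>
     (\<forall>\<omega>\<in>space Q. sets (N \<omega>) = sets \<mu>) \<and>
     (\<forall>A\<in>sets \<mu>. (\<lambda>\<omega>. emeasure (N \<omega>) A) \<in> borel_measurable Q) \<and>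
     (\<forall>A\<in>sets \<mu>. emeasure \<mu> A < \<infinity> \<longrightarrow>
        (\<forall>k. measure Q {\<omega>\<in>space Q. emeasure (N \<omega>) A = of_nat k} =
             measure \<mu> A ^ k / fact k * exp (- measure \<mu> A))) \<and>
     (\<forall>A\<in>sets \<mu>. emeasure \<mu> A = \<infinity> \<longrightarrow> (AE \<omega> in Q. emeasure (N \<omega>) A = \<infinity>)) \<and>
     (\<forall>A :: nat \<Rightarrow> 'a set. range A \<subseteq> sets \<mu> \<and> disjoint_family A \<longrightarrow>
        prob_space.indep_vars Q (\<lambda>_. borel) (\<lambda>i \<omega>. emeasure (N \<omega>) (A i)) UNIV)"

text \<open>The points \<open>\<gamma> k\<close>, numbered from 0, of a Poisson random measure: the image of the counting
  measure under \<open>k \<mapsto> \<gamma> k \<omega>\<close> is the sum of the Dirac masses at the points.\<close>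

definition poisson_marks ::
    "'g measure \<Rightarrow> real measure \<Rightarrow> (nat \<Rightarrow> 'g \<Rightarrow> real) \<Rightarrow> bool" where
  "poisson_marks Q \<mu> \<gamma> \<longleftrightarrow>
     (\<forall>k. \<gamma> k \<in> measurable Q (restrict_space borel {0<..})) \<and>
     poisson_random_measure Q \<mu>
       (\<lambda>\<omega>. distr (count_space UNIV) (restrict_space borel {0<..}) (\<lambda>k. \<gamma> k \<omega>))"

definition C_sta :: "(nat \<Rightarrow> 'g \<Rightarrow> real) \<Rightarrow> real \<Rightarrow> 'g \<Rightarrow> real" where
  "C_sta \<gamma> s \<omega> = (\<Sum>k. \<gamma> k \<omega> / (\<Sum>l. \<gamma> l \<omega>) * exp (- s / \<gamma> k \<omega>))"

text \<open>In the limit theorem the points \<open>\<gamma>\<close> have mean measure \<open>\<mu>(x,\<infinity>) = x\<^sup>-\<^sup>\<alpha> / \<epsilon>\<close>, with the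
  constant \<open>\<epsilon>\<close> of the extreme time-scale. The usual normalization \<open>x\<^sup>-\<^sup>\<alpha>\<close> is the case \<open>\<epsilon> = 1\<close>;
  it cannot be used for every \<open>\<epsilon>\<close>. Indeed, if \<open>c\<close> is an extreme time-scale with constant \<open>\<epsilon>\<close>
  and \<open>\<kappa> > 0\<close>, then \<open>\<kappa> c\<close> is one with constant \<open>\<kappa>\<^sup>\<alpha> \<epsilon>\<close>, and its correlation function at
  \<open>(t, s)\<close> is that of \<open>c\<close> at \<open>(\<kappa> t, \<kappa> s)\<close>, so that the limit law depends on \<open>\<epsilon>\<close>. The
  factor is the one for which \<open>\<mu>(x,\<infinity>)\<close> is the limit of the expected number of
  vertices of depth at least \<open>c n * x\<close>; for \<open>x = 1\<close> this number is \<open>2\<^sup>n / a n\<close>.\<close>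

end

theory Submission imports Defs "HOL-Real_Asymp.Real_Asymp" begin

text \<open>Expanding in Walsh functions, the Green kernel of the random walk on the cube is the
  identity minus the average, up to an error that vanishes uniformly in all entries. Hence, after
  rescaling time by the time-scale, the Laplace transform in the age of the correlation function
  started from the uniform distribution is, up to a vanishing error, a quotient of sums of explicit
  functions of the rescaled trap depths. To undo the transform one needs regularity in the age that
  is uniform in the volume: by reversibility the increments of the correlation function are
  controlled by the return energy of the uniform start, which is decreasing and midpoint convex.
  The same energy bound shows that the correlation function is close to the Gibbs average for large
  ages; the Gibbs start itself is stationary. It remains to pass to the limit in finitely many sums
  over the rescaled trap depths: their joint Laplace functionals converge to those of the Poisson
  points by tilting the Gaussian density, and Stone-Weierstrass upgrades this to joint convergence
  in law.\<close>

section \<open>The random walk on the cube\<close>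

text \<open>The error of the Green kernel has order at most \<open>n\<close> to the power -1/2 and
  is multiplied by the total rescaled depth, which stays tight because \<open>\<alpha> < 1\<close>.
  So the geometry of the cube disappears in the limit and only sums of one-site functions remain.
  The price is that the age dependence is first known through Laplace transforms, whose inversion at
  a point is not continuous: the inverting polynomial has to be fixed before the volume, and the
  modulus of continuity in the age must hold with high probability for all large volumes. Since
  nothing relates the environments of different volumes, no almost sure limit is available. All
  comparisons are therefore made in expectation, for ramp functions of the correlation function and
  for remainders truncated at 1. For the uniform start the limit law at a fixed age is never
  identified; it comes from tightness and the convergence of ramp integrals, and is compared with
  the Gibbs average only for large ages.\<close>

definition flip :: "nat \<Rightarrow> (nat \<Rightarrow> real) \<Rightarrow> nat \<Rightarrow> real" where
  "flip i x = x(i := - x i)"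

definition cube_laplacian :: "nat \<Rightarrow> ((nat \<Rightarrow> real) \<Rightarrow> real) \<Rightarrow> (nat \<Rightarrow> real) \<Rightarrow> real" where
  "cube_laplacian n v x = (\<Sum>i<n. v (flip i x) - v x) / real n"

definition walsh :: "nat set \<Rightarrow> (nat \<Rightarrow> real) \<Rightarrow> real" where
  "walsh S x = (\<Prod>i\<in>S. x i)"

text \<open>The Walsh function of \<open>S\<close> is an eigenvector of minus the Laplacian with
  eigenvalue 2|S|/n, so on it the identity minus the inverse acts as 1 - n/(2|S|). Walsh functions
  have modulus 1; hence this average of absolute values bounds every entry of the difference kernel
  on mean-zero functions.\<close>

definition cube_gap :: "nat \<Rightarrow> real" where
  "cube_gap n = (\<Sum>S\<in>Pow {..<n} - {{}}. \<bar>1 - real n / (2 * real (card S))\<bar>) / 2 ^ n"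

lemma finite_cube [simp]: "finite (cube n)"
  by (simp add: cube_def finite_PiE)

lemma card_cube: "card (cube n) = 2 ^ n"
  by (simp add: cube_def card_PiE numeral_2_eq_2)

lemma cube_nonempty [simp]: "cube n \<noteq> {}"
  using card_cube[of n] by auto

lemma cube_square: "x \<in> cube n \<Longrightarrow> i < n \<Longrightarrow> x i * x i = 1"
  by (auto simp: cube_def PiE_def Pi_def)

lemma flip_in_cube: "x \<in> cube n \<Longrightarrow> i < n \<Longrightarrow> flip i x \<in> cube n"
  by (auto simp: cube_def flip_def PiE_def Pi_def extensional_def)

lemma flip_flip [simp]: "flip i (flip i x) = x"
  by (auto simp: flip_def)

lemma sum_flip: "i < n \<Longrightarrow> (\<Sum>x\<in>cube n. F (flip i x)) = (\<Sum>x\<in>cube n. F x)"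
  by (rule sum.reindex_bij_witness[of _ "flip i" "flip i"]) (auto simp: flip_in_cube)

text \<open>Each flip is an involution of the cube, so under the sum it can be moved from one factor
  to the other.\<close>

lemma cube_laplacian_symmetric:
  "(\<Sum>x\<in>cube n. u x * cube_laplacian n v x) = (\<Sum>x\<in>cube n. cube_laplacian n u x * v x)"
proof -
  have "(\<Sum>x\<in>cube n. u x * v (flip i x)) = (\<Sum>x\<in>cube n. u (flip i x) * v x)" if "i < n" for i
    using sum_flip[OF that, of "\<lambda>x. u (flip i x) * v x"] by simp
  then have "(\<Sum>i<n. \<Sum>x\<in>cube n. u x * (v (flip i x) - v x)) =
      (\<Sum>i<n. \<Sum>x\<in>cube n. (u (flip i x) - u x) * v x)"
    by (intro sum.cong[of "{..<n}"] refl) (simp add: right_diff_distrib left_diff_distrib sum_subtractf)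
  then show ?thesis
    by (simp add: cube_laplacian_def sum_distrib_left sum_distrib_right sum_divide_distrib[symmetric]
        sum.swap[of _ "{..<n}"])
qed

lemma sum_cube_laplacian: "(\<Sum>x\<in>cube n. cube_laplacian n v x) = 0"
  using cube_laplacian_symmetric[of "\<lambda>_. 1" n v] by (simp add: cube_laplacian_def)

lemma walsh_flip:
  "finite S \<Longrightarrow> walsh S (flip i x) = (if i \<in> S then - walsh S x else walsh S x)"
  by (cases "i \<in> S") (auto simp: walsh_def flip_def prod.remove[of S i] intro!: prod.cong)

lemma abs_walsh: "x \<in> cube n \<Longrightarrow> S \<subseteq> {..<n} \<Longrightarrow> \<bar>walsh S x\<bar> = 1"
  unfolding walsh_def abs_prod
  by (rule prod.neutral) (auto simp: cube_def PiE_def Pi_def)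

lemma cube_laplacian_walsh:
  assumes "S \<subseteq> {..<n}"
  shows "cube_laplacian n (walsh S) x = - (2 * real (card S) / real n) * walsh S x"
proof -
  have fin: "finite S" using assms finite_subset by blast
  have "(\<Sum>i<n. walsh S (flip i x) - walsh S x) = (\<Sum>i<n. if i \<in> S then - 2 * walsh S x else 0)"
    by (intro sum.cong) (auto simp: walsh_flip[OF fin])
  also have "\<dots> = - 2 * real (card S) * walsh S x"
    using assms by (simp add: sum.If_cases Int_absorb1)
  finally show ?thesis by (simp add: cube_laplacian_def)
qed

text \<open>The sum over subsets factorizes into the product of the 1 + x_i y_i, and one differing
  coordinate makes a factor vanish.\<close>

lemma walsh_complete:
  assumes "x \<in> cube n" "y \<in> cube n"
  shows "(\<Sum>S\<in>Pow {..<n}. walsh S x * walsh S y) = (if x = y then 2 ^ n else 0)"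
proof -
  have "(\<Sum>S\<in>Pow {..<n}. walsh S x * walsh S y) = (\<Prod>i<n. x i * y i + 1)"
    by (subst prod_add) (auto simp: walsh_def prod.distrib)
  also have "\<dots> = (if x = y then 2 ^ n else 0)"
  proof (cases "x = y")
    case True
    then show ?thesis using assms by (simp add: cube_square)
  next
    case False
    then obtain i where "x i \<noteq> y i" by auto
    \<comment> \<open>Beyond \<open>n\<close> both vertices are \<open>undefined\<close>, so a
      differing coordinate must lie below \<open>n\<close>.\<close>
    moreover from this have "i < n"
      using assms unfolding cube_def by (metis PiE_arb lessThan_iff)
    ultimately have "x i * y i + 1 = 0" "i < n"
      using assms by (fastforce simp: cube_def PiE_def Pi_def)+
    then show ?thesis using False by (auto intro!: prod_zero)
  qed
  finally show ?thesis .
qed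

lemma walsh_expansion:
  assumes "x \<in> cube n"
  shows "2 ^ n * v x = (\<Sum>S\<in>Pow {..<n}. walsh S x * (\<Sum>y\<in>cube n. walsh S y * v y))"
proof -
  have "(\<Sum>S\<in>Pow {..<n}. walsh S x * (\<Sum>y\<in>cube n. walsh S y * v y)) =
      (\<Sum>y\<in>cube n. (\<Sum>S\<in>Pow {..<n}. walsh S x * walsh S y) * v y)"
    by (simp add: sum_distrib_left sum_distrib_right mult.assoc, rule sum.swap)
  also have "\<dots> = (\<Sum>y\<in>cube n. if x = y then 2 ^ n * v y else 0)"
    using assms by (intro sum.cong) (auto simp: walsh_complete)
  finally show ?thesis using assms by simp
qed

text \<open>The Green kernel of the random walk on the cube is the identity minus the averaging
  operator, up to an error that is uniformly small in all its entries.\<close>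

lemma cube_green:
  assumes n: "n \<ge> 1" and x: "x \<in> cube n"
  shows "\<bar>v x - (\<Sum>y\<in>cube n. v y) / 2 ^ n + cube_laplacian n v x\<bar> \<le>
    cube_gap n * (\<Sum>y\<in>cube n. \<bar>cube_laplacian n v y\<bar>)"
proof -
  define d where "d = (\<lambda>S. \<Sum>y\<in>cube n. walsh S y * cube_laplacian n v y)"
  define c where "c = (\<lambda>S. \<Sum>y\<in>cube n. walsh S y * v y)"
  define L where "L = (\<Sum>y\<in>cube n. \<bar>cube_laplacian n v y\<bar>)"
  let ?P = "Pow {..<n} - {{}}"
  have d: "d S = - (2 * real (card S) / real n) * c S" if "S \<subseteq> {..<n}" for S
    unfolding d_def c_def cube_laplacian_symmetric cube_laplacian_walsh[OF that]
    by (simp add: sum_distrib_left sum_negf sum_divide_distrib mult_ac)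
  have c: "c S = - (real n / (2 * real (card S))) * d S" if "S \<in> ?P" for S
  proof -
    have "card S \<noteq> 0" using that finite_subset by fastforce
    then show ?thesis using d[of S] that n by (auto simp: field_simps)
  qed
  have dL: "\<bar>d S\<bar> \<le> L" if "S \<subseteq> {..<n}" for S
    unfolding d_def L_def using that
    by (intro order_trans[OF sum_abs] sum_mono) (simp add: abs_mult abs_walsh)
  have P: "Pow {..<n} = insert {} ?P" by auto
  have d0: "d {} = 0" using d[of "{}"] by simp
  have split: "(\<Sum>S\<in>Pow {..<n}. walsh S x * e S) = e {} + (\<Sum>S\<in>?P. walsh S x * e S)" for e
    by (subst P, subst sum.insert) (auto simp: walsh_def)
  \<comment> \<open>The coefficient of the empty set is the sum of \<open>v\<close>; removing it
    leaves the frequencies on which the Laplacian can be inverted.\<close>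
  have "2 ^ n * v x = c {} + (\<Sum>S\<in>?P. walsh S x * c S)"
    using walsh_expansion[OF x, of v] split[of c] by (simp only: c_def)
  moreover have "2 ^ n * cube_laplacian n v x = (\<Sum>S\<in>?P. walsh S x * d S)"
    using walsh_expansion[OF x, of "cube_laplacian n v"] split[of d] d0 by (simp add: d_def)
  ultimately have "2 ^ n * (v x - c {} / 2 ^ n + cube_laplacian n v x) =
      (\<Sum>S\<in>?P. walsh S x * c S + walsh S x * d S)"
    by (simp add: distrib_left right_diff_distrib sum.distrib)
  also have "\<dots> = (\<Sum>S\<in>?P. walsh S x * ((1 - real n / (2 * real (card S))) * d S))"
  proof (intro sum.cong refl)
    fix S assume "S \<in> ?P"
    show "walsh S x * c S + walsh S x * d S = walsh S x * ((1 - real n / (2 * real (card S))) * d S)"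
      unfolding c[OF \<open>S \<in> ?P\<close>] by (simp add: left_diff_distrib right_diff_distrib)
  qed
  also have "\<bar>\<dots>\<bar> \<le> (\<Sum>S\<in>?P. \<bar>1 - real n / (2 * real (card S))\<bar> * L)"
    using x by (intro order_trans[OF sum_abs] sum_mono)
      (auto simp: abs_mult abs_walsh intro!: mult_left_mono dL)
  finally have "2 ^ n * \<bar>v x - c {} / 2 ^ n + cube_laplacian n v x\<bar> \<le> 2 ^ n * (cube_gap n * L)"
    by (simp add: abs_mult cube_gap_def sum_distrib_right)
  then show ?thesis
    by (simp add: c_def walsh_def L_def)
qed

section \<open>Binomial moments and the decay of the gap\<close>

lemma sum_Pow_card:
  "(\<Sum>S\<in>Pow {..<n}. F (card S)) = (\<Sum>k\<le>n. real (n choose k) * F k)" for F :: "nat \<Rightarrow> real"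
proof -
  have "(\<Sum>S\<in>Pow {..<n}. F (card S)) =
      (\<Sum>k\<le>n. \<Sum>S\<in>{S \<in> Pow {..<n}. card S = k}. F (card S))"
    using card_mono[of "{..<n}"] by (intro sum.group[symmetric]) auto
  also have "\<dots> = (\<Sum>k\<le>n. real (n choose k) * F k)"
    using n_subsets[of "{..<n}"] by (intro sum.cong) auto
  finally show ?thesis .
qed

text \<open>This is the variance of the symmetric binomial law, whose weights are the Bernstein
  polynomials at 1/2.\<close>

lemma sum_binomial_square: "(\<Sum>k\<le>n. real (n choose k) * (2 * real k - real n)\<^sup>2) = real n * 2 ^ n"
proof -
  have B: "Bernstein n k (1/2) = real (n choose k) / 2 ^ n" if "k \<le> n" for k
    using that by (simp add: Bernstein_def power_add[symmetric] power_divide)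
  have "(\<Sum>k\<le>n. real (n choose k) * (2 * real k - real n)\<^sup>2) / 2 ^ n =
      (\<Sum>k\<le>n. (2 * real k - real n)\<^sup>2 * Bernstein n k (1/2))"
    by (simp add: sum_divide_distrib B mult.commute)
  also have "\<dots> = 4 * (\<Sum>k\<le>n. real k * (real k - 1) * Bernstein n k (1/2))
      + (4 - 4 * real n) * (\<Sum>k\<le>n. real k * Bernstein n k (1/2))
      + (real n)\<^sup>2 * (\<Sum>k\<le>n. Bernstein n k (1/2))"
    unfolding sum_distrib_left sum.distrib[symmetric]
    by (intro sum.cong refl) (simp add: power2_eq_square algebra_simps)
  also have "\<dots> = real n"
    unfolding sum_k_Bernstein sum_kk_Bernstein sum_Bernstein
    by (simp add: power2_eq_square field_simps)
  finally show ?thesis by (simp add: field_simps)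
qed

text \<open>For \<open>k \<ge> 1\<close> the square of \<open>k\<close> is at least (k + 1)(k +
  2)/6, and dividing a binomial coefficient by (k + 1)(k + 2) gives one of order n + 2 over (n +
  1)(n + 2). Those add up to at most 4 * 2^n, whence the constant 24.\<close>

lemma sum_binomial_inverse_square:
  "(\<Sum>k\<in>{1..n}. real (n choose k) / (real k)\<^sup>2) \<le> 24 * 2 ^ n / (real (n + 1) * real (n + 2))"
proof -
  have pt: "real (n choose k) / (real k)\<^sup>2 \<le>
      6 * real (n + 2 choose (k + 2)) / (real (n + 1) * real (n + 2))" if "k \<in> {1..n}" for k
  proof -
    have "(k + 2) * (n + 2 choose (k + 2)) = (n + 2) * (n + 1 choose (k + 1))"
      using Suc_times_binomial_eq[of "n+1" "k+1"] by (simp add: mult_ac)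
    moreover have "(k + 1) * (n + 1 choose (k + 1)) = (n + 1) * (n choose k)"
      using Suc_times_binomial_eq[of n k] by (simp add: mult_ac)
    ultimately have "(k + 1) * (k + 2) * (n + 2 choose (k + 2)) = (n + 1) * (n + 2) * (n choose k)"
      by (metis (no_types, lifting) mult.assoc mult.left_commute)
    then have eq: "real (n + 2 choose (k + 2)) * ((real k + 1) * (real k + 2)) =
        real (n + 1) * real (n + 2) * real (n choose k)"
      by (metis (no_types, opaque_lifting) mult.commute of_nat_1 of_nat_add of_nat_mult
          of_nat_numeral)
    have "(real k + 1) * (real k + 2) \<le> 6 * (real k)\<^sup>2"
    proof -
      have "real k \<le> (real k)\<^sup>2" "1 \<le> (real k)\<^sup>2"
        using that by (auto simp: power2_eq_square intro: order_trans[OF _ mult_right_mono[of 1]])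
      then show ?thesis by (simp add: algebra_simps power2_eq_square)
    qed
    then have "real (n + 2 choose (k + 2)) * ((real k + 1) * (real k + 2)) \<le>
        real (n + 2 choose (k + 2)) * (6 * (real k)\<^sup>2)"
      by (intro mult_left_mono) auto
    then have "real (n + 1) * real (n + 2) * real (n choose k) \<le>
        6 * real (n + 2 choose (k + 2)) * (real k)\<^sup>2"
      unfolding eq by (simp only: mult_ac)
    moreover have "0 < real k" "0 < real (n + 1) * real (n + 2)"
      using that by auto
    ultimately show ?thesis
      by (simp add: divide_simps mult_ac del: of_nat_add binomial_Suc_Suc add_2_eq_Suc')
  qed
  have "(\<Sum>k\<in>{1..n}. real (n + 2 choose (k + 2))) = (\<Sum>k\<in>{3..n+2}. real (n + 2 choose k))"
    by (rule sum.reindex_bij_witness[of _ "\<lambda>k. k - 2" "\<lambda>k. k + 2"]) auto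
  also have "\<dots> \<le> (\<Sum>k\<le>n+2. real (n + 2 choose k))"
    by (rule sum_mono2) auto
  also have "\<dots> = 4 * 2 ^ n"
    using choose_row_sum[of "n+2"] by (simp flip: of_nat_sum)
  finally have "(\<Sum>k\<in>{1..n}. real (n + 2 choose (k + 2))) \<le> 4 * 2 ^ n" .
  then have "6 * (\<Sum>k\<in>{1..n}. real (n + 2 choose (k + 2))) / (real (n + 1) * real (n + 2)) \<le>
      6 * (4 * 2 ^ n) / (real (n + 1) * real (n + 2))"
    by (intro divide_right_mono mult_left_mono) auto
  then show ?thesis
    using sum_mono[OF pt, of "{1..n}" "\<lambda>k. k"]
    by (simp add: sum_distrib_left[symmetric] sum_divide_distrib[symmetric] del: of_nat_add)
qed

lemma cube_gap_nonneg: "0 \<le> cube_gap n"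
  by (auto simp: cube_gap_def intro!: divide_nonneg_nonneg sum_nonneg)

text \<open>Writing 1 - n/(2k) as (2k - n)/(2k), Cauchy-Schwarz separates a variance of order n from
  an inverse second moment of order 1/n^2, both relative to 2^n subsets.\<close>

lemma cube_gap_square:
  assumes n: "n \<ge> 1"
  shows "(cube_gap n)\<^sup>2 \<le> 6 / real n"
proof -
  let ?P = "Pow {..<n} - {{}}"
  have cs: "card S \<noteq> 0" if "S \<in> ?P" for S using that finite_subset by fastforce
  have "2 ^ n * cube_gap n =
      (\<Sum>S\<in>?P. \<bar>2 * real (card S) - real n\<bar> * (1 / (2 * real (card S))))"
  proof -
    have "\<bar>1 - real n / (2 * real (card S))\<bar> = \<bar>2 * real (card S) - real n\<bar> * (1 / (2 * real (card S)))"
      if "S \<in> ?P" for S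
    proof -
      have "1 - real n / (2 * real (card S)) = (2 * real (card S) - real n) / (2 * real (card S))"
        using cs[OF that] by (simp add: field_simps)
      then show ?thesis by (simp only: abs_divide) simp
    qed
    then show ?thesis unfolding cube_gap_def by simp
  qed
  then have "(2 ^ n * cube_gap n)\<^sup>2 \<le> (\<Sum>S\<in>?P. \<bar>2 * real (card S) - real n\<bar>\<^sup>2) *
      (\<Sum>S\<in>?P. (1 / (2 * real (card S)))\<^sup>2)"
    by (simp only: Cauchy_Schwarz_ineq_sum)
  also have "\<dots> \<le> (real n * 2 ^ n) * (6 * 2 ^ n / (real (n + 1) * real (n + 2)))"
  proof (intro mult_mono)
    have "(\<Sum>S\<in>?P. \<bar>2 * real (card S) - real n\<bar>\<^sup>2) \<le>
        (\<Sum>S\<in>Pow {..<n}. (2 * real (card S) - real n)\<^sup>2)"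
      unfolding power2_abs by (rule sum_mono2) auto
    then show "(\<Sum>S\<in>?P. \<bar>2 * real (card S) - real n\<bar>\<^sup>2) \<le> real n * 2 ^ n"
      using sum_Pow_card[of "\<lambda>k. (2 * real k - real n)\<^sup>2" n] unfolding sum_binomial_square by linarith
    have "(\<Sum>S\<in>?P. (1 / (2 * real (card S)))\<^sup>2) =
        (\<Sum>S\<in>Pow {..<n}. if card S = 0 then 0 else 1 / (4 * (real (card S))\<^sup>2))"
      using cs by (intro sum.mono_neutral_cong_left) (auto simp: power_divide power_mult_distrib)
    also have "\<dots> = (\<Sum>k\<le>n. real (n choose k) * (if k = 0 then 0 else 1 / (4 * (real k)\<^sup>2)))"
      using sum_Pow_card[of "\<lambda>k. if k = 0 then 0 else 1 / (4 * (real k)\<^sup>2)" n] .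
    also have "\<dots> = (\<Sum>k\<in>{1..n}. real (n choose k) / (real k)\<^sup>2) / 4"
      unfolding sum_divide_distrib by (rule sum.mono_neutral_cong_right) auto
    also have "\<dots> \<le> 6 * 2 ^ n / (real (n + 1) * real (n + 2))"
      using sum_binomial_inverse_square[of n] by simp
    finally show "(\<Sum>S\<in>?P. (1 / (2 * real (card S)))\<^sup>2) \<le> 6 * 2 ^ n / (real (n + 1) * real (n + 2))" .
  qed (auto intro!: sum_nonneg)
  also have "\<dots> = (2 ^ n)\<^sup>2 * (6 * (real n / (real (n + 1) * real (n + 2))))"
    by (simp add: power2_eq_square)
  also have "\<dots> \<le> (2 ^ n)\<^sup>2 * (6 * (1 / real n))"
  proof (intro mult_left_mono)
    have "real n * real n \<le> real (n + 1) * real (n + 2)" by (intro mult_mono) auto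
    then show "real n / (real (n + 1) * real (n + 2)) \<le> 1 / real n"
      using n by (simp add: divide_simps)
  qed auto
  finally have "(2 ^ n)\<^sup>2 * (cube_gap n)\<^sup>2 \<le> (2 ^ n)\<^sup>2 * (6 / real n)"
    by (simp add: power_mult_distrib)
  then show ?thesis by (rule mult_left_le_imp_le) simp
qed

lemma cube_gap_tendsto: "cube_gap \<longlonglongrightarrow> 0"
proof -
  have "(\<lambda>n. (cube_gap n)\<^sup>2) \<longlonglongrightarrow> 0"
  proof (rule tendsto_sandwich[where f = "\<lambda>_. 0" and h = "\<lambda>n. 6 / real n"])
    show "(\<lambda>n. 6 / real n) \<longlonglongrightarrow> 0" by real_asymp
    show "\<forall>\<^sub>F n in sequentially. (cube_gap n)\<^sup>2 \<le> 6 / real n"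
      using eventually_ge_at_top[of 1] by eventually_elim (rule cube_gap_square)
  qed auto
  then show ?thesis by simp
qed

section \<open>Finite reversible Markov chains\<close>

definition kernel_app :: "'v set \<Rightarrow> ('v \<Rightarrow> 'v \<Rightarrow> real) \<Rightarrow> ('v \<Rightarrow> real) \<Rightarrow> 'v \<Rightarrow> real" where
  "kernel_app V K f x = (\<Sum>y\<in>V. K x y * f y)"

definition generator :: "'v set \<Rightarrow> ('v \<Rightarrow> 'v \<Rightarrow> real) \<Rightarrow> 'v \<Rightarrow> 'v \<Rightarrow> real" where
  "generator V q x y = (if x = y then - (\<Sum>z\<in>V - {x}. q x z) else q x y)"

text \<open>For this matrix detailed balance and measurability in the environment can be read off
  from the rates, whereas the transition function is given only through its axioms. Powers of the
  matrix carry both properties over to it.\<close>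

definition euler_step :: "'v set \<Rightarrow> ('v \<Rightarrow> 'v \<Rightarrow> real) \<Rightarrow> real \<Rightarrow> 'v \<Rightarrow> 'v \<Rightarrow> real" where
  "euler_step V q h x y = of_bool (x = y) + h * generator V q x y"

lemma kernel_app_diff: "kernel_app V K (\<lambda>x. f x - g x) x = kernel_app V K f x - kernel_app V K g x"
  by (simp add: kernel_app_def right_diff_distrib sum_subtractf)

lemma kernel_app_bound:
  assumes "\<And>y. y \<in> V \<Longrightarrow> 0 \<le> K x y" "(\<Sum>y\<in>V. K x y) = 1" "\<And>y. y \<in> V \<Longrightarrow> \<bar>f y\<bar> \<le> F"
  shows "\<bar>kernel_app V K f x\<bar> \<le> F"
proof -
  have "\<bar>kernel_app V K f x\<bar> \<le> (\<Sum>y\<in>V. K x y * F)"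
    unfolding kernel_app_def using assms(1,3)
    by (intro order_trans[OF sum_abs] sum_mono) (auto simp: abs_mult intro!: mult_left_mono)
  then show ?thesis by (simp add: sum_distrib_right[symmetric] assms(2))
qed

text \<open>Jensen's inequality: the variance of \<open>f\<close> under the row of \<open>x\<close>
  is nonnegative.\<close>

lemma kernel_app_square_le:
  assumes "\<And>y. y \<in> V \<Longrightarrow> 0 \<le> K x y" "(\<Sum>y\<in>V. K x y) = 1"
  shows "(kernel_app V K f x)\<^sup>2 \<le> kernel_app V K (\<lambda>y. (f y)\<^sup>2) x"
proof -
  define m where "m = kernel_app V K f x"
  have "0 \<le> (\<Sum>y\<in>V. K x y * (f y - m)\<^sup>2)"
    using assms(1) by (intro sum_nonneg) auto
  also have "\<dots> = (\<Sum>y\<in>V. K x y * (f y)\<^sup>2) - 2 * m * (\<Sum>y\<in>V. K x y * f y) + m\<^sup>2 * (\<Sum>y\<in>V. K x y)"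
    by (simp add: power2_eq_square algebra_simps sum.distrib sum_subtractf sum_distrib_left)
  also have "\<dots> = kernel_app V K (\<lambda>y. (f y)\<^sup>2) x - m\<^sup>2"
    by (simp add: assms(2) m_def kernel_app_def power2_eq_square)
  finally show ?thesis by (simp add: m_def)
qed

lemma sum_euler_step:
  assumes "finite V" "x \<in> V"
  shows "(\<Sum>y\<in>V. euler_step V q h x y) = 1"
proof -
  have "(\<Sum>y\<in>V. generator V q x y) = 0"
  proof -
    have "(\<Sum>y\<in>V - {x}. generator V q x y) = (\<Sum>y\<in>V - {x}. q x y)"
      by (intro sum.cong) (auto simp: generator_def)
    then show ?thesis using assms by (simp only: sum.remove[of V x]) (simp add: generator_def)
  qed
  then show ?thesis
    using assms by (simp add: euler_step_def sum.distrib sum_distrib_left[symmetric])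
qed

text \<open>On [0, 1/l] the weight is at least exp (-1) and \<open>K\<close> is at least its value
  at the right end; the rest of the integral is nonnegative. For monotone functions this turns
  transform bounds into pointwise ones.\<close>

lemma antitone_le_laplace:
  fixes K :: "real \<Rightarrow> real"
  assumes "l > 0" and anti: "\<And>s t. 0 \<le> s \<Longrightarrow> s \<le> t \<Longrightarrow> K t \<le> K s" and pos: "\<And>t. 0 \<le> t \<Longrightarrow> 0 \<le> K t"
    and int: "set_integrable lborel {0..} (\<lambda>t. exp (- l * t) * K t)"
  shows "K (1 / l) \<le> exp 1 * l * (LINT t:{0..}|lborel. exp (- l * t) * K t)"
proof -
  have "(LINT t:{0..1/l}|lborel. exp (-1) * K (1 / l)) \<le> (LINT t:{0..}|lborel. exp (- l * t) * K t)"
    unfolding set_lebesgue_integral_def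
  proof (rule integral_mono)
    show "integrable lborel (\<lambda>t. indicat_real {0..1/l} t *\<^sub>R (exp (-1) * K (1 / l)))"
      by (intro integrable_scaleR_left integrable_real_indicator) (use \<open>l > 0\<close> in auto)
    show "integrable lborel (\<lambda>t. indicat_real {0..} t *\<^sub>R (exp (- l * t) * K t))"
      using int by (simp add: set_integrable_def)
    fix t :: real
    show "indicat_real {0..1/l} t *\<^sub>R (exp (-1) * K (1 / l)) \<le> indicat_real {0..} t *\<^sub>R (exp (- l * t) * K t)"
    proof (cases "t \<in> {0..1/l}")
      case True
      then have "l * t \<le> 1" using \<open>l > 0\<close> by (simp add: field_simps)
      then have "exp (-1) * K (1 / l) \<le> exp (- l * t) * K t"
        using True \<open>l > 0\<close> by (intro mult_mono anti pos) auto
      then show ?thesis using True by simp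
    next
      case False
      then show ?thesis using pos[of t] by (auto simp: indicator_def)
    qed
  qed
  also have "(LINT t:{0..1/l}|lborel. exp (-1) * K (1 / l)) = exp (-1) * K (1 / l) / l"
    using \<open>l > 0\<close> by (simp add: set_lebesgue_integral_def)
  finally show ?thesis using \<open>l > 0\<close> by (simp add: field_simps exp_minus)
qed

text \<open>Both facts are the normalization of the exponential density.\<close>

lemma laplace_one:
  fixes l :: real
  assumes "l > 0"
  shows "set_integrable lborel {0..} (\<lambda>t. exp (- l * t))"
    and "(LINT t:{0..}|lborel. exp (- l * t)) = 1 / l"
proof -
  interpret E: prob_space "density lborel (exponential_density l)"
    by (rule prob_space_exponential_density[OF assms])
  have eq: "exponential_density l t = l * (indicat_real {0..} t *\<^sub>R exp (- l * t))" for t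
    by (simp add: exponential_density_def indicator_def mult_ac)
  have "(\<integral>\<^sup>+t. ennreal (exponential_density l t) \<partial>lborel) = ennreal 1"
    using E.emeasure_space_1 by (simp add: emeasure_density)
  then have "has_bochner_integral lborel (exponential_density l) 1"
    by (intro has_bochner_integral_nn_integral) (auto simp: exponential_density_nonneg[OF assms])
  then have "has_bochner_integral lborel (\<lambda>t. (1/l) * exponential_density l t) ((1/l) * 1)"
    by (rule has_bochner_integral_mult_right)
  then have "has_bochner_integral lborel (\<lambda>t. indicat_real {0..} t *\<^sub>R exp (- l * t)) (1/l)"
    using assms by (simp add: eq)
  then show "set_integrable lborel {0..} (\<lambda>t. exp (- l * t))"
      "(LINT t:{0..}|lborel. exp (- l * t)) = 1 / l"
    by (auto simp: set_integrable_def set_lebesgue_integral_def has_bochner_integral_iff)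
qed

lemma laplace_integrable:
  fixes l :: real
  assumes "l > 0" and F: "\<And>t. t \<ge> 0 \<Longrightarrow> \<bar>u t\<bar> \<le> F" and cont: "continuous_on {0..} u"
  shows "set_integrable lborel {0..} (\<lambda>t. exp (- l * t) * u t)"
proof (rule set_integrable_bound)
  show "set_integrable lborel {0..} (\<lambda>t. F * exp (- l * t))"
    using laplace_one(1)[OF \<open>l > 0\<close>] by simp
  have "continuous_on {0..} (\<lambda>t. exp (- l * t) * u t)"
    by (intro continuous_intros cont)
  then show "set_borel_measurable lborel {0..} (\<lambda>t. exp (- l * t) * u t)"
    using borel_measurable_continuous_on_indicator[of "{0::real..}" "\<lambda>t. exp (- l * t) * u t"]
    by (simp add: set_borel_measurable_def)
  show "AE t in lborel. t \<in> {0..} \<longrightarrow> norm (exp (- l * t) * u t) \<le> norm (F * exp (- l * t))"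
  proof (intro AE_I2 impI)
    fix t :: real assume "t \<in> {0..}"
    then have "\<bar>u t\<bar> \<le> \<bar>F\<bar>" using F[of t] by auto
    then show "norm (exp (- l * t) * u t) \<le> norm (F * exp (- l * t))"
      by (simp add: abs_mult mult.commute)
  qed
qed

section \<open>Semigroup, Euler scheme and resolvent of a finite chain\<close>

locale finite_chain =
  fixes V :: "'v set" and q :: "'v \<Rightarrow> 'v \<Rightarrow> real" and p :: "real \<Rightarrow> 'v \<Rightarrow> 'v \<Rightarrow> real"
  assumes finite_V: "finite V"
    and rates_nonneg: "\<And>x y. x \<in> V \<Longrightarrow> y \<in> V \<Longrightarrow> 0 \<le> q x y"
    and transition: "transition_function V q p"
begin

abbreviation semi :: "real \<Rightarrow> ('v \<Rightarrow> real) \<Rightarrow> 'v \<Rightarrow> real" where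
  "semi t f \<equiv> kernel_app V (p t) f"

abbreviation gen :: "('v \<Rightarrow> real) \<Rightarrow> 'v \<Rightarrow> real" where
  "gen f \<equiv> kernel_app V (generator V q) f"

lemma p_nonneg: "t \<ge> 0 \<Longrightarrow> x \<in> V \<Longrightarrow> y \<in> V \<Longrightarrow> 0 \<le> p t x y"
  and p_sum: "t \<ge> 0 \<Longrightarrow> x \<in> V \<Longrightarrow> (\<Sum>y\<in>V. p t x y) = 1"
  using transition[unfolded transition_function_def, THEN conjunct1, rule_format, of t x] by auto

lemmas p_0 = transition[unfolded transition_function_def, THEN conjunct2, THEN conjunct1, rule_format]
  and p_add = transition[unfolded transition_function_def, THEN conjunct2, THEN conjunct2,
    THEN conjunct1, rule_format]
  and p_rate = transition[unfolded transition_function_def, THEN conjunct2, THEN conjunct2,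
    THEN conjunct2, rule_format]

lemma semi_bound: "t \<ge> 0 \<Longrightarrow> x \<in> V \<Longrightarrow> (\<And>y. y \<in> V \<Longrightarrow> \<bar>f y\<bar> \<le> F) \<Longrightarrow> \<bar>semi t f x\<bar> \<le> F"
  by (rule kernel_app_bound) (auto simp: p_nonneg p_sum)

lemma semi_nonneg: "t \<ge> 0 \<Longrightarrow> x \<in> V \<Longrightarrow> (\<And>y. y \<in> V \<Longrightarrow> 0 \<le> f y) \<Longrightarrow> 0 \<le> semi t f x"
  by (auto simp: kernel_app_def p_nonneg intro!: sum_nonneg)

lemma semi_const: "t \<ge> 0 \<Longrightarrow> x \<in> V \<Longrightarrow> semi t (\<lambda>_. c) x = c"
  by (simp add: kernel_app_def sum_distrib_right[symmetric] p_sum)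

lemma semi_0: "x \<in> V \<Longrightarrow> semi 0 f x = f x"
  using finite_V by (simp add: kernel_app_def p_0)

lemma semi_add:
  assumes "s \<ge> 0" "t \<ge> 0" "x \<in> V"
  shows "semi (s + t) f x = semi s (semi t f) x"
proof -
  have "(\<Sum>y\<in>V. p (s + t) x y * f y) = (\<Sum>y\<in>V. (\<Sum>z\<in>V. p s x z * p t z y) * f y)"
    by (rule sum.cong[OF refl], subst p_add[OF assms]) (rule refl | assumption)+
  also have "\<dots> = (\<Sum>y\<in>V. \<Sum>z\<in>V. p s x z * (p t z y * f y))"
    by (simp only: sum_distrib_right mult.assoc)
  also have "\<dots> = (\<Sum>z\<in>V. p s x z * (\<Sum>y\<in>V. p t z y * f y))"
    by (subst sum.swap) (simp only: sum_distrib_left)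
  finally show ?thesis by (simp only: kernel_app_def)
qed

text \<open>Only the off-diagonal rates are prescribed; the derivative on the diagonal follows
  because the rows of \<open>p\<close> sum to 1.\<close>

lemma p_deriv:
  assumes "x \<in> V" "y \<in> V"
  shows "((\<lambda>h. (p h x y - of_bool (x = y)) / h) \<longlongrightarrow> generator V q x y) (at_right 0)"
proof (cases "x = y")
  case False
  then show ?thesis using p_rate[OF assms] by (simp add: generator_def)
next
  case True
  have "((\<lambda>h. - (\<Sum>z\<in>V - {x}. p h x z / h)) \<longlongrightarrow> - (\<Sum>z\<in>V - {x}. q x z)) (at_right 0)"
    using assms by (intro tendsto_intros p_rate) auto
  moreover have "\<forall>\<^sub>F h in at_right 0. - (\<Sum>z\<in>V - {x}. p h x z / h) = (p h x y - of_bool (x = y)) / h"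
    using eventually_at_right_less[of "0::real"]
  proof eventually_elim
    case (elim h)
    then have "p h x x + (\<Sum>z\<in>V - {x}. p h x z) = 1"
      using p_sum[of h x] sum.remove[OF finite_V assms(1), of "p h x"] assms(1) by simp
    then have "- (\<Sum>z\<in>V - {x}. p h x z) = p h x x - 1" by linarith
    then show ?case
      using True by (simp only: sum_divide_distrib[symmetric] minus_divide_left) simp
  qed
  ultimately show ?thesis
    using True by (simp add: generator_def tendsto_cong)
qed

lemma semi_deriv:
  assumes "x \<in> V"
  shows "((\<lambda>h. (semi h f x - f x) / h) \<longlongrightarrow> gen f x) (at_right 0)"
proof -
  have "semi h f x - f x = (\<Sum>y\<in>V. (p h x y - of_bool (x = y)) * f y)" for h
    using assms finite_V by (simp add: kernel_app_def left_diff_distrib sum_subtractf)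
  then have "(semi h f x - f x) / h = (\<Sum>y\<in>V. (p h x y - of_bool (x = y)) / h * f y)" for h
    by (simp add: sum_divide_distrib)
  then show ?thesis
    unfolding kernel_app_def[of V "generator V q"] using assms
    by (simp only:) (intro tendsto_intros p_deriv)
qed

lemma semi_tendsto_0:
  assumes "x \<in> V"
  shows "((\<lambda>h. semi h f x) \<longlongrightarrow> f x) (at_right 0)"
proof -
  have "((\<lambda>h. h * ((semi h f x - f x) / h) + f x) \<longlongrightarrow> 0 * gen f x + f x) (at_right 0)"
    by (rule tendsto_add[OF tendsto_mult[OF tendsto_ident_at semi_deriv[OF assms]] tendsto_const])
  moreover have "\<forall>\<^sub>F h in at_right 0. h * ((semi h f x - f x) / h) + f x = semi h f x"
    using eventually_at_right_less[of "0::real"] by eventually_elim simp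
  ultimately have "((\<lambda>h. semi h f x) \<longlongrightarrow> 0 * gen f x + f x) (at_right 0)"
    by (rule Lim_transform_eventually)
  then show ?thesis by simp
qed

text \<open>Contractivity transports the modulus \<open>w\<close> at time 0 to every starting time,
  so right continuity at 0 becomes continuity from both sides.\<close>

lemma semi_continuous:
  assumes "x \<in> V"
  shows "continuous_on {0..} (\<lambda>t. semi t f x)"
proof -
  define w where "w = (\<lambda>h. \<Sum>y\<in>V. \<bar>semi h f y - f y\<bar>)"
  have "((\<lambda>h. w h) \<longlongrightarrow> (\<Sum>y\<in>V. \<bar>f y - f y\<bar>)) (at_right 0)"
    unfolding w_def by (intro tendsto_intros semi_tendsto_0)
  then have w: "(w \<longlongrightarrow> 0) (at_right 0)" by simp
  have w0: "w 0 = 0" by (simp add: w_def semi_0)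
  have le: "\<bar>semi t f x - semi s f x\<bar> \<le> w (t - s)" if "0 \<le> s" "s \<le> t" for s t
  proof -
    have "semi t f x - semi s f x = semi s (\<lambda>y. semi (t - s) f y - f y) x"
      using semi_add[of s "t - s" x f] that assms by (simp add: kernel_app_diff)
    also have "\<bar>\<dots>\<bar> \<le> w (t - s)"
      using that assms finite_V unfolding w_def
      by (intro semi_bound) (auto intro!: member_le_sum)
    finally show ?thesis .
  qed
  show ?thesis
    unfolding continuous_on_iff
  proof (intro ballI allI impI)
    fix t e :: real assume t: "t \<in> {0..}" and "0 < e"
    from w \<open>0 < e\<close> have "\<forall>\<^sub>F h in at_right 0. \<bar>w h\<bar> < e"
      using tendstoD[of w 0 "at_right 0" e] by (simp add: dist_real_def)
    then obtain d where d: "d > 0" "\<And>h. 0 < h \<Longrightarrow> h < d \<Longrightarrow> \<bar>w h\<bar> < e"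
      unfolding eventually_at_right_field by auto
    have "dist (semi t' f x) (semi t f x) < e" if "t' \<in> {0..}" "dist t' t < d" for t'
    proof -
      have "w \<bar>t' - t\<bar> < e"
        using d(2)[of "\<bar>t' - t\<bar>"] that \<open>0 < e\<close> w0 by (cases "t' = t") (auto simp: dist_real_def)
      then show ?thesis
        using le[of t t'] le[of t' t] that t by (cases "t \<le> t'") (auto simp: dist_real_def abs_minus_commute)
    qed
    then show "\<exists>d>0. \<forall>t'\<in>{0..}. dist t' t < d \<longrightarrow> dist (semi t' f x) (semi t f x) < e"
      using d(1) by blast
  qed
qed

text \<open>The semigroup and the Euler matrix are both contractions in the supremum norm, so
  one-step errors add up at most linearly.\<close>

lemma euler_error:
  assumes h: "h \<ge> 0" and step: "\<And>x y. x \<in> V \<Longrightarrow> y \<in> V \<Longrightarrow> 0 \<le> euler_step V q h x y"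
    and F: "\<And>y. y \<in> V \<Longrightarrow> \<bar>f y\<bar> \<le> F" and x: "x \<in> V"
  shows "\<bar>semi (real j * h) f x - (kernel_app V (euler_step V q h) ^^ j) f x\<bar> \<le>
      real j * (\<Sum>x\<in>V. \<Sum>y\<in>V. \<bar>p h x y - euler_step V q h x y\<bar>) * F"
proof -
  let ?E = "kernel_app V (euler_step V q h)"
  define e where "e = (\<Sum>x\<in>V. \<Sum>y\<in>V. \<bar>p h x y - euler_step V q h x y\<bar>)"
  have bound: "\<bar>(?E ^^ j) f x\<bar> \<le> F" if "x \<in> V" for j x
    using that
    by (induction j arbitrary: x)
      (auto simp: F step finite_V sum_euler_step intro!: kernel_app_bound)
  have "\<forall>x\<in>V. \<bar>semi (real j * h) f x - (?E ^^ j) f x\<bar> \<le> real j * e * F"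
  proof (induction j)
    case 0
    then show ?case by (simp add: semi_0)
  next
    case (Suc j)
    show ?case
    proof
      fix x assume x: "x \<in> V"
      let ?g = "(?E ^^ j) f"
      have "semi (real (Suc j) * h) f x = semi h (semi (real j * h) f) x"
        using semi_add[of h "real j * h" x f] h x by (simp add: distrib_right)
      then have "semi (real (Suc j) * h) f x - (?E ^^ Suc j) f x =
          semi h (\<lambda>y. semi (real j * h) f y - ?g y) x
            + (\<Sum>y\<in>V. (p h x y - euler_step V q h x y) * ?g y)"
        by (simp add: kernel_app_diff) (simp add: kernel_app_def left_diff_distrib sum_subtractf)
      moreover have "\<bar>semi h (\<lambda>y. semi (real j * h) f y - ?g y) x\<bar> \<le> real j * e * F"
        using Suc x h by (intro semi_bound) auto
      moreover have "\<bar>\<Sum>y\<in>V. (p h x y - euler_step V q h x y) * ?g y\<bar> \<le> e * F"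
      proof -
        have "\<bar>\<Sum>y\<in>V. (p h x y - euler_step V q h x y) * ?g y\<bar> \<le>
            (\<Sum>y\<in>V. \<bar>p h x y - euler_step V q h x y\<bar>) * F"
          unfolding sum_distrib_right
          by (intro order_trans[OF sum_abs] sum_mono) (auto simp: abs_mult bound intro!: mult_left_mono)
        also have "\<dots> \<le> e * F"
          unfolding e_def using x finite_V F[OF x]
          by (intro mult_right_mono member_le_sum) (auto intro: sum_nonneg)
        finally show ?thesis .
      qed
      ultimately show "\<bar>semi (real (Suc j) * h) f x - (?E ^^ Suc j) f x\<bar> \<le> real (Suc j) * e * F"
        unfolding of_nat_Suc distrib_right by linarith
    qed
  qed
  then show ?thesis using x by (simp add: e_def)
qed

text \<open>The one-step error is o(h) by \<open>p_deriv\<close>, hence \<open>m\<close> steps of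
  length t/m accumulate o(1).\<close>

lemma euler_limit:
  assumes t: "t > 0" and x: "x \<in> V"
  shows "(\<lambda>m. (kernel_app V (euler_step V q (t / real m)) ^^ m) f x) \<longlonglongrightarrow> semi t f x"
proof -
  define e where "e = (\<lambda>h. \<Sum>x\<in>V. \<Sum>y\<in>V. \<bar>p h x y - euler_step V q h x y\<bar>)"
  define F where "F = (\<Sum>y\<in>V. \<bar>f y\<bar>)"
  have F: "\<bar>f y\<bar> \<le> F" if "y \<in> V" for y
    unfolding F_def using that finite_V by (intro member_le_sum) auto
  have "((\<lambda>h. \<Sum>x\<in>V. \<Sum>y\<in>V. \<bar>(p h x y - of_bool (x = y)) / h - generator V q x y\<bar>) \<longlongrightarrow>
      (\<Sum>x\<in>V. \<Sum>y\<in>V. \<bar>generator V q x y - generator V q x y\<bar>)) (at_right 0)"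
    by (intro tendsto_intros p_deriv)
  moreover have "\<forall>\<^sub>F h in at_right 0.
      (\<Sum>x\<in>V. \<Sum>y\<in>V. \<bar>(p h x y - of_bool (x = y)) / h - generator V q x y\<bar>) = e h / h"
    using eventually_at_right_less[of "0::real"]
  proof eventually_elim
    case (elim h)
    have "\<bar>(p h x y - of_bool (x = y)) / h - generator V q x y\<bar> =
        \<bar>p h x y - euler_step V q h x y\<bar> / h" for x y
    proof -
      have "(p h x y - of_bool (x = y)) / h - generator V q x y =
          (p h x y - euler_step V q h x y) / h"
        using elim by (simp add: euler_step_def field_simps)
      then show ?thesis using elim by simp
    qed
    then show ?case by (simp add: e_def sum_divide_distrib)
  qed
  ultimately have e: "((\<lambda>h. e h / h) \<longlongrightarrow> 0) (at_right 0)"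
    by (simp add: tendsto_cong)
  have lim: "filterlim (\<lambda>m. t / real m) (at_right 0) sequentially"
    using t by real_asymp
  have "(\<lambda>m. t * (e (t / real m) / (t / real m)) * F) \<longlonglongrightarrow> t * 0 * F"
    by (intro tendsto_intros filterlim_compose[OF e lim])
  moreover have "\<forall>\<^sub>F m in sequentially.
      t * (e (t / real m) / (t / real m)) * F = real m * e (t / real m) * F"
    using eventually_gt_at_top[of 0] by eventually_elim (use t in \<open>simp add: field_simps\<close>)
  ultimately have "(\<lambda>m. real m * e (t / real m) * F) \<longlonglongrightarrow> t * 0 * F"
    by (rule Lim_transform_eventually)
  then have small: "(\<lambda>m. real m * e (t / real m) * F) \<longlonglongrightarrow> 0" by simp
  \<comment> \<open>\<open>euler_error\<close> requires nonnegative entries; on the diagonal this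
    holds only for small step lengths.\<close>
  have "\<forall>\<^sub>F h in at_right 0. 0 < euler_step V q h x x" if "x \<in> V" for x
  proof -
    have "((\<lambda>h. euler_step V q h x x) \<longlongrightarrow> 1 + 0 * generator V q x x) (at_right 0)"
      unfolding euler_step_def by (intro tendsto_eq_intros) auto
    then show ?thesis by (intro order_tendstoD) auto
  qed
  then have "\<forall>\<^sub>F h in at_right 0. \<forall>x\<in>V. 0 < euler_step V q h x x"
    using finite_V by (simp add: eventually_ball_finite)
  then have "\<forall>\<^sub>F m in sequentially. \<forall>x\<in>V. 0 < euler_step V q (t / real m) x x"
    using lim by (rule eventually_compose_filterlim)
  then have "\<forall>\<^sub>F m in sequentially.
      \<bar>(kernel_app V (euler_step V q (t / real m)) ^^ m) f x - semi t f x\<bar> \<le> real m * e (t / real m) * F"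
    using eventually_gt_at_top[of 0]
  proof eventually_elim
    case (elim m)
    have "0 \<le> euler_step V q (t / real m) x y" if "x \<in> V" "y \<in> V" for x y
      using elim that t rates_nonneg[OF that]
      by (cases "x = y") (auto simp: euler_step_def generator_def less_imp_le)
    then show ?case
      using euler_error[of "t / real m" f F x m] F x t elim unfolding e_def
      by (simp add: abs_minus_commute)
  qed
  then have "(\<lambda>m. (kernel_app V (euler_step V q (t / real m)) ^^ m) f x - semi t f x) \<longlonglongrightarrow> 0"
    by (intro Lim_null_comparison[OF _ small]) simp
  then show ?thesis by (rule LIM_zero_cancel)
qed

lemma resolvent_integrable:
  assumes "l > 0" "x \<in> V"
  shows "set_integrable lborel {0..} (\<lambda>t. exp (- l * t) * semi t f x)"
proof (rule laplace_integrable[OF \<open>l > 0\<close> _ semi_continuous[OF \<open>x \<in> V\<close>]])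
  fix t :: real assume "t \<ge> 0"
  then show "\<bar>semi t f x\<bar> \<le> (\<Sum>y\<in>V. \<bar>f y\<bar>)"
    using finite_V by (intro semi_bound assms) (auto intro!: member_le_sum)
qed

definition resolvent :: "real \<Rightarrow> ('v \<Rightarrow> real) \<Rightarrow> 'v \<Rightarrow> real" where
  "resolvent l f x = (LINT t:{0..}|lborel. exp (- l * t) * semi t f x)"

lemma sum_resolvent:
  assumes "l > 0"
  shows "(\<Sum>x\<in>V. w x * resolvent l f x) = (LINT t:{0..}|lborel. exp (- l * t) * (\<Sum>x\<in>V. w x * semi t f x))"
proof -
  have "(LINT t:{0..}|lborel. exp (- l * t) * (\<Sum>x\<in>V. w x * semi t f x)) =
      (LINT t|lborel. (\<Sum>x\<in>V. w x * (indicat_real {0..} t *\<^sub>R (exp (- l * t) * semi t f x))))"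
    unfolding set_lebesgue_integral_def
    by (rule Bochner_Integration.integral_cong) (auto simp: sum_distrib_left mult_ac)
  also have "\<dots> = (\<Sum>x\<in>V. w x * resolvent l f x)"
    using resolvent_integrable[OF assms]
    by (subst Bochner_Integration.integral_sum)
      (auto simp: resolvent_def set_lebesgue_integral_def set_integrable_def)
  finally show ?thesis by simp
qed

lemma resolvent_bounds:
  assumes "l > 0" "x \<in> V" "\<And>y. y \<in> V \<Longrightarrow> 0 \<le> f y"
  shows "0 \<le> resolvent l f x"
    and "(\<And>y. y \<in> V \<Longrightarrow> f y \<le> 1) \<Longrightarrow> l * resolvent l f x \<le> 1"
proof -
  show "0 \<le> resolvent l f x"
    unfolding resolvent_def set_lebesgue_integral_def using assms
    by (intro Bochner_Integration.integral_nonneg)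
      (auto simp: indicator_def intro!: mult_nonneg_nonneg semi_nonneg)
  assume f1: "\<And>y. y \<in> V \<Longrightarrow> f y \<le> 1"
  have "resolvent l f x \<le> (LINT t:{0..}|lborel. exp (- l * t))"
    unfolding resolvent_def
  proof (rule set_integral_mono[OF resolvent_integrable[OF assms(1,2)] laplace_one(1)[OF assms(1)]])
    fix t :: real assume "t \<in> {0..}"
    then have "\<bar>semi t f x\<bar> \<le> 1" using assms f1 by (intro semi_bound) auto
    then show "exp (- l * t) * semi t f x \<le> exp (- l * t)"
      by (simp add: mult_le_cancel_left1 abs_le_iff)
  qed
  then show "l * resolvent l f x \<le> 1"
    unfolding laplace_one(2)[OF \<open>l > 0\<close>] using \<open>l > 0\<close> by (simp add: field_simps)
qed

text \<open>Running the semigroup for time \<open>h\<close> shifts the Laplace integral: it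
  multiplies by exp (l h) and removes the part over [0, h]. Differentiating this identity at
  \<open>h = 0\<close> from the right gives the equation, so no derivative of the semigroup at
  positive times is required.\<close>

lemma resolvent_equation:
  assumes l: "l > 0" and x: "x \<in> V"
  shows "l * resolvent l f x - gen (resolvent l f) x = f x"
proof -
  let ?v = "resolvent l f"
  define w where "w = (\<lambda>t. exp (- l * t) * semi t f x)"
  define D where "D = (\<lambda>h. integral {0..h} w)"
  have w_int: "set_integrable lborel {0..} w"
    unfolding w_def by (rule resolvent_integrable[OF l x])
  have w_cont: "continuous_on {0..} w"
    unfolding w_def by (intro continuous_intros semi_continuous[OF x])
  have "(D has_real_derivative w 0) (at 0 within {0..1})"
    unfolding D_def
    by (intro integral_has_real_derivative continuous_on_subset[OF w_cont]) auto
  then have "(D has_real_derivative w 0) (at_right 0)"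
    by (simp add: at_within_Icc_at_right)
  then have D: "((\<lambda>h. D h / h) \<longlongrightarrow> f x) (at_right 0)"
    by (simp add: has_field_derivative_iff D_def w_def semi_0[OF x])
  have shift: "semi h ?v x = exp (l * h) * (?v x - D h)" if h: "h > 0" for h
  proof -
    have "semi h ?v x = (\<Sum>y\<in>V. p h x y * ?v y)"
      by (simp add: kernel_app_def)
    also have "\<dots> = (LINT t:{0..}|lborel. exp (- l * t) * (\<Sum>y\<in>V. p h x y * semi t f y))"
      by (rule sum_resolvent[OF l])
    also have "\<dots> = (LINT t:{0..}|lborel. exp (- l * t) * semi (h + t) f x)"
      using h x by (intro set_lebesgue_integral_cong) (auto simp: semi_add kernel_app_def[of V "p h"])
    \<comment> \<open>The interval is opened at its left end, a null set, and \<open>1 * t\<close>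
      is written out to fit the affine substitution rule.\<close>
    also have "\<dots> = (LINT t|lborel. indicat_real {h<..} (h + 1 * t) *\<^sub>R (exp (l * h) * w (h + 1 * t)))"
      unfolding set_lebesgue_integral_def
    proof (rule integral_cong_AE)
      have "continuous_on {0..} (\<lambda>t. exp (- l * t) * semi (h + t) f x)"
        using h by (intro continuous_intros continuous_on_compose2[OF semi_continuous[OF x]]) auto
      then show "(\<lambda>t. indicat_real {0..} t *\<^sub>R (exp (- l * t) * semi (h + t) f x)) \<in> borel_measurable lborel"
        using borel_measurable_continuous_on_indicator[of "{0::real..}"] by (simp del: real_scaleR_def)
      have "continuous_on {0<..} (\<lambda>t. exp (l * h) * w (h + 1 * t))"
        using h by (intro continuous_intros continuous_on_compose2[OF w_cont]) auto
      then have "(\<lambda>t. indicat_real {0<..} t *\<^sub>R (exp (l * h) * w (h + 1 * t))) \<in> borel_measurable lborel"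
        using borel_measurable_continuous_on_indicator[of "{0::real<..}"] by (simp del: real_scaleR_def)
      moreover have "indicat_real {0<..} t = indicat_real {h<..} (h + 1 * t)" for t
        by (simp add: indicator_def)
      ultimately show "(\<lambda>t. indicat_real {h<..} (h + 1 * t) *\<^sub>R (exp (l * h) * w (h + 1 * t))) \<in> borel_measurable lborel"
        by simp
      show "AE t in lborel. indicat_real {0..} t *\<^sub>R (exp (- l * t) * semi (h + t) f x) =
          indicat_real {h<..} (h + 1 * t) *\<^sub>R (exp (l * h) * w (h + 1 * t))"
        using AE_lborel_singleton[of "0::real"]
        by eventually_elim (auto simp: indicator_def w_def exp_add[symmetric] algebra_simps)
    qed
    also have "\<dots> = (LINT t|lborel. indicat_real {h<..} t *\<^sub>R (exp (l * h) * w t))"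
      using lborel_integral_real_affine[of 1 "\<lambda>t. indicat_real {h<..} t *\<^sub>R (exp (l * h) * w t)" h] by simp
    also have "\<dots> = exp (l * h) * (LINT t:{h<..}|lborel. w t)"
      unfolding set_lebesgue_integral_def scaleR_conv_of_real
      by (simp only: mult.left_commute[of _ "exp (l * h)"] integral_mult_right_zero)
    also have "(LINT t:{h<..}|lborel. w t) = ?v x - D h"
    proof -
      have s1: "set_integrable lborel {0..h} w" and s2: "set_integrable lborel {h<..} w"
        using h by (auto intro!: set_integrable_subset[OF w_int])
      have "(LINT t:{0..h} \<union> {h<..}|lborel. w t) = (LINT t:{0..h}|lborel. w t) + (LINT t:{h<..}|lborel. w t)"
        by (rule set_integral_Un[OF _ s1 s2]) auto
      moreover have "{0..h} \<union> {h<..} = {0..}" using h by auto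
      moreover have "(LINT t:{0..h}|lborel. w t) = D h"
        unfolding D_def by (rule set_borel_integral_eq_integral[OF s1])
      ultimately show ?thesis by (simp add: resolvent_def w_def)
    qed
    finally show ?thesis .
  qed
  have "((\<lambda>h. (exp (l * h) - 1) / h * ?v x - exp (l * h) * (D h / h)) \<longlongrightarrow> l * ?v x - exp (l * 0) * f x) (at_right 0)"
  proof (intro tendsto_diff tendsto_mult tendsto_const D)
    have "((\<lambda>h. exp (l * h)) has_real_derivative l) (at 0)"
      by (auto intro!: derivative_eq_intros)
    then have "((\<lambda>h. exp (l * h)) has_real_derivative l) (at_right 0)"
      by (rule has_field_derivative_at_within)
    then show "((\<lambda>h. (exp (l * h) - 1) / h) \<longlongrightarrow> l) (at_right 0)"
      by (simp add: has_field_derivative_iff)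
    show "((\<lambda>h. exp (l * h)) \<longlongrightarrow> exp (l * 0)) (at_right 0)"
      by (intro tendsto_intros)
  qed
  moreover have "\<forall>\<^sub>F h in at_right 0. (exp (l * h) - 1) / h * ?v x - exp (l * h) * (D h / h) = (semi h ?v x - ?v x) / h"
    using eventually_at_right_less[of "0::real"]
    by eventually_elim (simp add: shift field_simps)
  ultimately have "((\<lambda>h. (semi h ?v x - ?v x) / h) \<longlongrightarrow> l * ?v x - exp (l * 0) * f x) (at_right 0)"
    by (rule Lim_transform_eventually)
  then have "gen ?v x = l * ?v x - exp (l * 0) * f x"
    using semi_deriv[OF x] tendsto_unique trivial_limit_at_right_real by blast
  then show ?thesis by simp
qed

end

section \<open>Reversible chains and the return energy\<close>

locale reversible_chain = finite_chain V q p for V :: "'v set" and q p +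
  fixes \<tau> :: "'v \<Rightarrow> real"
  assumes tau_pos: "x \<in> V \<Longrightarrow> 0 < \<tau> x"
    and balance: "x \<in> V \<Longrightarrow> y \<in> V \<Longrightarrow> \<tau> x * q x y = \<tau> y * q y x"
begin

definition ip :: "('v \<Rightarrow> real) \<Rightarrow> ('v \<Rightarrow> real) \<Rightarrow> real" where
  "ip f g = (\<Sum>x\<in>V. \<tau> x * (f x * g x))"

lemma ip_commute: "ip f g = ip g f"
  by (simp add: ip_def mult.commute)

lemma ip_cong: "(\<And>x. x \<in> V \<Longrightarrow> f x = f' x) \<Longrightarrow> (\<And>x. x \<in> V \<Longrightarrow> g x = g' x) \<Longrightarrow> ip f g = ip f' g'"
  by (simp add: ip_def)

lemma ip_nonneg: "0 \<le> ip f f"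
  unfolding ip_def
  by (intro sum_nonneg mult_nonneg_nonneg[OF _ zero_le_square]) (simp add: less_imp_le tau_pos)

lemma ip_diff: "ip (\<lambda>x. f x - g x) (\<lambda>x. f x - g x) = ip f f - 2 * ip f g + ip g g"
  by (simp add: ip_def algebra_simps sum.distrib sum_subtractf sum_distrib_left)

lemma ip_diff_left: "ip (\<lambda>x. f x - g x) h = ip f h - ip g h"
  by (simp add: ip_def algebra_simps sum_subtractf)

lemma ip_Cauchy_Schwarz: "(ip f g)\<^sup>2 \<le> ip f f * ip g g"
proof -
  have "ip a b = (\<Sum>x\<in>V. (sqrt (\<tau> x) * a x) * (sqrt (\<tau> x) * b x))" for a b
    unfolding ip_def
  proof (intro sum.cong refl)
    fix x assume "x \<in> V"
    then have "\<tau> x = sqrt (\<tau> x) * sqrt (\<tau> x)" using tau_pos[of x] by simp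
    then show "\<tau> x * (a x * b x) = (sqrt (\<tau> x) * a x) * (sqrt (\<tau> x) * b x)"
      by (metis mult.assoc mult.left_commute)
  qed
  then show ?thesis
    using Cauchy_Schwarz_ineq_sum[of "\<lambda>x. sqrt (\<tau> x) * f x" "\<lambda>x. sqrt (\<tau> x) * g x" V]
    by (simp add: power2_eq_square)
qed

lemma ip_euler: "ip f (kernel_app V (euler_step V q h) g) = ip (kernel_app V (euler_step V q h) f) g"
proof -
  have sym: "\<tau> x * euler_step V q h x y = \<tau> y * euler_step V q h y x" if "x \<in> V" "y \<in> V" for x y
    using balance[OF that] by (cases "x = y") (auto simp: euler_step_def generator_def)
  have "ip f (kernel_app V (euler_step V q h) g) = (\<Sum>x\<in>V. \<Sum>y\<in>V. (\<tau> x * euler_step V q h x y) * (f x * g y))"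
    by (simp add: ip_def kernel_app_def sum_distrib_left mult_ac)
  also have "\<dots> = (\<Sum>y\<in>V. \<Sum>x\<in>V. (\<tau> y * euler_step V q h y x) * (f x * g y))"
    by (subst sum.swap) (intro sum.cong refl, simp add: sym)
  also have "\<dots> = ip (kernel_app V (euler_step V q h) f) g"
    by (simp add: ip_def kernel_app_def sum_distrib_left sum_distrib_right mult_ac)
  finally show ?thesis .
qed

lemma ip_euler_power:
  "ip f ((kernel_app V (euler_step V q h) ^^ m) g) = ip ((kernel_app V (euler_step V q h) ^^ m) f) g"
proof (induction m arbitrary: f)
  case (Suc m)
  then show ?case
    by (simp only: funpow.simps comp_apply ip_euler) (simp only: funpow_swap1)
qed simp

text \<open>Detailed balance concerns the rates only. It makes the Euler matrix self-adjoint, and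
  self-adjointness survives powers and the limit.\<close>

lemma ip_semi:
  assumes "t \<ge> 0"
  shows "ip f (semi t g) = ip (semi t f) g"
proof (cases "t = 0")
  case True
  then show ?thesis by (simp add: semi_0 cong: ip_cong)
next
  case False
  then have t: "t > 0" using assms by simp
  let ?E = "\<lambda>m. kernel_app V (euler_step V q (t / real m)) ^^ m"
  have "(\<lambda>m. ip f (?E m g)) \<longlonglongrightarrow> ip f (semi t g)"
    unfolding ip_def by (intro tendsto_intros euler_limit t)
  moreover have "(\<lambda>m. ip (?E m f) g) \<longlonglongrightarrow> ip (semi t f) g"
    unfolding ip_def by (intro tendsto_intros euler_limit t)
  ultimately show ?thesis
    by (simp add: ip_euler_power LIMSEQ_unique)
qed

lemma ip_one_semi: "t \<ge> 0 \<Longrightarrow> ip (\<lambda>_. 1) (semi t f) = ip (\<lambda>_. 1) f"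
  using ip_semi[of t "\<lambda>_. 1" f] by (simp add: semi_const cong: ip_cong)

text \<open>Jensen at every site, followed by invariance of the weights.\<close>

lemma ip_semi_contract:
  assumes "t \<ge> 0"
  shows "ip (semi t f) (semi t f) \<le> ip f f"
proof -
  have "ip (semi t f) (semi t f) \<le> ip (\<lambda>_. 1) (semi t (\<lambda>x. (f x)\<^sup>2))"
    unfolding ip_def
  proof (rule sum_mono)
    fix x assume x: "x \<in> V"
    have "(semi t f x)\<^sup>2 \<le> semi t (\<lambda>x. (f x)\<^sup>2) x"
      using assms x by (intro kernel_app_square_le p_nonneg p_sum)
    then show "\<tau> x * (semi t f x * semi t f x) \<le> \<tau> x * (1 * semi t (\<lambda>x. (f x)\<^sup>2) x)"
      using tau_pos[OF x] by (simp add: power2_eq_square)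
  qed
  also have "\<dots> = ip f f"
    unfolding ip_one_semi[OF assms] by (simp add: ip_def power2_eq_square)
  finally show ?thesis .
qed

text \<open>By self-adjointness this is the squared norm of the evolved \<open>h\<close> at half the
  time. All its properties are drawn from that, in place of a spectral decomposition.\<close>

definition energy :: "('v \<Rightarrow> real) \<Rightarrow> real \<Rightarrow> real" where
  "energy h t = ip h (semi t h)"

lemma energy_add:
  assumes "s \<ge> 0" "t \<ge> 0"
  shows "energy h (s + t) = ip (semi s h) (semi t h)"
proof -
  have "energy h (s + t) = ip h (semi s (semi t h))"
    unfolding energy_def using assms by (intro ip_cong semi_add) auto
  then show ?thesis using assms by (simp add: ip_semi)
qed

lemma energy_double: "t \<ge> 0 \<Longrightarrow> energy h (2 * t) = ip (semi t h) (semi t h)"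
  using energy_add[of t t h] by simp

lemma energy_nonneg: "t \<ge> 0 \<Longrightarrow> 0 \<le> energy h t"
  using energy_double[of "t / 2" h] ip_nonneg by simp

lemma energy_antitone:
  assumes "0 \<le> s" "s \<le> t"
  shows "energy h t \<le> energy h s"
proof -
  let ?a = "s / 2" and ?b = "t / 2 - s / 2"
  have "energy h t = ip (semi (?b + ?a) h) (semi (?b + ?a) h)"
    using energy_double[of "t / 2" h] assms by (simp add: field_simps)
  also have "\<dots> = ip (semi ?b (semi ?a h)) (semi ?b (semi ?a h))"
    using assms by (intro ip_cong semi_add) auto
  also have "\<dots> \<le> ip (semi ?a h) (semi ?a h)"
    using assms by (intro ip_semi_contract) auto
  also have "\<dots> = energy h s"
    using energy_double[of ?a h] assms by simp
  finally show ?thesis .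
qed

lemma energy_midpoint:
  assumes "s \<ge> 0" "t \<ge> 0"
  shows "2 * energy h (s + t) \<le> energy h (2 * s) + energy h (2 * t)"
  using ip_nonneg[of "\<lambda>x. semi s h x - semi t h x"] assms
  by (simp add: ip_diff energy_add energy_double)

text \<open>Midpoint convexity makes the decrements over consecutive steps of length
  \<open>d\<close> decrease in time, so the one after \<open>t\<close> is at most the average of the
  \<open>m\<close> before it. Those telescope.\<close>

lemma energy_slope:
  assumes d: "d \<ge> 0" and md: "real m * d \<le> t"
  shows "real m * (energy h t - energy h (t + d)) \<le> energy h (t - real m * d)"
proof -
  \<comment> \<open>The second conjunct, comparing the decrement at \<open>t\<close> with the
    earliest one, is what the induction needs to add one more step on the left.\<close>
  have "real m * (energy h t - energy h (t + d)) \<le> energy h (t - real m * d) - energy h t \<and>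
      energy h t - energy h (t + d) \<le> energy h (t - real m * d) - energy h (t - real m * d + d)"
    using md
  proof (induction m)
    case 0
    then show ?case by simp
  next
    case (Suc m)
    let ?u = "t - real (Suc m) * d"
    have u: "?u \<ge> 0" "t - real m * d = ?u + d" using Suc.prems by (auto simp: algebra_simps)
    have mid: "2 * energy h (w + d) \<le> energy h w + energy h (w + d + d)" if "w \<ge> 0" for w
      using energy_midpoint[of "w / 2" "w / 2 + d" h] that d by (simp add: algebra_simps)
    note mid[OF u(1)]
    moreover have "real m * d \<le> t" using Suc.prems d by (simp add: algebra_simps)
    moreover have "real (Suc m) * (energy h t - energy h (t + d)) =
        real m * (energy h t - energy h (t + d)) + (energy h t - energy h (t + d))"
      by (simp add: algebra_simps)
    ultimately show ?case using Suc.IH u by (auto simp: u(2))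
  qed
  moreover have "t \<ge> 0" using d md by (meson mult_nonneg_nonneg of_nat_0_le_iff order_trans)
  ultimately show ?thesis using energy_nonneg[of t h] by linarith
qed

text \<open>Expanding the square leaves minus twice the energy at \<open>s + t\<close>, which by
  monotonicity is at least the energy at \<open>2 * t\<close>.\<close>

lemma energy_increment:
  assumes "0 \<le> s" "s \<le> t"
  shows "ip (\<lambda>x. semi s h x - semi t h x) (\<lambda>x. semi s h x - semi t h x) \<le> energy h (2 * s) - energy h (2 * t)"
  using assms energy_antitone[of "s + t" "2 * t" h]
  by (simp add: ip_diff energy_add[symmetric] energy_double[symmetric])

end

section \<open>The trap model on the cube\<close>

text \<open>The weights are a parameter, so that the depths can be replaced by depths over the
  time-scale; this amounts to speeding up the clock.\<close>

definition trap_rate :: "nat \<Rightarrow> ((nat \<Rightarrow> real) \<Rightarrow> real) \<Rightarrow> (nat \<Rightarrow> real) \<Rightarrow> (nat \<Rightarrow> real) \<Rightarrow> real" where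
  "trap_rate n \<tau> x y = (if cube_edge n x y then 1 / (real n * \<tau> x) else 0)"

lemma cube_edge_sym: "cube_edge n x y \<longleftrightarrow> cube_edge n y x"
  unfolding cube_edge_def by (auto simp: eq_commute)

lemma cube_edge_iff_flip:
  assumes x: "x \<in> cube n"
  shows "cube_edge n x y \<longleftrightarrow> y \<in> (\<lambda>i. flip i x) ` {..<n}"
proof
  assume e: "cube_edge n x y"
  then have y: "y \<in> cube n" by (simp add: cube_edge_def)
  from e obtain i where i: "{i \<in> {..<n}. x i \<noteq> y i} = {i}"
    unfolding cube_edge_def by (auto simp: card_1_singleton_iff)
  then have "i < n" by auto
  have "y j = flip i x j" for j
  proof (cases "j < n")
    case False
    then show ?thesis using x y \<open>i < n\<close> by (auto simp: cube_def flip_def PiE_def extensional_def)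
  next
    case True
    then have "x j \<in> {-1, 1}" "y j \<in> {-1, 1}" using x y by (auto simp: cube_def)
    moreover have "x j \<noteq> y j \<longleftrightarrow> j = i" using i True by blast
    ultimately show ?thesis by (auto simp: flip_def)
  qed
  then have "y = flip i x" by auto
  with \<open>i < n\<close> show "y \<in> (\<lambda>i. flip i x) ` {..<n}" by auto
next
  assume "y \<in> (\<lambda>i. flip i x) ` {..<n}"
  then obtain i where i: "i < n" "y = flip i x" by auto
  have "x i \<in> {-1, 1}" using x i by (auto simp: cube_def)
  then have "{j \<in> {..<n}. x j \<noteq> y j} = {i}" using i by (auto simp: flip_def)
  then show "cube_edge n x y" using x i by (simp add: cube_edge_def flip_in_cube)
qed

lemma sum_cube_edges:
  assumes x: "x \<in> cube n"
  shows "(\<Sum>y\<in>cube n. (if cube_edge n x y then F y else 0)) = (\<Sum>i<n. F (flip i x))"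
proof -
  have inj: "inj_on (\<lambda>i. flip i x) {..<n}"
  proof (rule inj_onI)
    fix i j assume ij: "i \<in> {..<n}" "j \<in> {..<n}" "flip i x = flip j x"
    have "x i \<in> {-1, 1}" using x ij by (auto simp: cube_def)
    moreover have "flip i x i = flip j x i" using ij by simp
    ultimately show "i = j" by (auto simp: flip_def split: if_splits)
  qed
  have "(\<Sum>y\<in>cube n. (if cube_edge n x y then F y else 0)) = (\<Sum>y\<in>(\<lambda>i. flip i x) ` {..<n}. F y)"
    using x by (intro sum.mono_neutral_cong_right) (auto simp: cube_edge_iff_flip flip_in_cube)
  also have "\<dots> = (\<Sum>i<n. F (flip i x))"
    using inj by (simp add: sum.reindex)
  finally show ?thesis .
qed

text \<open>Weierstrass approximation, in the variable \<open>exp (- r)\<close>, of a bump supported in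
  \<open>t \<le> r \<le> t + d\<close>.\<close>

lemma laplace_inversion:
  fixes t d \<eta> :: real
  assumes t: "t \<ge> 0" and d: "d > 0" and \<eta>: "\<eta> > 0"
  shows "\<exists>(J :: nat) (a :: nat \<Rightarrow> real). \<forall>(u :: real \<Rightarrow> real) \<rho>. continuous_on {0..} u \<longrightarrow> (\<forall>r\<ge>0. \<bar>u r\<bar> \<le> 1) \<longrightarrow>
    (\<forall>r. t \<le> r \<longrightarrow> r \<le> t + d \<longrightarrow> \<bar>u r - u t\<bar> \<le> \<rho>) \<longrightarrow>
    \<bar>u t - (\<Sum>j\<le>J. a j * (LINT r:{0..}|lborel. exp (- (real j + 1) * r) * u r))\<bar> \<le> \<rho> + \<eta>"
proof -
  define W where "W = (\<lambda>x. max 0 (min (exp (- t) - x) (x - exp (- (t + d)))))"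
  have W_cont: "continuous_on S W" for S unfolding W_def by (intro continuous_intros)
  have W_nonneg: "0 \<le> W x" for x by (simp add: W_def)
  have W_le: "\<bar>W (exp (- r))\<bar> \<le> 1" if "r \<ge> 0" for r
  proof -
    have "exp (- t) \<le> 1" using t by simp
    moreover have "0 < exp (- r)" by simp
    ultimately show ?thesis unfolding W_def by linarith
  qed
  have W_pos: "0 < W (exp (- r)) \<longleftrightarrow> t < r \<and> r < t + d" for r
    by (auto simp: W_def less_max_iff_disj)
  have W_zero: "W (exp (- r)) = 0" if "\<not> (t \<le> r \<and> r \<le> t + d)" for r
    using W_pos[of r] W_nonneg[of "exp (- r)"] that by linarith
  have int: "set_integrable lborel {0..} (\<lambda>r. exp (- r) * v r)"
    if "continuous_on {0..} v" "\<And>r. r \<ge> 0 \<Longrightarrow> \<bar>v r\<bar> \<le> F" for v :: "real \<Rightarrow> real" and F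
    using laplace_integrable[of 1 v F] that by simp
  \<comment> \<open>Normalizing constant of the bump. It is positive, since otherwise the bump would
    vanish almost everywhere on an interval of length \<open>d\<close>.\<close>
  define c where "c = (LINT r:{0..}|lborel. exp (- r) * W (exp (- r)))"
  have W_comp: "continuous_on {0..} (\<lambda>r. W (exp (- r)))"
    by (intro continuous_on_compose2[OF W_cont[of UNIV]] continuous_intros) auto
  have W_int: "set_integrable lborel {0..} (\<lambda>r. exp (- r) * W (exp (- r)))"
    by (rule int[OF W_comp W_le])
  have c: "c > 0"
  proof (rule ccontr)
    assume "\<not> c > 0"
    moreover have "0 \<le> c"
      unfolding c_def set_lebesgue_integral_def
      by (intro Bochner_Integration.integral_nonneg) (simp add: W_nonneg)
    ultimately have "c = 0" by simp
    then have "AE r in lborel. indicat_real {0..} r *\<^sub>R (exp (- r) * W (exp (- r))) = 0"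
      unfolding c_def set_lebesgue_integral_def using W_int
      by (subst (asm) integral_nonneg_eq_0_iff_AE) (auto simp: set_integrable_def W_nonneg)
    then have "AE r in lborel. r \<notin> {t<..<t+d}"
    proof eventually_elim
      case (elim r)
      show ?case
      proof
        assume "r \<in> {t<..<t+d}"
        then show False using elim W_pos[of r] t by auto
      qed
    qed
    then have "emeasure lborel {t<..<t+d} = 0"
      by (subst (asm) AE_iff_measurable[OF _ refl]) (simp_all add: greaterThanLessThan_eq greaterThan_def lessThan_def Collect_conj_eq)
    then show False using d by simp
  qed
  have "continuous_on {0..1::real} (\<lambda>x. W x / c)"
    using c by (intro continuous_intros W_cont) auto
  then obtain P where P: "real_polynomial_function P" "\<And>x. x \<in> {0..1} \<Longrightarrow> \<bar>W x / c - P x\<bar> < \<eta>"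
    using Stone_Weierstrass_real_polynomial_function[of "{0..1::real}" _ \<eta>] \<eta> by auto
  then obtain a J where aJ: "P = (\<lambda>x. \<Sum>i\<le>J. a i * x ^ i)"
    using real_polynomial_function_iff_sum by metis
  show ?thesis
  \<comment> \<open>The coefficients depend on \<open>t\<close>, \<open>d\<close> and
    \<open>\<eta>\<close> alone and are fixed before \<open>u\<close>, so that one polynomial will
    serve every volume and every environment.\<close>
  proof (intro exI[of _ J] exI[of _ a] allI impI)
    fix u :: "real \<Rightarrow> real" and \<rho> :: real assume u: "continuous_on {0..} u" and u1: "\<forall>r\<ge>0. \<bar>u r\<bar> \<le> 1"
      and \<rho>: "\<forall>r. t \<le> r \<longrightarrow> r \<le> t + d \<longrightarrow> \<bar>u r - u t\<bar> \<le> \<rho>"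
    have \<rho>0: "0 \<le> \<rho>" using \<rho>[rule_format, of t] d by simp
    define E where "E = (\<lambda>r. exp (- r) * (W (exp (- r)) / c))"
    have iE: "set_integrable lborel {0..} E"
      unfolding E_def using set_integrable_mult_left[of "1/c" lborel "{0..}" "\<lambda>r. exp (- r) * W (exp (- r))"] W_int c
      by (simp add: field_simps)
    have E1: "(LINT r:{0..}|lborel. E r) = 1"
    proof -
      have "(LINT r:{0..}|lborel. E r) = (LINT r:{0..}|lborel. (1 / c) * (exp (- r) * W (exp (- r))))"
        by (simp add: E_def mult_ac)
      also have "\<dots> = (1 / c) * c" unfolding c_def by (rule set_integral_mult_right)
      finally show ?thesis using c by simp
    qed
    have ij: "set_integrable lborel {0..} (\<lambda>r. a j * (exp (- (real j + 1) * r) * u r))" for j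
      using laplace_integrable[of "real j + 1" u 1] u u1 by (auto intro!: set_integrable_mult_right)
    have iP: "set_integrable lborel {0..} (\<lambda>r. \<Sum>j\<le>J. a j * (exp (- (real j + 1) * r) * u r))"
      using ij unfolding set_integrable_def by (simp only: scaleR_sum_right) (intro Bochner_Integration.integrable_sum)
    have P_eq: "exp (- r) * (P (exp (- r)) * u r) = (\<Sum>j\<le>J. a j * (exp (- (real j + 1) * r) * u r))" for r
    proof -
      \<comment> \<open>The weight exp (-r) supplies one extra power; therefore the Laplace
        parameters are \<open>j + 1\<close> and stay positive.\<close>
      have "exp (- r) * exp (- r) ^ j = exp (- (real j + 1) * r)" for j
        by (simp add: exp_of_nat_mult[symmetric] exp_add[symmetric] algebra_simps)
      then show ?thesis
        unfolding aJ sum_distrib_left sum_distrib_right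
        by (intro sum.cong refl) (metis (no_types, lifting) mult.assoc mult.left_commute)
    qed
    have sum_eq: "(\<Sum>j\<le>J. a j * (LINT r:{0..}|lborel. exp (- (real j + 1) * r) * u r)) =
        (LINT r:{0..}|lborel. \<Sum>j\<le>J. a j * (exp (- (real j + 1) * r) * u r))"
      using ij unfolding set_lebesgue_integral_def set_integrable_def scaleR_sum_right
      by (subst Bochner_Integration.integral_sum) (auto simp: mult.left_commute)
    have "u t - (\<Sum>j\<le>J. a j * (LINT r:{0..}|lborel. exp (- (real j + 1) * r) * u r)) =
        (LINT r:{0..}|lborel. u t * E r) - (LINT r:{0..}|lborel. \<Sum>j\<le>J. a j * (exp (- (real j + 1) * r) * u r))"
      unfolding sum_eq by (simp add: E1)
    also have "\<dots> = (LINT r:{0..}|lborel. u t * E r - (\<Sum>j\<le>J. a j * (exp (- (real j + 1) * r) * u r)))"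
      using iE iP by (intro set_integral_diff(2)[symmetric]) auto
    also have "\<bar>\<dots>\<bar> \<le> (LINT r:{0..}|lborel. \<rho> * E r + \<eta> * exp (- r))"
    proof -
      have i1: "set_integrable lborel {0..} (\<lambda>r. u t * E r - (\<Sum>j\<le>J. a j * (exp (- (real j + 1) * r) * u r)))"
        using iE iP by (intro set_integral_diff) auto
      have i2: "set_integrable lborel {0..} (\<lambda>r. \<rho> * E r + \<eta> * exp (- r))"
        using iE laplace_one(1)[of 1] by (intro set_integral_add) auto
      have pt: "\<bar>u t * E r - (\<Sum>j\<le>J. a j * (exp (- (real j + 1) * r) * u r))\<bar> \<le> \<rho> * E r + \<eta> * exp (- r)"
        if "r \<ge> 0" for r
      proof -
        \<comment> \<open>The first summand is small because the probability density
          \<open>E\<close> lives where \<open>u\<close> is within \<open>\<rho>\<close> of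
          \<open>u t\<close>, the second because the polynomial is uniformly close to the normalized
          bump.\<close>
        have "u t * E r - (\<Sum>j\<le>J. a j * (exp (- (real j + 1) * r) * u r)) =
            E r * (u t - u r) + exp (- r) * (W (exp (- r)) / c - P (exp (- r))) * u r"
          unfolding P_eq[symmetric] by (simp add: E_def algebra_simps diff_divide_distrib)
        also have "\<bar>\<dots>\<bar> \<le> E r * \<bar>u t - u r\<bar> + exp (- r) * \<bar>W (exp (- r)) / c - P (exp (- r))\<bar> * \<bar>u r\<bar>"
          using c W_nonneg[of "exp (- r)"]
          by (intro order_trans[OF abs_triangle_ineq]) (simp add: abs_mult E_def)
        also have "\<dots> \<le> E r * \<rho> + exp (- r) * \<eta> * 1"
        proof (rule add_mono)
          show "E r * \<bar>u t - u r\<bar> \<le> E r * \<rho>"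
          proof (cases "t \<le> r \<and> r \<le> t + d")
            case True
            then have "\<bar>u t - u r\<bar> \<le> \<rho>" using \<rho> by (simp add: abs_minus_commute)
            then show ?thesis using c W_nonneg[of "exp (- r)"]
              by (intro mult_left_mono) (auto simp: E_def)
          next
            case False
            then show ?thesis by (simp add: E_def W_zero)
          qed
          have "\<bar>W (exp (- r)) / c - P (exp (- r))\<bar> \<le> \<eta>"
            using P(2)[of "exp (- r)"] that by auto
          then show "exp (- r) * \<bar>W (exp (- r)) / c - P (exp (- r))\<bar> * \<bar>u r\<bar> \<le> exp (- r) * \<eta> * 1"
            using u1 that \<eta> by (intro mult_mono mult_left_mono) auto
        qed
        finally show ?thesis by (simp add: mult.commute)
      qed
      have "\<bar>LINT r:{0..}|lborel. u t * E r - (\<Sum>j\<le>J. a j * (exp (- (real j + 1) * r) * u r))\<bar> \<le>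
          (LINT r:{0..}|lborel. \<bar>u t * E r - (\<Sum>j\<le>J. a j * (exp (- (real j + 1) * r) * u r))\<bar>)"
        using set_integral_norm_bound[OF i1] by simp
      also have "\<dots> \<le> (LINT r:{0..}|lborel. \<rho> * E r + \<eta> * exp (- r))"
        using set_integrable_abs[OF i1] i2 pt by (intro set_integral_mono) auto
      finally show ?thesis .
    qed
    also have "\<dots> = \<rho> + \<eta>"
    proof -
      have "(LINT r:{0..}|lborel. \<rho> * E r + \<eta> * exp (- r)) = \<rho> * (LINT r:{0..}|lborel. E r) + \<eta> * (LINT r:{0..}|lborel. exp (- 1 * r))"
        using iE laplace_one(1)[of 1] by (subst set_integral_add(2)) auto
      then show ?thesis using laplace_one(2)[of 1] by (simp add: E1)
    qed
    finally show "\<bar>u t - (\<Sum>j\<le>J. a j * (LINT r:{0..}|lborel. exp (- (real j + 1) * r) * u r))\<bar> \<le> \<rho> + \<eta>" .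
  qed
qed

section \<open>Estimates for the trap chain with arbitrary positive weights\<close>

locale trap_chain =
  fixes n :: nat and \<tau> :: "(nat \<Rightarrow> real) \<Rightarrow> real" and p
  assumes n: "n \<ge> 1" and tau_pos': "x \<in> cube n \<Longrightarrow> 0 < \<tau> x"
    and transition': "transition_function (cube n) (trap_rate n \<tau>) p"

sublocale trap_chain \<subseteq> reversible_chain "cube n" "trap_rate n \<tau>" p \<tau>
proof
  fix x y assume xy: "x \<in> cube n" "y \<in> cube n"
  show "0 \<le> trap_rate n \<tau> x y"
    using tau_pos'[OF xy(1)] by (simp add: trap_rate_def less_imp_le)
  show "\<tau> x * trap_rate n \<tau> x y = \<tau> y * trap_rate n \<tau> y x"
    using tau_pos'[OF xy(1)] tau_pos'[OF xy(2)] by (simp add: trap_rate_def cube_edge_sym[of n y x])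
qed (auto simp: transition' tau_pos')

context trap_chain
begin

lemma gen_eq: "x \<in> cube n \<Longrightarrow> gen f x = cube_laplacian n f x / \<tau> x"
proof -
  assume x: "x \<in> cube n"
  have ne: "\<not> cube_edge n x x" by (simp add: cube_edge_def)
  have "(\<Sum>z\<in>cube n - {x}. trap_rate n \<tau> x z) = (\<Sum>z\<in>cube n. trap_rate n \<tau> x z)"
    using x ne by (simp add: sum.remove[of "cube n" x] trap_rate_def)
  then have "gen f x = (\<Sum>y\<in>cube n. trap_rate n \<tau> x y * f y - of_bool (x = y) * (\<Sum>z\<in>cube n. trap_rate n \<tau> x z) * f y)"
    unfolding kernel_app_def using ne
    by (intro sum.cong refl) (auto simp: generator_def trap_rate_def)
  also have "\<dots> = (\<Sum>y\<in>cube n. trap_rate n \<tau> x y * (f y - f x))"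
    using x by (simp add: sum_subtractf right_diff_distrib sum_distrib_right mult.assoc)
  also have "\<dots> = (\<Sum>y\<in>cube n. if cube_edge n x y then (f y - f x) / (real n * \<tau> x) else 0)"
    by (intro sum.cong refl) (auto simp: trap_rate_def)
  also have "\<dots> = cube_laplacian n f x / \<tau> x"
    unfolding sum_cube_edges[OF x] cube_laplacian_def by (simp add: sum_divide_distrib)
  finally show ?thesis .
qed

definition mass :: real where "mass = (\<Sum>x\<in>cube n. \<tau> x)"

text \<open>The summand is the weight left to a site when the resolvent equation is solved with the
  Green kernel replaced by the identity minus the average.\<close>

definition cut_mass :: "real \<Rightarrow> real" where "cut_mass l = (\<Sum>x\<in>cube n. \<tau> x / (1 + l * \<tau> x))"

text \<open>The density of the uniform distribution with respect to the reversible weights.\<close>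

definition start :: "(nat \<Rightarrow> real) \<Rightarrow> real" where "start x = 1 / (2 ^ n * \<tau> x)"

definition overlap :: "((nat \<Rightarrow> real) \<Rightarrow> real) \<Rightarrow> real \<Rightarrow> real" where
  "overlap f t = (\<Sum>x\<in>cube n. semi t f x) / 2 ^ n"

lemma overlap_eq: "overlap f t = ip start (semi t f)"
  unfolding overlap_def ip_def sum_divide_distrib
  using tau_pos by (intro sum.cong refl) (auto simp: start_def less_imp_neq[symmetric])

lemma mass_pos: "0 < mass"
  unfolding mass_def by (intro sum_pos) (auto simp: tau_pos)

lemma cut_mass_pos: "l \<ge> 0 \<Longrightarrow> 0 < cut_mass l"
  unfolding cut_mass_def using tau_pos
  by (intro sum_pos divide_pos_pos add_pos_nonneg) (auto simp: less_imp_le)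

lemma resolvent_laplacian:
  assumes "l > 0" "x \<in> cube n"
  shows "cube_laplacian n (resolvent l f) x = - (\<tau> x * (f x - l * resolvent l f x))"
  using resolvent_equation[OF assms, of f] tau_pos[OF assms(2)]
  by (simp add: gen_eq[OF assms(2)] field_simps)

lemma laplace_overlap:
  assumes "l > 0"
  shows "(LINT t:{0..}|lborel. exp (- l * t) * overlap f t) = (\<Sum>x\<in>cube n. resolvent l f x) / 2 ^ n"
  using sum_resolvent[OF assms, of "\<lambda>_. 1 / 2 ^ n" f]
  by (simp add: overlap_def sum_divide_distrib mult_ac)

text \<open>By \<open>cube_green\<close> the resolvent equals its mean minus its Laplacian up to
  \<open>e\<close>. Inserted into the resolvent equation, this can be solved for the Laplacian site
  by site. The Laplacian sums to 0, which determines the mean.\<close>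

lemma overlap_resolvent:
  assumes l: "l > 0" and f: "\<And>x. x \<in> cube n \<Longrightarrow> 0 \<le> f x" "\<And>x. x \<in> cube n \<Longrightarrow> f x \<le> 1"
  shows "\<bar>(LINT t:{0..}|lborel. exp (- l * t) * overlap f t)
      - (\<Sum>x\<in>cube n. \<tau> x * f x / (1 + l * \<tau> x)) / (l * cut_mass l)\<bar> \<le> cube_gap n * mass"
proof -
  define v where "v = resolvent l f"
  define m where "m = (\<Sum>x\<in>cube n. v x) / 2 ^ n"
  define e where "e = (\<lambda>x. v x - m + cube_laplacian n v x)"
  define A where "A = (\<Sum>x\<in>cube n. \<tau> x * f x / (1 + l * \<tau> x))"
  have lap: "cube_laplacian n v x = - (\<tau> x * (f x - l * v x))" if "x \<in> cube n" for x
    unfolding v_def by (rule resolvent_laplacian[OF l that])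
  have abs_lap: "\<bar>cube_laplacian n v x\<bar> \<le> \<tau> x" if x: "x \<in> cube n" for x
  proof -
    have "0 \<le> l * v x" "l * v x \<le> 1"
      unfolding v_def using resolvent_bounds[OF l x f(1)] f(2) l by auto
    then have "\<bar>f x - l * v x\<bar> \<le> 1" using f[OF x] by auto
    then show ?thesis
      unfolding lap[OF x] using tau_pos[OF x] by (simp add: abs_mult mult_left_le)
  qed
  have e: "\<bar>e x\<bar> \<le> cube_gap n * mass" if "x \<in> cube n" for x
  proof -
    have "\<bar>e x\<bar> \<le> cube_gap n * (\<Sum>y\<in>cube n. \<bar>cube_laplacian n v y\<bar>)"
      unfolding e_def m_def by (rule cube_green[OF n that])
    also have "\<dots> \<le> cube_gap n * mass"
      unfolding mass_def by (intro mult_left_mono sum_mono abs_lap cube_gap_nonneg)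
    finally show ?thesis .
  qed
  have pos: "0 < 1 + l * \<tau> x" if "x \<in> cube n" for x
    using l tau_pos[OF that] by (intro add_pos_pos mult_pos_pos) auto
  have w: "cube_laplacian n v x = - (\<tau> x * f x / (1 + l * \<tau> x)) + l * m * (\<tau> x / (1 + l * \<tau> x))
      + l * (\<tau> x / (1 + l * \<tau> x) * e x)" if x: "x \<in> cube n" for x
  proof -
    have "(1 + l * \<tau> x) * cube_laplacian n v x = - (\<tau> x * f x) + l * m * \<tau> x + l * (\<tau> x * e x)"
      unfolding e_def using lap[OF x] by (simp add: algebra_simps)
    then have "cube_laplacian n v x = (- (\<tau> x * f x) + l * m * \<tau> x + l * (\<tau> x * e x)) / (1 + l * \<tau> x)"
      using pos[OF x] by (simp add: field_simps)
    then show ?thesis by (simp add: add_divide_distrib diff_divide_distrib)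
  qed
  have "0 = (\<Sum>x\<in>cube n. cube_laplacian n v x)"
    by (simp add: sum_cube_laplacian)
  also have "\<dots> = - A + l * m * cut_mass l + l * (\<Sum>x\<in>cube n. \<tau> x / (1 + l * \<tau> x) * e x)"
    by (simp add: w sum.distrib sum_subtractf sum_negf sum_distrib_left A_def cut_mass_def)
  \<comment> \<open>What remains is an average of \<open>e\<close> with weights summing to
    \<open>cut_mass l\<close>, so the bound on \<open>e\<close> passes through without any
    dependence on \<open>l\<close>.\<close>
  finally have "m - A / (l * cut_mass l) = - (\<Sum>x\<in>cube n. \<tau> x / (1 + l * \<tau> x) * e x) / cut_mass l"
    using l cut_mass_pos[of l] by (simp add: field_simps)
  also have "\<bar>\<dots>\<bar> \<le> (\<Sum>x\<in>cube n. \<tau> x / (1 + l * \<tau> x) * (cube_gap n * mass)) / cut_mass l"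
  proof -
    have "\<bar>\<Sum>x\<in>cube n. \<tau> x / (1 + l * \<tau> x) * e x\<bar> \<le> (\<Sum>x\<in>cube n. \<tau> x / (1 + l * \<tau> x) * (cube_gap n * mass))"
    proof (intro order_trans[OF sum_abs] sum_mono)
      fix x assume x: "x \<in> cube n"
      have "0 \<le> \<tau> x / (1 + l * \<tau> x)" using pos[OF x] tau_pos[OF x] by simp
      then show "\<bar>\<tau> x / (1 + l * \<tau> x) * e x\<bar> \<le> \<tau> x / (1 + l * \<tau> x) * (cube_gap n * mass)"
        unfolding abs_mult abs_of_nonneg[OF \<open>0 \<le> \<tau> x / (1 + l * \<tau> x)\<close>]
        using e[OF x] by (intro mult_left_mono)
    qed
    then show ?thesis using cut_mass_pos[of l] l by (simp add: divide_right_mono)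
  qed
  also have "\<dots> = cube_gap n * mass"
    using cut_mass_pos[of l] l unfolding sum_distrib_right[symmetric] cut_mass_def[symmetric] by simp
  finally show ?thesis
    unfolding laplace_overlap[OF l] A_def m_def v_def .
qed

lemma energy_start: "energy start t = overlap start t"
  by (simp add: energy_def overlap_eq)

text \<open>The density \<open>start\<close> need not be bounded by 1, so
  \<open>overlap_resolvent\<close> does not apply. Instead conservation of mass shows that the
  weighted resolvent has total 1/l, which bounds the Laplacian by 2 in the sum norm and gives an
  error free of \<open>mass\<close>.\<close>

lemma laplace_energy_start:
  assumes l: "l > 0"
  shows "(LINT t:{0..}|lborel. exp (- l * t) * energy start t) \<le> 1 / (l * cut_mass l) + 2 * cube_gap n"
proof -
  define v where "v = resolvent l start"
  define m where "m = (\<Sum>x\<in>cube n. v x) / 2 ^ n"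
  define e where "e = (\<lambda>x. v x - m + cube_laplacian n v x)"
  have lap: "cube_laplacian n v x = l * (\<tau> x * v x) - 1 / 2 ^ n" if "x \<in> cube n" for x
  proof -
    have "\<tau> x * start x = 1 / 2 ^ n" using tau_pos[OF that] by (simp add: start_def)
    then show ?thesis
      unfolding v_def resolvent_laplacian[OF l that, of start] by (simp add: right_diff_distrib)
  qed
  have "0 = (\<Sum>x\<in>cube n. cube_laplacian n v x)"
    by (simp add: sum_cube_laplacian)
  also have "\<dots> = l * (\<Sum>x\<in>cube n. \<tau> x * v x) - 1"
    by (simp add: lap sum_subtractf card_cube sum_distrib_left)
  finally have one: "l * (\<Sum>x\<in>cube n. \<tau> x * v x) = 1" by simp
  have v0: "0 \<le> v x" if "x \<in> cube n" for x
    unfolding v_def using resolvent_bounds(1)[OF l that, of start] tau_pos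
    by (auto simp: start_def less_imp_le)
  have "(\<Sum>y\<in>cube n. \<bar>cube_laplacian n v y\<bar>) \<le> (\<Sum>y\<in>cube n. l * (\<tau> y * v y) + 1 / 2 ^ n)"
  proof (rule sum_mono)
    fix y assume y: "y \<in> cube n"
    have "0 \<le> l * (\<tau> y * v y)" using l v0[OF y] tau_pos[OF y] by simp
    then show "\<bar>cube_laplacian n v y\<bar> \<le> l * (\<tau> y * v y) + 1 / 2 ^ n"
      unfolding lap[OF y] by (auto simp: abs_if)
  qed
  also have "\<dots> = 2"
    using one by (simp add: sum.distrib card_cube sum_distrib_left)
  finally have L2: "(\<Sum>y\<in>cube n. \<bar>cube_laplacian n v y\<bar>) \<le> 2" .
  have e: "- (2 * cube_gap n) \<le> e x" if "x \<in> cube n" for x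
  proof -
    have "\<bar>e x\<bar> \<le> cube_gap n * (\<Sum>y\<in>cube n. \<bar>cube_laplacian n v y\<bar>)"
      unfolding e_def m_def by (rule cube_green[OF n that])
    also have "\<dots> \<le> cube_gap n * 2"
      by (intro mult_left_mono L2 cube_gap_nonneg)
    finally show ?thesis by linarith
  qed
  have pos: "0 < 1 + l * \<tau> x" if "x \<in> cube n" for x
    using l tau_pos[OF that] by (intro add_pos_pos mult_pos_pos) auto
  have "(m - 2 * cube_gap n) * (\<tau> x / (1 + l * \<tau> x)) \<le> \<tau> x * v x" if x: "x \<in> cube n" for x
  proof -
    have "v x * (1 + l * \<tau> x) = m + 1 / 2 ^ n + e x"
      unfolding e_def lap[OF x] by (simp add: algebra_simps)
    \<comment> \<open>Discarding this nonnegative source term is what makes the bound on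
      \<open>m\<close> one-sided.\<close>
    moreover have "(0::real) \<le> 1 / 2 ^ n" by simp
    ultimately have "m - 2 * cube_gap n \<le> v x * (1 + l * \<tau> x)"
      using e[OF x] by linarith
    then have "(m - 2 * cube_gap n) / (1 + l * \<tau> x) \<le> v x"
      using pos[OF x] by (simp add: pos_divide_le_eq)
    then have "\<tau> x * ((m - 2 * cube_gap n) / (1 + l * \<tau> x)) \<le> \<tau> x * v x"
      using tau_pos[OF x] by (intro mult_left_mono) auto
    then show ?thesis by (simp add: mult.commute)
  qed
  then have "(m - 2 * cube_gap n) * cut_mass l \<le> (\<Sum>x\<in>cube n. \<tau> x * v x)"
    unfolding cut_mass_def sum_distrib_left by (intro sum_mono) auto
  then have "l * ((m - 2 * cube_gap n) * cut_mass l) \<le> 1"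
    unfolding one[symmetric] using l by (intro mult_left_mono) auto
  then have "m - 2 * cube_gap n \<le> 1 / (l * cut_mass l)"
    using l cut_mass_pos[of l] by (simp add: pos_le_divide_eq mult_ac)
  then show ?thesis
    unfolding energy_start laplace_overlap[OF l] m_def v_def by linarith
qed

lemma overlap_continuous: "continuous_on {0..} (overlap f)"
  unfolding overlap_def by (intro continuous_intros semi_continuous) auto

lemma overlap_bound:
  assumes "t \<ge> 0" "\<And>x. x \<in> cube n \<Longrightarrow> \<bar>f x\<bar> \<le> F"
  shows "\<bar>overlap f t\<bar> \<le> F"
proof -
  have "\<bar>\<Sum>x\<in>cube n. semi t f x\<bar> \<le> (\<Sum>x\<in>cube n. F)"
    using assms by (intro order_trans[OF sum_abs] sum_mono semi_bound) auto
  then show ?thesis by (simp add: overlap_def card_cube field_simps)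
qed

lemma energy_start_integrable:
  assumes "l > 0"
  shows "set_integrable lborel {0..} (\<lambda>t. exp (- l * t) * energy start t)"
  unfolding energy_start
proof (rule laplace_integrable[OF assms _ overlap_continuous])
  fix t :: real assume "t \<ge> 0"
  then show "\<bar>overlap start t\<bar> \<le> (\<Sum>x\<in>cube n. \<bar>start x\<bar>)"
    by (intro overlap_bound) (auto intro!: member_le_sum)
qed

lemma ip_one_start: "ip (\<lambda>_. 1) start = 1"
proof -
  have "ip (\<lambda>_. 1) start = (\<Sum>x\<in>cube n. 1 / 2 ^ n)"
    unfolding ip_def using tau_pos
    by (intro sum.cong refl) (auto simp: start_def less_imp_neq[symmetric])
  then show ?thesis by (simp add: card_cube)
qed

text \<open>Cauchy-Schwarz against the constant function; the lower bound is the energy of the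
  equilibrium density.\<close>

lemma energy_start_ge:
  assumes "t \<ge> 0"
  shows "1 / mass \<le> energy start t"
proof -
  have "(ip (\<lambda>_. 1) (semi (t / 2) start))\<^sup>2 \<le> ip (\<lambda>_. 1) (\<lambda>_. 1) * ip (semi (t / 2) start) (semi (t / 2) start)"
    by (rule ip_Cauchy_Schwarz)
  then have "1 \<le> mass * energy start t"
    using assms energy_double[of "t / 2" start]
    by (simp add: ip_one_semi ip_one_start) (simp add: ip_def mass_def)
  then show ?thesis using mass_pos by (simp add: field_simps)
qed

lemma energy_start_le:
  assumes l: "l > 0"
  shows "energy start (1 / l) \<le> exp 1 * (1 / cut_mass l + 2 * l * cube_gap n)"
proof -
  have "energy start (1 / l) \<le> exp 1 * l * (LINT t:{0..}|lborel. exp (- l * t) * energy start t)"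
    by (rule antitone_le_laplace[OF l energy_antitone energy_nonneg energy_start_integrable[OF l]])
  also have "\<dots> \<le> exp 1 * l * (1 / (l * cut_mass l) + 2 * cube_gap n)"
    using l by (intro mult_left_mono laplace_energy_start) auto
  also have "\<dots> = exp 1 * (1 / cut_mass l + 2 * l * cube_gap n)"
    using l by (simp add: field_simps)
  finally show ?thesis .
qed

text \<open>The bound of \<open>antitone_le_laplace\<close> again, after subtracting the equilibrium
  level. As \<open>l\<close> tends to 0 the two reciprocals on the right approach each other, which
  is what forces equilibration at large ages.\<close>

lemma energy_start_diff_le:
  assumes l: "l > 0"
  shows "energy start (1 / l) - 1 / mass \<le> exp 1 * (1 / cut_mass l - 1 / mass + 2 * l * cube_gap n)"
proof -
  let ?K = "\<lambda>t. energy start t - 1 / mass"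
  have i1: "set_integrable lborel {0..} (\<lambda>t. exp (- l * t) * (1 / mass))"
    using laplace_one(1)[OF l] by (intro set_integrable_mult_left) auto
  have eq: "exp (- l * t) * ?K t = exp (- l * t) * energy start t - exp (- l * t) * (1 / mass)" for t
    by (simp add: algebra_simps)
  have i2: "set_integrable lborel {0..} (\<lambda>t. exp (- l * t) * ?K t)"
    unfolding eq by (rule set_integral_diff(1)[OF energy_start_integrable[OF l] i1])
  have "?K (1 / l) \<le> exp 1 * l * (LINT t:{0..}|lborel. exp (- l * t) * ?K t)"
    using energy_antitone energy_start_ge by (intro antitone_le_laplace[OF l _ _ i2]) auto
  also have "(LINT t:{0..}|lborel. exp (- l * t) * ?K t) =
      (LINT t:{0..}|lborel. exp (- l * t) * energy start t) - 1 / l * (1 / mass)"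
    unfolding eq set_integral_diff(2)[OF energy_start_integrable[OF l] i1]
    unfolding set_integral_mult_left laplace_one(2)[OF l] ..
  also have "exp 1 * l * \<dots> \<le> exp 1 * l * (1 / (l * cut_mass l) + 2 * cube_gap n - 1 / l * (1 / mass))"
    using l laplace_energy_start[OF l] by (intro mult_left_mono) auto
  also have "\<dots> = exp 1 * (1 / cut_mass l - 1 / mass + 2 * l * cube_gap n)"
    using l by (simp add: field_simps)
  finally show ?thesis .
qed

lemma ip_le_mass:
  assumes "\<And>x. x \<in> cube n \<Longrightarrow> 0 \<le> f x" "\<And>x. x \<in> cube n \<Longrightarrow> f x \<le> 1"
  shows "ip f f \<le> mass"
  unfolding ip_def mass_def
proof (rule sum_mono)
  fix x assume x: "x \<in> cube n"
  have "f x * f x \<le> 1" using assms[OF x] by (simp add: mult_le_one)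
  then show "\<tau> x * (f x * f x) \<le> \<tau> x" using tau_pos[OF x] by (simp add: mult_left_le)
qed

text \<open>Self-adjointness moves the increment in time from \<open>f\<close> to
  \<open>start\<close>. Cauchy-Schwarz then costs the norm of \<open>f\<close>, at most
  \<open>mass\<close>, and \<open>energy_slope\<close> with \<open>m\<close> steps of length 2d
  between the times t and 2t yields the factor 1/m.\<close>

lemma overlap_increment:
  assumes f: "\<And>x. x \<in> cube n \<Longrightarrow> 0 \<le> f x" "\<And>x. x \<in> cube n \<Longrightarrow> f x \<le> 1"
    and t: "t > 0" "t \<le> r" "r \<le> t + d" and m: "m \<ge> 1" "2 * real m * d \<le> t"
  shows "(overlap f r - overlap f t)\<^sup>2 \<le> exp 1 / real m * (mass / cut_mass (1 / t) + 2 / t * cube_gap n * mass)"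
proof -
  let ?u = "\<lambda>x. semi t start x - semi r start x"
  have "overlap f r - overlap f t = - ip ?u f"
    using t by (simp add: overlap_eq ip_semi ip_diff_left)
  then have "(overlap f r - overlap f t)\<^sup>2 \<le> ip ?u ?u * ip f f"
    using ip_Cauchy_Schwarz[of ?u f] by simp
  also have "\<dots> \<le> ip ?u ?u * mass"
    by (intro mult_left_mono ip_le_mass f ip_nonneg)
  also have "ip ?u ?u \<le> energy start t / real m"
  proof -
    have "ip ?u ?u \<le> energy start (2 * t) - energy start (2 * r)"
      using t by (intro energy_increment) auto
    also have "\<dots> \<le> energy start (2 * t) - energy start (2 * t + 2 * d)"
      using t energy_antitone[of "2 * r" "2 * t + 2 * d" start] by simp
    finally have 1: "ip ?u ?u \<le> energy start (2 * t) - energy start (2 * t + 2 * d)" .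
    have "real m * (energy start (2 * t) - energy start (2 * t + 2 * d)) \<le> energy start (2 * t - real m * (2 * d))"
      using t m by (intro energy_slope) auto
    also have "\<dots> \<le> energy start t"
      using t m by (intro energy_antitone) auto
    finally have "energy start (2 * t) - energy start (2 * t + 2 * d) \<le> energy start t / real m"
      using m by (simp add: field_simps)
    with 1 show ?thesis by linarith
  qed
  also have "energy start t \<le> exp 1 * (1 / cut_mass (1 / t) + 2 * (1 / t) * cube_gap n)"
    using energy_start_le[of "1 / t"] t by simp
  finally have "(overlap f r - overlap f t)\<^sup>2 \<le> exp 1 * (1 / cut_mass (1 / t) + 2 * (1 / t) * cube_gap n) / real m * mass"
    using mass_pos m by (simp add: divide_right_mono mult_right_mono)
  then show ?thesis by (simp add: algebra_simps add_divide_distrib)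
qed

text \<open>The same duality, with the equilibrium density subtracted from the evolved start. As
  \<open>start\<close> has total weight 1, the squared norm of the difference is the energy at 2t
  minus its lower bound; this is the origin of the parameter 1/(2t).\<close>

lemma overlap_equilibrium:
  assumes f: "\<And>x. x \<in> cube n \<Longrightarrow> 0 \<le> f x" "\<And>x. x \<in> cube n \<Longrightarrow> f x \<le> 1" and t: "t > 0"
  shows "(overlap f t - (\<Sum>x\<in>cube n. \<tau> x * f x) / mass)\<^sup>2 \<le>
    exp 1 * (mass / cut_mass (1 / (2 * t)) - 1 + 1 / t * cube_gap n * mass)"
proof -
  let ?l = "1 / (2 * t)"
  let ?u = "\<lambda>x. semi t start x - 1 / mass"
  have one: "ip (semi t start) (\<lambda>_. 1) = 1"
    using t by (simp add: ip_commute[of "semi t start"] ip_one_semi ip_one_start)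
  have const: "ip g (\<lambda>_. c) = c * ip g (\<lambda>_. 1)" "ip (\<lambda>_. c) g = c * ip (\<lambda>_. 1) g" for g c
    by (auto simp: ip_def sum_distrib_left mult_ac)
  have "ip (\<lambda>_. 1) f = (\<Sum>x\<in>cube n. \<tau> x * f x)" "ip (\<lambda>_. 1) (\<lambda>_. 1) = mass"
    by (auto simp: ip_def mass_def)
  note ips = this
  have "overlap f t - (\<Sum>x\<in>cube n. \<tau> x * f x) / mass = ip ?u f"
    using t by (simp add: overlap_eq ip_semi ip_diff_left const(2)[where c = "1 / mass"] ips)
  then have "(overlap f t - (\<Sum>x\<in>cube n. \<tau> x * f x) / mass)\<^sup>2 \<le> ip ?u ?u * ip f f"
    using ip_Cauchy_Schwarz[of ?u f] by simp
  also have "\<dots> \<le> ip ?u ?u * mass"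
    by (intro mult_left_mono ip_le_mass f ip_nonneg)
  also have "ip ?u ?u = energy start (2 * t) - 1 / mass"
  proof -
    have "ip ?u ?u = energy start (2 * t) - 2 * (1 / mass * 1) + 1 / mass * (1 / mass * mass)"
      using t unfolding ip_diff by (simp add: energy_double const[where c = "1 / mass"] one ips)
    then show ?thesis using mass_pos by simp
  qed
  also have "\<dots> \<le> exp 1 * (1 / cut_mass ?l - 1 / mass + 2 * ?l * cube_gap n)"
    using energy_start_diff_le[of ?l] t by simp
  finally have "(overlap f t - (\<Sum>x\<in>cube n. \<tau> x * f x) / mass)\<^sup>2 \<le>
      exp 1 * (1 / cut_mass ?l - 1 / mass + 2 * ?l * cube_gap n) * mass"
    using mass_pos by (simp add: mult_right_mono)
  also have "\<dots> = exp 1 * (mass / cut_mass ?l - 1 + 1 / t * cube_gap n * mass)"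
    using mass_pos t by (simp add: field_simps)
  finally show ?thesis .
qed

end

section \<open>Sample paths and the correlation function\<close>

text \<open>Compared with the base exp (-c/N), powers of numbers in [0, 1] differ by at most
  \<open>N\<close> times the difference of the bases.\<close>

lemma power_tendsto_exp:
  fixes x :: "nat \<Rightarrow> real" and N :: "nat \<Rightarrow> nat"
  assumes x: "\<forall>\<^sub>F k in sequentially. 0 \<le> x k \<and> x k \<le> 1"
    and N: "filterlim N at_top sequentially" and lim: "(\<lambda>k. real (N k) * (1 - x k)) \<longlonglongrightarrow> c" and c: "c \<ge> 0"
  shows "(\<lambda>k. x k ^ N k) \<longlonglongrightarrow> exp (- c)"
proof -
  have "((\<lambda>h. (exp (- c * h) - 1) / h) \<longlongrightarrow> - c) (at_right 0)"
  proof -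
    have "((\<lambda>h. exp (- c * h)) has_real_derivative - c) (at 0)"
      by (auto intro!: derivative_eq_intros)
    then have "((\<lambda>h. exp (- c * h)) has_real_derivative - c) (at_right 0)"
      by (rule has_field_derivative_at_within)
    then show ?thesis by (simp add: has_field_derivative_iff)
  qed
  moreover have "filterlim (\<lambda>k. 1 / real (N k)) (at_right 0) sequentially"
  proof -
    have "filterlim (\<lambda>m. 1 / real m) (at_right 0) sequentially" by real_asymp
    then show ?thesis using N by (rule filterlim_compose)
  qed
  ultimately have "(\<lambda>k. (exp (- c * (1 / real (N k))) - 1) / (1 / real (N k))) \<longlonglongrightarrow> - c"
    by (rule filterlim_compose)
  from tendsto_add[OF this lim]
  have "(\<lambda>k. real (N k) * (exp (- c * (1 / real (N k))) - x k)) \<longlonglongrightarrow> 0"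
    by (simp add: algebra_simps)
  from tendsto_rabs_zero[OF this]
  have small: "(\<lambda>k. real (N k) * \<bar>exp (- c * (1 / real (N k))) - x k\<bar>) \<longlonglongrightarrow> 0"
    by (simp add: abs_mult)
  have "\<forall>\<^sub>F k in sequentially. \<bar>exp (- c) - x k ^ N k\<bar> \<le> real (N k) * \<bar>exp (- c * (1 / real (N k))) - x k\<bar>"
    using x eventually_compose_filterlim[OF eventually_gt_at_top[of 0] N]
  proof eventually_elim
    case (elim k)
    have "exp (- c) = exp (- c * (1 / real (N k))) ^ N k"
      using elim by (simp add: exp_of_nat_mult[symmetric])
    then show ?case
      using norm_power_diff[of "exp (- c * (1 / real (N k)))" "x k" "N k"] elim c by simp
  qed
  then have "(\<lambda>k. exp (- c) - x k ^ N k) \<longlonglongrightarrow> 0"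
    by (intro Lim_null_comparison[OF _ small]) simp
  from tendsto_diff[OF tendsto_const[of "exp (- c)"] this] show ?thesis by simp
qed

text \<open>It supplies a grid point strictly to the right of \<open>u\<close> and so close to it
  that, by right continuity, the path has the same value there as at \<open>u\<close>.\<close>

lemma dyadic_between:
  fixes t s u b :: real
  assumes "s > 0" "t \<le> u" "u < t + s" "u < b"
  obtains k j where "j < 2 ^ k" "u < t + real j * s / 2 ^ k" "t + real j * s / 2 ^ k < b"
proof -
  \<comment> \<open>Cutting at \<open>t + s\<close> keeps the index of the grid point below
    2^k.\<close>
  define b' where "b' = min b (t + s)"
  have b': "u < b'" "b' \<le> b" "b' \<le> t + s" using assms by (auto simp: b'_def)
  obtain k where k: "s / (b' - u) < 2 ^ k"
    using real_arch_pow[of 2 "s / (b' - u)"] by auto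
  then have sk: "s / 2 ^ k < b' - u"
    using b' by (simp add: field_simps)
  \<comment> \<open>Rounding down and adding 1 lands strictly to the right of \<open>u\<close>, by
    at most one mesh width.\<close>
  define j where "j = nat (\<lfloor>(u - t) * 2 ^ k / s\<rfloor> + 1)"
  have "0 \<le> \<lfloor>(u - t) * 2 ^ k / s\<rfloor>"
    using assms by simp
  then have j: "real j = of_int \<lfloor>(u - t) * 2 ^ k / s\<rfloor> + 1"
    by (simp add: j_def)
  have "(u - t) * 2 ^ k / s < real j" "real j \<le> (u - t) * 2 ^ k / s + 1"
    unfolding j by linarith+
  then have ineq: "(u - t) * 2 ^ k < real j * s" "real j * s \<le> (u - t) * 2 ^ k + s"
    using assms by (auto simp: field_simps)
  have "((u - t) * 2 ^ k) / 2 ^ k < real j * s / 2 ^ k" "real j * s / 2 ^ k \<le> ((u - t) * 2 ^ k + s) / 2 ^ k"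
    by (rule divide_strict_right_mono[OF ineq(1)], simp, rule divide_right_mono[OF ineq(2)], simp)
  then have 1: "u < t + real j * s / 2 ^ k" "t + real j * s / 2 ^ k \<le> u + s / 2 ^ k"
    by (simp_all add: add_divide_distrib)
  then have "t + real j * s / 2 ^ k < b'" using sk by linarith
  moreover from this have "real j * s / 2 ^ k < s" using b' by linarith
  then have "real j < 2 ^ k" using assms by (simp add: field_simps)
  then have "j < 2 ^ k" by (simp flip: of_nat_less_iff)
  ultimately show ?thesis using that 1 b' by force
qed

text \<open>By right continuity a path is constant on an interval as soon as it is constant along the
  dyadic points of that interval, where its law is given by the finite-dimensional
  distributions.\<close>

lemma markov_jump_process_stay:
  assumes mjp: "markov_jump_process P V q \<mu> X" and fin: "finite V"
    and q: "\<And>x y. x \<in> V \<Longrightarrow> y \<in> V \<Longrightarrow> 0 \<le> q x y"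
  obtains p where "transition_function V q p"
    and "\<And>t s. 0 \<le> t \<Longrightarrow> 0 \<le> s \<Longrightarrow>
      measure P {w \<in> space P. \<forall>u. t \<le> u \<and> u < t + s \<longrightarrow> X u w = X t w} =
        (\<Sum>z\<in>V. (\<Sum>x\<in>V. \<mu> x * p t x z) * exp (- s * (\<Sum>y\<in>V - {z}. q z y)))"
proof -
  from mjp obtain p where tp: "transition_function V q p" and
    fdd: "\<And>m (T :: nat \<Rightarrow> real) z. T 0 = 0 \<Longrightarrow> mono T \<Longrightarrow> (\<And>i. i \<le> m \<Longrightarrow> z i \<in> V) \<Longrightarrow>
      measure P {w\<in>space P. \<forall>i\<le>m. X (T i) w = z i} =
        \<mu> (z 0) * (\<Prod>i<m. p (T (Suc i) - T i) (z i) (z (Suc i)))"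
    unfolding markov_jump_process_def by blast
  from mjp interpret P: prob_space P by (simp add: markov_jump_process_def)
  have meas: "X t \<in> measurable P (count_space V)" if "t \<ge> 0" for t
    using mjp that by (simp add: markov_jump_process_def)
  have path: "\<forall>\<^sub>F v in at_right u. X v w = X u w" if "w \<in> space P" "u \<ge> 0" for w u
    using mjp that by (simp add: markov_jump_process_def jump_path_def)
  interpret finite_chain V q p
    by unfold_locales (use fin q tp in auto)
  have ev: "{w \<in> space P. X t w = z} \<in> P.events" if "t \<ge> 0" for t z
  proof -
    have "X t -` {z} \<inter> space P = (if z \<in> V then X t -` {z} \<inter> space P else {})"
      using measurable_space[OF meas[OF that]] by auto
    also have "\<dots> \<in> P.events"
      using measurable_sets[OF meas[OF that], of "{z}"] by auto
    finally show ?thesis by (simp add: vimage_def Int_def conj_commute)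
  qed
  have main: "measure P {w \<in> space P. \<forall>u. t \<le> u \<and> u < t + s \<longrightarrow> X u w = X t w} =
      (\<Sum>z\<in>V. (\<Sum>x\<in>V. \<mu> x * p t x z) * exp (- s * (\<Sum>y\<in>V - {z}. q z y)))"
    if t: "0 \<le> t" and s: "0 \<le> s" for t s
  proof -
    define S where "S = (\<lambda>z. {w \<in> space P. (\<forall>u. t \<le> u \<and> u < t + s \<longrightarrow> X u w = X t w) \<and> X t w = z})"
    define E where "E = (\<lambda>z k. {w \<in> space P. \<forall>j<(2::nat) ^ k. X (t + real j * s / 2 ^ k) w = z})"
    have E_ev: "E z k \<in> P.events" for z k
    proof -
      have "E z k = space P \<inter> (\<Inter>j\<in>{..<(2::nat) ^ k}. {w \<in> space P. X (t + real j * s / 2 ^ k) w = z})"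
        by (auto simp: E_def)
      also have "\<dots> \<in> P.events"
      proof -
        have "{..<(2::nat) ^ k} \<noteq> {}" by (metis lessThan_iff empty_iff zero_less_numeral zero_less_power)
        then show ?thesis using t s by (intro sets.Int sets.top sets.finite_INT ev) auto
      qed
      finally show ?thesis .
    qed
    have E_dec: "decseq (E z)" for z
    proof (rule decseq_SucI, rule subsetI)
      fix k w assume w: "w \<in> E z (Suc k)"
      have "X (t + real j * s / 2 ^ k) w = z" if "j < 2 ^ k" for j
      proof -
        have "X (t + real (2 * j) * s / 2 ^ Suc k) w = z"
          using w that unfolding E_def by (auto dest!: spec[of _ "2 * j"])
        then show ?thesis by simp
      qed
      then show "w \<in> E z k" using w by (simp add: E_def)
    qed
    have E_Int: "(\<Inter>k. E z k) = S z" for z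
    proof (intro equalityI subsetI)
      fix w assume w: "w \<in> (\<Inter>k. E z k)"
      then have E: "X (t + real j * s / 2 ^ k) w = z" if "j < 2 ^ k" for j k
        using that by (auto simp: E_def)
      have w_sp: "w \<in> space P" using w by (auto simp: E_def)
      have Xt: "X t w = z" using E[of 0 0] by simp
      have "X u w = z" if u: "t \<le> u" "u < t + s" for u
      proof -
        have "\<forall>\<^sub>F v in at_right u. X v w = X u w" using path[OF w_sp, of u] t u by simp
        then obtain b where b: "u < b" "\<And>v. u < v \<Longrightarrow> v < b \<Longrightarrow> X v w = X u w"
          unfolding eventually_at_right_field by auto
        obtain k j where "j < 2 ^ k" "u < t + real j * s / 2 ^ k" "t + real j * s / 2 ^ k < b"
          by (rule dyadic_between[of s t u b]) (use u b(1) in auto)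
        then show ?thesis using E b(2) by metis
      qed
      then show "w \<in> S z" using w_sp Xt by (auto simp: S_def)
    next
      fix w assume w: "w \<in> S z"
      have "X (t + real j * s / 2 ^ k) w = z" if j: "j < 2 ^ k" for j k
      proof (cases "s = 0")
        case True
        then show ?thesis using w by (simp add: S_def)
      next
        case False
        have "real j < 2 ^ k" using j by (simp flip: of_nat_less_iff)
        then have "real j * s / 2 ^ k < s" using False s by (simp add: field_simps)
        moreover have "0 \<le> real j * s / 2 ^ k" using s by simp
        ultimately show ?thesis using w by (auto simp: S_def)
      qed
      then show "w \<in> (\<Inter>k. E z k)" using w by (auto simp: E_def S_def)
    qed
    \<comment> \<open>The 2^k grid points enclose 2^k - 1 gaps, whence the exponent.\<close>
    have E_meas: "measure P (E z k) = (\<Sum>x\<in>V. \<mu> x * p t x z) * p (s / 2 ^ k) z z ^ (2 ^ k - 1)"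
      if z: "z \<in> V" for z k
    proof -
      define N where "N = (2::nat) ^ k"
      have N: "N = Suc (N - 1)" by (simp add: N_def)
      \<comment> \<open>Index 0 is reserved for the initial time 0, so the grid is shifted by one
        index. For \<open>t = 0\<close> the time 0 occurs twice, which is consistent because
        \<open>p 0\<close> is the identity.\<close>
      define T where "T = (\<lambda>i. if i = 0 then 0 else t + real (i - 1) * s / real N)"
      have T_mono: "mono T"
        unfolding mono_def T_def using t s by (auto intro!: divide_right_mono mult_right_mono)
      have eq: "{w\<in>space P. X 0 w = x} \<inter> E z k = {w\<in>space P. \<forall>i\<le>N. X (T i) w = (if i = 0 then x else z)}" for x
      proof -
        have "(\<forall>i\<le>N. X (T i) w = (if i = 0 then x else z)) \<longleftrightarrow>
            X 0 w = x \<and> (\<forall>j<N. X (t + real j * s / real N) w = z)" for w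
        proof -
          have "(\<forall>i\<le>N. X (T i) w = (if i = 0 then x else z)) \<longleftrightarrow>
              X (T 0) w = x \<and> (\<forall>j<N. X (T (Suc j)) w = z)"
            by (metis Suc_le_eq Zero_not_Suc le0 not0_implies_Suc)
          then show ?thesis by (simp add: T_def)
        qed
        then show ?thesis by (auto simp: E_def N_def)
      qed
      have "measure P ({w\<in>space P. X 0 w = x} \<inter> E z k) = \<mu> x * p t x z * p (s / 2 ^ k) z z ^ (2 ^ k - 1)"
        if x: "x \<in> V" for x
      proof -
        let ?z = "\<lambda>i :: nat. if i = 0 then x else z"
        have "measure P ({w\<in>space P. X 0 w = x} \<inter> E z k) =
            \<mu> (?z 0) * (\<Prod>i<N. p (T (Suc i) - T i) (?z i) (?z (Suc i)))"
          unfolding eq using x z T_mono by (intro fdd) (auto simp: T_def)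
        also have "(\<Prod>i<N. p (T (Suc i) - T i) (?z i) (?z (Suc i))) =
            p t x z * (\<Prod>i<N - 1. p (T (Suc (Suc i)) - T (Suc i)) z z)"
          by (subst N, subst prod.lessThan_Suc_shift) (simp add: T_def)
        also have "(\<Prod>i<N - 1. p (T (Suc (Suc i)) - T (Suc i)) z z) = (\<Prod>i<N - 1. p (s / real N) z z)"
          by (intro prod.cong refl arg_cong[of _ _ "\<lambda>r. p r z z"])
            (simp add: T_def diff_divide_distrib[symmetric] left_diff_distrib[symmetric])
        finally show ?thesis by (simp add: N_def)
      qed
      moreover have "measure P (E z k) = (\<Sum>x\<in>V. measure P ({w\<in>space P. X 0 w = x} \<inter> E z k))"
      proof -
        have "E z k = (\<Union>x\<in>V. {w\<in>space P. X 0 w = x} \<inter> E z k)"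
          using measurable_space[OF meas[of 0]] by (auto simp: E_def)
        then have "measure P (E z k) = measure P (\<Union>x\<in>V. {w\<in>space P. X 0 w = x} \<inter> E z k)"
          by simp
        also have "\<dots> = (\<Sum>x\<in>V. measure P ({w\<in>space P. X 0 w = x} \<inter> E z k))"
          using fin E_ev ev[of 0]
          by (intro P.finite_measure_finite_Union) (auto simp: disjoint_family_on_def)
        finally show ?thesis .
      qed
      ultimately show ?thesis by (simp add: sum_distrib_right)
    qed
    have S_meas: "measure P (S z) = (\<Sum>x\<in>V. \<mu> x * p t x z) * exp (- s * (\<Sum>y\<in>V - {z}. q z y))"
      if z: "z \<in> V" for z
    proof -
      let ?r = "\<Sum>y\<in>V - {z}. q z y"
      have r0: "0 \<le> ?r" using q z by (intro sum_nonneg) auto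
      have "(\<lambda>k. p (s / 2 ^ k) z z ^ (2 ^ k - 1)) \<longlonglongrightarrow> exp (- (s * ?r))"
      proof (cases "s = 0")
        case True
        then show ?thesis using p_0 z by simp
      next
        case False
        then have s0: "s > 0" using s by simp
        have lim: "filterlim (\<lambda>k. s / 2 ^ k) (at_right 0) sequentially"
          using s0 by real_asymp
        have "((\<lambda>h. (1 - p h z z) / h) \<longlongrightarrow> ?r) (at_right 0)"
          using tendsto_minus[OF p_deriv[OF z z]] by (simp add: generator_def minus_divide_left)
        from filterlim_compose[OF this lim]
        have d: "(\<lambda>k. (1 - p (s / 2 ^ k) z z) / (s / 2 ^ k)) \<longlonglongrightarrow> ?r" .
        have "(\<lambda>k. ((2 ^ k - 1) / 2 ^ k) * (s * ((1 - p (s / 2 ^ k) z z) / (s / 2 ^ k)))) \<longlonglongrightarrow> 1 * (s * ?r)"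
        proof (intro tendsto_mult tendsto_const d)
          show "(\<lambda>k. (2 ^ k - 1) / 2 ^ k :: real) \<longlonglongrightarrow> 1" by real_asymp
        qed
        moreover have "((2 ^ k - 1) / 2 ^ k) * (s * ((1 - p (s / 2 ^ k) z z) / (s / 2 ^ k))) =
            real (2 ^ k - 1) * (1 - p (s / 2 ^ k) z z)" for k
          using s0 by (simp add: of_nat_diff field_simps)
        ultimately have "(\<lambda>k. real (2 ^ k - 1) * (1 - p (s / 2 ^ k) z z)) \<longlonglongrightarrow> s * ?r" by simp
        moreover have "0 \<le> p h z z \<and> p h z z \<le> 1" if "h \<ge> 0" for h
          using p_nonneg[OF that z] p_sum[OF that z] fin z
          by (metis member_le_sum DiffD1)
        moreover have "filterlim (\<lambda>k. 2 ^ k - 1 :: nat) at_top sequentially"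
          unfolding filterlim_at_top
        proof
          fix Z :: nat
          show "\<forall>\<^sub>F k in sequentially. Z \<le> 2 ^ k - 1"
            using eventually_ge_at_top[of Z]
          proof eventually_elim
            case (elim k)
            have "k < 2 ^ k" by simp
            then show ?case using elim by linarith
          qed
        qed
        ultimately show ?thesis
          using s r0 by (intro power_tendsto_exp) auto
      qed
      then have "(\<lambda>k. measure P (E z k)) \<longlonglongrightarrow> (\<Sum>x\<in>V. \<mu> x * p t x z) * exp (- (s * ?r))"
        unfolding E_meas[OF z] by (intro tendsto_intros)
      moreover have "(\<lambda>k. measure P (E z k)) \<longlonglongrightarrow> measure P (\<Inter>k. E z k)"
        using E_ev E_dec by (intro P.finite_Lim_measure_decseq) auto
      ultimately show ?thesis
        unfolding E_Int using LIMSEQ_unique by fastforce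
    qed
    have S_ev: "S z \<in> P.events" for z
      unfolding E_Int[symmetric] using E_ev by (intro sets.countable_INT) auto
    have "{w \<in> space P. \<forall>u. t \<le> u \<and> u < t + s \<longrightarrow> X u w = X t w} = (\<Union>z\<in>V. S z)"
      using measurable_space[OF meas[OF t]] by (auto simp: S_def)
    then have "measure P {w \<in> space P. \<forall>u. t \<le> u \<and> u < t + s \<longrightarrow> X u w = X t w} = (\<Sum>z\<in>V. measure P (S z))"
      using fin S_ev by (simp, intro P.finite_measure_finite_Union) (auto simp: disjoint_family_on_def S_def)
    then show ?thesis by (simp add: S_meas)
  qed
  from that[OF tp main] show thesis by blast
qed

lemma transition_function_scale:
  assumes tf: "transition_function V q p" and c: "c > 0"
  shows "transition_function V (\<lambda>x y. c * q x y) (\<lambda>t. p (c * t))"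
proof -
  have rate: "((\<lambda>h. p (c * h) x y / h) \<longlongrightarrow> c * q x y) (at_right 0)"
    if lim: "((\<lambda>h. p h x y / h) \<longlongrightarrow> q x y) (at_right 0)" for x y
  proof -
    have "filterlim (\<lambda>h. c * h) (at_right 0) (at_right 0)"
      using c by real_asymp
    from tendsto_mult[OF tendsto_const[of c] filterlim_compose[OF lim this]]
    have "((\<lambda>h. c * (p (c * h) x y / (c * h))) \<longlongrightarrow> c * q x y) (at_right 0)" .
    then show ?thesis using c by simp
  qed
  show ?thesis
    using tf c unfolding transition_function_def
    by (simp add: rate distrib_left)
qed

text \<open>The overlap is an average of products that are at most 1, so it equals 1 only if all of
  them do. Thus the correlation function is the probability that the path does not move.\<close>

lemma cube_inner_eq_1:
  assumes n: "n \<ge> 1" and xy: "x \<in> cube n" "y \<in> cube n"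
  shows "cube_inner n x y / real n = 1 \<longleftrightarrow> x = y"
proof
  assume "cube_inner n x y / real n = 1"
  then have "(\<Sum>i<n. 1 - x i * y i) = 0"
    using n by (simp add: cube_inner_def sum_subtractf field_simps)
  moreover have v: "x i \<in> {-1, 1}" "y i \<in> {-1, 1}" if "i < n" for i
    using xy that by (auto simp: cube_def)
  moreover have "0 \<le> 1 - x i * y i" if "i < n" for i using v[OF that] by auto
  ultimately have "1 - x i * y i = 0" if "i < n" for i
    using that by (subst (asm) sum_nonneg_eq_0_iff) auto
  then have "x i = y i" if "i < n" for i
    using v[OF that] that by fastforce
  then show "x = y"
    using xy by (intro PiE_ext[of x "{..<n}" "\<lambda>_. {-1,1}" y]) (auto simp: cube_def)
next
  assume "x = y"
  then show "cube_inner n x y / real n = 1"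
    using n xy by (simp add: cube_inner_def cube_square)
qed

text \<open>Measuring time in units of the time-scale divides all depths by it. The exit rate of a
  vertex is the reciprocal of its depth, as it sums \<open>n\<close> equal rates, which gives the
  exponential holding factor.\<close>

lemma correlation_eq:
  assumes n: "n \<ge> 1" and dyn: "rem_dynamics M H \<beta> \<mu> P X" and w: "\<omega> \<in> space M" and c: "c n > 0"
  obtains p where "trap_chain n (\<lambda>x. trap_depth H \<beta> n \<omega> x / c n) p"
    and "\<And>t s. 0 \<le> t \<Longrightarrow> 0 \<le> s \<Longrightarrow> correlation P X c n t s \<omega> =
      (\<Sum>x\<in>cube n. \<mu> n \<omega> x *
        kernel_app (cube n) (p t) (\<lambda>z. exp (- s / (trap_depth H \<beta> n \<omega> z / c n))) x)"
proof -
  let ?\<tau> = "trap_depth H \<beta> n \<omega>"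
  let ?q = "jump_rate H \<beta> n \<omega>"
  have tau: "?\<tau> x > 0" for x by (simp add: trap_depth_def)
  have mjp: "markov_jump_process (P n \<omega>) (cube n) ?q (\<mu> n \<omega>) (X n \<omega>)"
    using dyn n w by (simp add: rem_dynamics_def)
  have meas: "X n \<omega> t \<in> measurable (P n \<omega>) (count_space (cube n))" if "t \<ge> 0" for t
    using mjp that by (simp add: markov_jump_process_def)
  have nn: "0 \<le> ?q x y" for x y
    using tau by (simp add: jump_rate_def less_imp_le)
  obtain p where p: "transition_function (cube n) ?q p"
    and stay: "\<And>t s. 0 \<le> t \<Longrightarrow> 0 \<le> s \<Longrightarrow>
      measure (P n \<omega>) {w \<in> space (P n \<omega>). \<forall>u. t \<le> u \<and> u < t + s \<longrightarrow> X n \<omega> u w = X n \<omega> t w} =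
        (\<Sum>z\<in>cube n. (\<Sum>x\<in>cube n. \<mu> n \<omega> x * p t x z) * exp (- s * (\<Sum>y\<in>cube n - {z}. ?q z y)))"
    using markov_jump_process_stay[OF mjp finite_cube nn] by blast
  have rate: "c n * ?q x y = trap_rate n (\<lambda>x. ?\<tau> x / c n) x y" for x y
    by (simp add: jump_rate_def trap_rate_def)
  have exit: "(\<Sum>y\<in>cube n - {z}. ?q z y) = 1 / ?\<tau> z" if z: "z \<in> cube n" for z
  proof -
    have "(\<Sum>y\<in>cube n - {z}. ?q z y) = (\<Sum>y\<in>cube n. ?q z y)"
      using z by (simp add: sum.remove[of "cube n" z] jump_rate_def cube_edge_def)
    also have "\<dots> = real n * (1 / (real n * ?\<tau> z))"
      unfolding jump_rate_def sum_cube_edges[OF z] by simp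
    finally show ?thesis using n by simp
  qed
  show thesis
  proof (rule that)
    show "trap_chain n (\<lambda>x. ?\<tau> x / c n) (\<lambda>t. p (c n * t))"
      using transition_function_scale[OF p c] n c tau
      by unfold_locales (auto simp: rate)
    fix t s :: real assume t: "0 \<le> t" and s: "0 \<le> s"
    have ev: "{w\<in>space (P n \<omega>). \<forall>u. t \<le> u \<and> u < t + s \<longrightarrow>
        cube_inner n (X n \<omega> (c n * t) w) (X n \<omega> (c n * u) w) / real n = 1} =
      {w \<in> space (P n \<omega>). \<forall>u. c n * t \<le> u \<and> u < c n * t + c n * s \<longrightarrow> X n \<omega> u w = X n \<omega> (c n * t) w}"
    proof -
      have X: "X n \<omega> u w \<in> cube n" if "w \<in> space (P n \<omega>)" "u \<ge> 0" for u w
        using measurable_space[OF meas[OF that(2)] that(1)] by simp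
      have "(\<forall>u. t \<le> u \<and> u < t + s \<longrightarrow>
          cube_inner n (X n \<omega> (c n * t) w) (X n \<omega> (c n * u) w) / real n = 1) \<longleftrightarrow>
        (\<forall>u. c n * t \<le> u \<and> u < c n * t + c n * s \<longrightarrow> X n \<omega> u w = X n \<omega> (c n * t) w)"
        if w: "w \<in> space (P n \<omega>)" for w
      proof -
        have 1: "cube_inner n (X n \<omega> (c n * t) w) (X n \<omega> (c n * u) w) / real n = 1 \<longleftrightarrow>
            X n \<omega> (c n * u) w = X n \<omega> (c n * t) w" if "t \<le> u" for u
          using that t c w by (subst cube_inner_eq_1[OF n X X]) auto
        have 2: "c n * t \<le> c n * u \<longleftrightarrow> t \<le> u" "c n * u < c n * t + c n * s \<longleftrightarrow> u < t + s" for u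
          using c by (auto simp flip: distrib_left)
        \<comment> \<open>Multiplication by \<open>c n\<close> is a bijection of the line, so
          quantifying over rescaled times loses nothing.\<close>
        have 3: "(\<forall>u. Q u) \<longleftrightarrow> (\<forall>u. Q (c n * u))" for Q
          using c by (metis less_imp_neq nonzero_mult_div_cancel_left times_divide_eq_right)
        show ?thesis
          using 1 by (subst (2) 3) (auto simp only: 2)
      qed
      then show ?thesis by blast
    qed
    have "correlation P X c n t s \<omega> = (\<Sum>z\<in>cube n. (\<Sum>x\<in>cube n. \<mu> n \<omega> x * p (c n * t) x z) *
        exp (- (c n * s) * (\<Sum>y\<in>cube n - {z}. ?q z y)))"
      unfolding correlation_def ev using t s c by (intro stay) auto
    also have "\<dots> = (\<Sum>z\<in>cube n. \<Sum>x\<in>cube n. \<mu> n \<omega> x * (p (c n * t) x z * exp (- s / (?\<tau> z / c n))))"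
      by (intro sum.cong refl) (simp add: exit sum_distrib_left sum_distrib_right mult_ac)
    also have "\<dots> = (\<Sum>x\<in>cube n. \<mu> n \<omega> x * kernel_app (cube n) (p (c n * t)) (\<lambda>z. exp (- s / (?\<tau> z / c n))) x)"
      by (subst sum.swap) (simp add: kernel_app_def sum_distrib_left)
    finally show "correlation P X c n t s \<omega> = \<dots>" .
  qed
qed

section \<open>Sums over Poisson points\<close>

text \<open>Convergence at plus infinity uses \<open>a > 0\<close>. At minus infinity the factor exp
  y leaves exp ((1 - a) y), which is integrable because \<open>a < 1\<close>; this is where low
  temperature enters.\<close>

lemma tilted_exp_integrable:
  fixes a :: real
  assumes a: "0 < a" "a < 1"
  shows "integrable lborel (\<lambda>y. min 1 (exp y) * exp (- a * y))"
proof -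
  have exp_int: "integrable lborel (\<lambda>y. indicat_real {0..} y * exp (- b * y))" if "b > 0" for b :: real
  proof -
    have "(\<integral>\<^sup>+y. ennreal (exp (- b * y)) * indicator {0..} y \<partial>lborel) = ennreal (0 - (- exp (- b * 0) / b))"
    proof (rule nn_integral_FTC_atLeast)
      show "((\<lambda>y. - exp (- b * y) / b) \<longlongrightarrow> 0) at_top"
        using that by real_asymp
      show "DERIV (\<lambda>y. - exp (- b * y) / b) y :> exp (- b * y)" for y
        using that by (auto intro!: derivative_eq_intros)
    qed auto
    then have "(\<integral>\<^sup>+y. ennreal (indicat_real {0..} y * exp (- b * y)) \<partial>lborel) < \<infinity>"
      by (simp add: ennreal_mult' ennreal_indicator mult.commute)
    then show ?thesis
      by (intro integrableI_nonneg) auto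
  qed
  have "integrable lborel (\<lambda>y. indicat_real {0..} (0 + (-1) * y) * exp (- (1 - a) * (0 + (-1) * y)))"
    using exp_int[of "1 - a"] a by (subst lborel_integrable_real_affine_iff) auto
  then have neg: "integrable lborel (\<lambda>y. indicat_real {0..} (- y) * exp ((1 - a) * y))"
    by (simp add: left_diff_distrib)
  show ?thesis
  proof (rule Bochner_Integration.integrable_bound[OF Bochner_Integration.integrable_add[OF exp_int[OF a(1)] neg]])
    show "AE y in lborel. norm (min 1 (exp y) * exp (- a * y)) \<le>
        norm (indicat_real {0..} y * exp (- a * y) + indicat_real {0..} (- y) * exp ((1 - a) * y))"
    proof (intro AE_I2)
      fix y :: real
      have "min 1 (exp y) * exp (- a * y) \<le> indicat_real {0..} y * exp (- a * y) + indicat_real {0..} (- y) * exp ((1 - a) * y)"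
        by (cases "y \<ge> 0") (auto simp: indicator_def min_def exp_add[symmetric] algebra_simps)
      moreover have "0 \<le> min 1 (exp y) * exp (- a * y)" by simp
      ultimately show "norm (min 1 (exp y) * exp (- a * y)) \<le>
          norm (indicat_real {0..} y * exp (- a * y) + indicat_real {0..} (- y) * exp ((1 - a) * y))"
        by simp
    qed
  qed auto
qed

text \<open>The integral of 1 - exp (-g) against the mean measure, written in the variable y = ln x,
  in which the log-depths are Gaussian.\<close>

definition levy_exponent :: "real \<Rightarrow> real \<Rightarrow> (real \<Rightarrow> real) \<Rightarrow> real" where
  "levy_exponent \<alpha> \<epsilon> g = (LINT y|lborel. (1 - exp (- g (exp y))) * (\<alpha> / \<epsilon> * exp (- \<alpha> * y)))"

text \<open>A dominating function that is linear near 0 and bounded at infinity, hence integrable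
  for the mean measure.\<close>

lemma one_minus_exp_le: "0 \<le> u \<Longrightarrow> u \<le> C * x \<Longrightarrow> 0 \<le> x \<Longrightarrow> 0 \<le> C \<Longrightarrow> \<bar>1 - exp (- u)\<bar> \<le> (1 + C) * min 1 x"
  for u C x :: real
proof -
  assume *: "0 \<le> u" "u \<le> C * x" "0 \<le> x" "0 \<le> C"
  have "1 + (- u) \<le> exp (- u)" by (rule exp_ge_add_one_self)
  then have 1: "1 - exp (- u) \<le> u" by simp
  have 2: "0 \<le> 1 - exp (- u)" "1 - exp (- u) \<le> 1" using *(1) by simp_all
  have "1 - exp (- u) \<le> (1 + C) * min 1 x"
  proof (cases "x \<le> 1")
    case True
    have "C * x \<le> (1 + C) * x" using * by (simp add: mult_right_mono)
    then show ?thesis using 1 * True by simp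
  next
    case False
    then have "(1 + C) * min 1 x = 1 + C" by simp
    then show ?thesis using 2 *(4) by linarith
  qed
  then show ?thesis using 2 by simp
qed

section \<open>Poisson points with a power-law mean measure\<close>

locale stable_points =
  fixes Q :: "'g measure" and \<mu> :: "real measure" and \<gamma> :: "nat \<Rightarrow> 'g \<Rightarrow> real" and \<alpha> \<epsilon> :: real
  assumes alpha: "0 < \<alpha>" "\<alpha> < 1" and eps: "0 < \<epsilon>"
    and sets_mu: "sets \<mu> = sets (restrict_space borel {0<..})"
    and mean: "\<And>x. x > 0 \<Longrightarrow> emeasure \<mu> {x<..} = ennreal (x powr (- \<alpha>) / \<epsilon>)"
    and marks: "poisson_marks Q \<mu> \<gamma>"
begin

abbreviation N :: "'g \<Rightarrow> real measure" where
  "N \<omega> \<equiv> distr (count_space UNIV) (restrict_space borel {0<..}) (\<lambda>k. \<gamma> k \<omega>)"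

lemma prm: "poisson_random_measure Q \<mu> N"
  and gamma_measurable: "\<gamma> k \<in> measurable Q (restrict_space borel {0<..})"
  using marks by (auto simp: poisson_marks_def)

sublocale Q: prob_space Q
  using prm by (simp add: poisson_random_measure_def)

lemma space_mu: "space \<mu> = {0<..}"
  using sets_eq_imp_space_eq[OF sets_mu] by (simp add: space_restrict_space)

lemma sets_N: "sets (N \<omega>) = sets \<mu>"
  by (simp add: sets_mu)

lemma gamma_pos: "\<omega> \<in> space Q \<Longrightarrow> 0 < \<gamma> k \<omega>"
  using measurable_space[OF gamma_measurable, of \<omega> k] by (simp add: space_restrict_space)

lemma gamma_borel [measurable]: "\<gamma> k \<in> borel_measurable Q"
  using gamma_measurable by (simp add: measurable_restrict_space2_iff)

lemma borel_imp_mu: "g \<in> borel_measurable borel \<Longrightarrow> g \<in> borel_measurable \<mu>"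
  unfolding measurable_cong_sets[OF sets_mu refl] by (rule measurable_restrict_space1)

text \<open>The mean measure is known only on half-lines. Their images under \<open>ln\<close> form
  a generator stable under intersection, with finite values, that exhausts the line.\<close>

lemma distr_ln: "distr \<mu> borel ln = density lborel (\<lambda>y. ennreal (\<alpha> / \<epsilon> * exp (- \<alpha> * y)))"
proof (rule measure_eqI_generator_eq[where E = "range greaterThan" and \<Omega> = UNIV and A = "\<lambda>i. {- real i<..}"])
  have ln: "ln \<in> borel_measurable \<mu>" by (rule borel_imp_mu) simp
  have em: "emeasure (distr \<mu> borel ln) {y<..} = ennreal (exp (- \<alpha> * y) / \<epsilon>)" for y
  proof -
    have "ln -` {y<..} \<inter> space \<mu> = {exp y<..}"
    proof -
      have "y < ln x \<longleftrightarrow> exp y < x" if "0 < x" for x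
        using exp_less_cancel_iff[of y "ln x"] that by simp
      moreover have "0 < x" if "exp y < x" for x using that exp_gt_zero[of y] by (rule less_trans[rotated])
      ultimately show ?thesis unfolding space_mu by auto
    qed
    then show ?thesis
      using mean[of "exp y"] by (simp add: emeasure_distr[OF ln] exp_powr_real mult.commute)
  qed
  show "Int_stable (range greaterThan :: real set set)"
  proof -
    have "{a<..} \<inter> {b<..} = {max a b<..}" for a b :: real by auto
    then show ?thesis by (auto simp: Int_stable_def)
  qed
  show "emeasure (distr \<mu> borel ln) X = emeasure (density lborel (\<lambda>y. ennreal (\<alpha> / \<epsilon> * exp (- \<alpha> * y)))) X"
    if X: "X \<in> range greaterThan" for X
  proof -
    obtain y where X: "X = {y<..}" using X by auto
    have "emeasure (density lborel (\<lambda>y. ennreal (\<alpha> / \<epsilon> * exp (- \<alpha> * y)))) X =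
        (\<integral>\<^sup>+t. ennreal (\<alpha> / \<epsilon> * exp (- \<alpha> * t)) * indicator {y<..} t \<partial>lborel)"
      unfolding X by (simp add: emeasure_density)
    also have "\<dots> = (\<integral>\<^sup>+t. ennreal (\<alpha> / \<epsilon> * exp (- \<alpha> * t)) * indicator {y..} t \<partial>lborel)"
      using AE_lborel_singleton[of y] by (intro nn_integral_cong_AE) (auto simp: indicator_def)
    also have "\<dots> = ennreal (0 - (- exp (- \<alpha> * y) / \<epsilon>))"
    proof (rule nn_integral_FTC_atLeast)
      show "((\<lambda>y. - exp (- \<alpha> * y) / \<epsilon>) \<longlongrightarrow> 0) at_top"
        using alpha eps by real_asymp
      show "DERIV (\<lambda>y. - exp (- \<alpha> * y) / \<epsilon>) t :> \<alpha> / \<epsilon> * exp (- \<alpha> * t)" for t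
        using eps by (auto intro!: derivative_eq_intros)
    qed (use alpha eps in auto)
    finally show ?thesis by (simp add: X em)
  qed
  show "emeasure (distr \<mu> borel ln) {- real i<..} \<noteq> \<infinity>" for i
    by (simp add: em)
  show "(\<Union>i. {- real i<..}) = (UNIV :: real set)"
  proof (intro equalityI subset_UNIV subsetI)
    fix x :: real
    obtain i where "- x < real i" using reals_Archimedean2 by blast
    then show "x \<in> (\<Union>i. {- real i<..})" by (auto intro!: exI[of _ i])
  qed
qed (auto simp: borel_Ioi)

lemma nn_integral_mu:
  assumes f: "f \<in> borel_measurable \<mu>"
  shows "(\<integral>\<^sup>+x. f x \<partial>\<mu>) = (\<integral>\<^sup>+y. f (exp y) * ennreal (\<alpha> / \<epsilon> * exp (- \<alpha> * y)) \<partial>lborel)"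
proof -
  have ln: "ln \<in> measurable \<mu> borel" by (rule borel_imp_mu) simp
  have e: "exp \<in> measurable borel \<mu>"
    unfolding measurable_cong_sets[OF refl sets_mu]
    by (rule measurable_restrict_space2) auto
  have fe: "(\<lambda>y. f (exp y)) \<in> borel_measurable borel"
    using measurable_compose[OF e f] .
  have "(\<integral>\<^sup>+x. f x \<partial>\<mu>) = (\<integral>\<^sup>+x. f (exp (ln x)) \<partial>\<mu>)"
    by (rule nn_integral_cong) (simp add: space_mu)
  also have "\<dots> = (\<integral>\<^sup>+y. f (exp y) \<partial>distr \<mu> borel ln)"
    using fe ln by (simp add: nn_integral_distr)
  also have "\<dots> = (\<integral>\<^sup>+y. f (exp y) * ennreal (\<alpha> / \<epsilon> * exp (- \<alpha> * y)) \<partial>lborel)"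
    unfolding distr_ln using fe by (subst nn_integral_density) (auto simp: mult.commute)
  finally show ?thesis .
qed

lemma nn_integral_min_finite: "(\<integral>\<^sup>+x. ennreal (min 1 x) \<partial>\<mu>) < \<infinity>"
proof -
  have "(\<integral>\<^sup>+x. ennreal (min 1 x) \<partial>\<mu>) = (\<integral>\<^sup>+y. ennreal (\<alpha> / \<epsilon> * (min 1 (exp y) * exp (- \<alpha> * y))) \<partial>lborel)"
    using alpha eps by (subst nn_integral_mu) (auto simp: ennreal_mult[symmetric] mult_ac intro!: borel_imp_mu)
  also have "\<dots> < \<infinity>"
    using integrable_mult_right[OF tilted_exp_integrable[OF alpha], of "\<alpha> / \<epsilon>"] alpha eps
    by (subst (asm) integrable_iff_bounded) (simp add: abs_mult)
  finally show ?thesis .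
qed

text \<open>Counts are extended reals. As the Poisson weights sum to 1, a count is almost surely a
  natural number, and the expectation becomes a series.\<close>

lemma count_nn_integral:
  assumes A: "A \<in> sets \<mu>" "emeasure \<mu> A < \<infinity>" and h: "h \<in> borel_measurable borel"
  shows "(\<integral>\<^sup>+\<omega>. h (emeasure (N \<omega>) A) \<partial>Q) =
    (\<Sum>k. h (of_nat k) * ennreal (measure \<mu> A ^ k / fact k * exp (- measure \<mu> A)))"
proof -
  let ?p = "\<lambda>k. measure \<mu> A ^ k / fact k * exp (- measure \<mu> A)"
  let ?E = "\<lambda>k. {\<omega> \<in> space Q. emeasure (N \<omega>) A = of_nat k}"
  have NA [measurable]: "(\<lambda>\<omega>. emeasure (N \<omega>) A) \<in> borel_measurable Q"
    using prm A by (simp add: poisson_random_measure_def)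
  have E: "?E k \<in> sets Q" for k by measurable
  have p: "measure Q (?E k) = ?p k" for k
    using prm A by (simp add: poisson_random_measure_def)
  have disj: "disjoint_family ?E"
    by (auto simp: disjoint_family_on_def)
  have "(\<lambda>k. measure Q (?E k)) sums measure Q (\<Union>k. ?E k)"
    using E disj by (intro Q.finite_measure_UNION) auto
  moreover have "(\<lambda>k. ?p k) sums (exp (measure \<mu> A) * exp (- measure \<mu> A))"
    using exp_converges[of "measure \<mu> A"] by (intro sums_mult2) (simp add: divide_inverse mult.commute)
  ultimately have "measure Q (\<Union>k. ?E k) = 1"
    unfolding p by (simp add: sums_unique2 exp_add[symmetric])
  then have "AE \<omega> in Q. \<omega> \<in> (\<Union>k. ?E k)"
    using E by (subst (asm) Q.prob_eq_1) auto
  then have AE: "AE \<omega> in Q. \<exists>k. emeasure (N \<omega>) A = of_nat k"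
    by eventually_elim auto
  have "(\<integral>\<^sup>+\<omega>. h (emeasure (N \<omega>) A) \<partial>Q) = (\<integral>\<^sup>+\<omega>. (\<Sum>k. h (of_nat k) * indicator (?E k) \<omega>) \<partial>Q)"
  proof (rule nn_integral_cong_AE)
    show "AE \<omega> in Q. h (emeasure (N \<omega>) A) = (\<Sum>k. h (of_nat k) * indicator (?E k) \<omega>)"
      using AE AE_space
    proof eventually_elim
      case (elim \<omega>)
      then obtain k where k: "emeasure (N \<omega>) A = of_nat k" by auto
      have "(\<Sum>j. h (of_nat j) * indicator (?E j) \<omega>) = (\<Sum>j\<in>{k}. h (of_nat j) * indicator (?E j) \<omega>)"
        using k by (intro suminf_finite) (auto simp: indicator_def)
      then show ?case using k elim by simp
    qed
  qed
  also have "\<dots> = (\<Sum>k. h (of_nat k) * emeasure Q (?E k))"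
    using E by (subst nn_integral_suminf) (auto simp: nn_integral_cmult_indicator)
  also have "\<dots> = (\<Sum>k. h (of_nat k) * ennreal (?p k))"
    using p by (simp add: Q.emeasure_eq_measure)
  finally show ?thesis .
qed

lemma count_mean:
  assumes A: "A \<in> sets \<mu>"
  shows "(\<integral>\<^sup>+\<omega>. emeasure (N \<omega>) A \<partial>Q) = emeasure \<mu> A"
proof (cases "emeasure \<mu> A = \<infinity>")
  case True
  then have "AE \<omega> in Q. emeasure (N \<omega>) A = \<infinity>"
    using prm A by (simp add: poisson_random_measure_def)
  then have "(\<integral>\<^sup>+\<omega>. emeasure (N \<omega>) A \<partial>Q) = (\<integral>\<^sup>+\<omega>. \<infinity> \<partial>Q)"
    by (rule nn_integral_cong_AE)
  then show ?thesis using True by (simp add: Q.emeasure_space_1)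
next
  case False
  then have fin: "emeasure \<mu> A < \<infinity>" by (simp add: less_top)
  define m where "m = measure \<mu> A"
  have m: "m \<ge> 0" by (simp add: m_def)
  have "(\<lambda>k. m * exp (- m) * (m ^ k / fact k)) sums (m * exp (- m) * exp m)"
    using exp_converges[of m] by (intro sums_mult) (simp add: divide_inverse mult.commute)
  moreover have "real (Suc k) * (m ^ Suc k / fact (Suc k) * exp (- m)) = m * exp (- m) * (m ^ k / fact k)" for k
    by (simp add: field_simps del: of_nat_Suc)
  ultimately have "(\<lambda>k. real (Suc k) * (m ^ Suc k / fact (Suc k) * exp (- m))) sums (m * exp (- m) * exp m)"
    by presburger
  moreover have "m * exp (- m) * exp m = m" by (simp add: exp_minus)
  ultimately have "(\<lambda>k. real (Suc k) * (m ^ Suc k / fact (Suc k) * exp (- m))) sums m" by simp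
  then have "(\<lambda>k. real k * (m ^ k / fact k * exp (- m))) sums m"
    by (subst (asm) sums_Suc_iff) simp
  then have "(\<Sum>k. ennreal (real k * (m ^ k / fact k * exp (- m)))) = ennreal m"
    using m by (intro suminf_ennreal_eq) auto
  moreover have "(\<integral>\<^sup>+\<omega>. emeasure (N \<omega>) A \<partial>Q) = (\<Sum>k. of_nat k * ennreal (m ^ k / fact k * exp (- m)))"
    using count_nn_integral[OF A fin, of "\<lambda>x. x"] by (simp add: m_def)
  moreover have "of_nat k * ennreal (m ^ k / fact k * exp (- m)) = ennreal (real k * (m ^ k / fact k * exp (- m)))" for k
    unfolding ennreal_of_nat_eq_real_of_nat using m by (intro ennreal_mult[symmetric]) auto
  ultimately have "(\<integral>\<^sup>+\<omega>. emeasure (N \<omega>) A \<partial>Q) = ennreal m" by presburger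
  also have "ennreal m = emeasure \<mu> A"
    unfolding m_def using False by (intro emeasure_eq_ennreal_measure[symmetric]) auto
  finally show ?thesis .
qed

text \<open>Campbell's formula, by induction over nonnegative measurable functions. Measurability of
  the random integral is carried along, since the later induction steps depend on it.\<close>

lemma campbell:
  assumes "f \<in> borel_measurable \<mu>"
  shows "(\<lambda>\<omega>. \<integral>\<^sup>+x. f x \<partial>N \<omega>) \<in> borel_measurable Q \<and> (\<integral>\<^sup>+\<omega>. (\<integral>\<^sup>+x. f x \<partial>N \<omega>) \<partial>Q) = (\<integral>\<^sup>+x. f x \<partial>\<mu>)"
  using assms
proof (induction rule: borel_measurable_induct)
  case (cong f g)
  have "(\<integral>\<^sup>+x. f x \<partial>N \<omega>) = (\<integral>\<^sup>+x. g x \<partial>N \<omega>)" for \<omega>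
    using cong by (intro nn_integral_cong) (simp add: space_mu space_restrict_space)
  moreover have "(\<integral>\<^sup>+x. f x \<partial>\<mu>) = (\<integral>\<^sup>+x. g x \<partial>\<mu>)"
    using cong by (intro nn_integral_cong) auto
  ultimately show ?case using cong by simp
next
  case (set A)
  have "(\<lambda>\<omega>. emeasure (N \<omega>) A) \<in> borel_measurable Q"
    using prm set by (simp add: poisson_random_measure_def)
  moreover have "(\<integral>\<^sup>+x. indicator A x \<partial>N \<omega>) = emeasure (N \<omega>) A" for \<omega>
    using set sets_N by (intro nn_integral_indicator) auto
  ultimately show ?case using set count_mean[OF set] by simp
next
  case (mult u c)
  have "(\<integral>\<^sup>+x. c * u x \<partial>N \<omega>) = c * (\<integral>\<^sup>+x. u x \<partial>N \<omega>)" for \<omega>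
    using mult(2) by (intro nn_integral_cmult) (simp only: measurable_cong_sets[OF sets_N refl])
  moreover have [measurable]: "(\<lambda>\<omega>. \<integral>\<^sup>+x. u x \<partial>N \<omega>) \<in> borel_measurable Q" using mult by blast
  moreover have "(\<lambda>\<omega>. c * (\<integral>\<^sup>+x. u x \<partial>N \<omega>)) \<in> borel_measurable Q" by measurable
  ultimately show ?case using mult by (simp add: nn_integral_cmult)
next
  case (add u v)
  have "(\<integral>\<^sup>+x. v x + u x \<partial>N \<omega>) = (\<integral>\<^sup>+x. v x \<partial>N \<omega>) + (\<integral>\<^sup>+x. u x \<partial>N \<omega>)" for \<omega>
  proof (rule nn_integral_add)
    show "v \<in> borel_measurable (N \<omega>)" "u \<in> borel_measurable (N \<omega>)"
      using add.hyps by (simp_all only: measurable_cong_sets[OF sets_N refl])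
  qed
  moreover have "(\<lambda>\<omega>. (\<integral>\<^sup>+x. v x \<partial>N \<omega>) + (\<integral>\<^sup>+x. u x \<partial>N \<omega>)) \<in> borel_measurable Q"
    using add.IH by (intro borel_measurable_add) blast+
  ultimately show ?case using add by (simp add: nn_integral_add)
next
  case (seq U)
  have 1: "(\<integral>\<^sup>+x. (SUP i. U i) x \<partial>N \<omega>) = (SUP i. \<integral>\<^sup>+x. U i x \<partial>N \<omega>)" for \<omega>
    unfolding SUP_apply
  proof (rule nn_integral_monotone_convergence_SUP)
    show "incseq U" by fact
    show "U i \<in> borel_measurable (N \<omega>)" for i
      using seq.hyps by (simp only: measurable_cong_sets[OF sets_N refl])
  qed
  have IHm: "(\<lambda>\<omega>. \<integral>\<^sup>+x. U i x \<partial>N \<omega>) \<in> borel_measurable Q"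
    and IHe: "(\<integral>\<^sup>+\<omega>. (\<integral>\<^sup>+x. U i x \<partial>N \<omega>) \<partial>Q) = (\<integral>\<^sup>+x. U i x \<partial>\<mu>)" for i
    using seq.IH[of i] by (rule conjunct1, rule conjunct2)
  have mono: "incseq (\<lambda>i \<omega>. \<integral>\<^sup>+x. U i x \<partial>N \<omega>)"
  proof -
    have "incseq U" by fact
    then show ?thesis by (auto simp: incseq_def le_fun_def intro!: nn_integral_mono)
  qed
  have "(\<integral>\<^sup>+\<omega>. (\<integral>\<^sup>+x. (SUP i. U i) x \<partial>N \<omega>) \<partial>Q) = (SUP i. \<integral>\<^sup>+\<omega>. (\<integral>\<^sup>+x. U i x \<partial>N \<omega>) \<partial>Q)"
    unfolding 1 by (rule nn_integral_monotone_convergence_SUP[OF mono IHm])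
  also have "\<dots> = (SUP i. \<integral>\<^sup>+x. U i x \<partial>\<mu>)" by (simp only: IHe)
  also have "\<dots> = (\<integral>\<^sup>+x. (SUP i. U i) x \<partial>\<mu>)"
    unfolding SUP_apply by (rule nn_integral_monotone_convergence_SUP[symmetric]) fact+
  finally have "(\<integral>\<^sup>+\<omega>. (\<integral>\<^sup>+x. (SUP i. U i) x \<partial>N \<omega>) \<partial>Q) = (\<integral>\<^sup>+x. (SUP i. U i) x \<partial>\<mu>)" .
  moreover have "(\<lambda>\<omega>. \<integral>\<^sup>+x. (SUP i. U i) x \<partial>N \<omega>) \<in> borel_measurable Q"
    unfolding 1 by (rule borel_measurable_SUP[OF _ IHm]) simp
  ultimately show ?case by (intro conjI)
qed

lemma nn_integral_N:
  assumes "\<omega> \<in> space Q" "f \<in> borel_measurable \<mu>"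
  shows "(\<integral>\<^sup>+x. f x \<partial>N \<omega>) = (\<Sum>k. f (\<gamma> k \<omega>))"
proof -
  have "f \<in> borel_measurable (restrict_space borel {0<..})"
    using assms(2) by (simp only: measurable_cong_sets[OF sets_mu refl])
  then show ?thesis
    using assms(1) gamma_pos
    by (subst nn_integral_distr) (auto simp: nn_integral_count_space_nat space_restrict_space)
qed

text \<open>The points truncated at 1 have a finite expected sum. Being summable they tend to 0, so
  the truncation is eventually inactive.\<close>

lemma gamma_summable: "AE \<omega> in Q. summable (\<lambda>k. \<gamma> k \<omega>)"
proof -
  have min: "(\<lambda>x. ennreal (min 1 x)) \<in> borel_measurable \<mu>"
    by (intro borel_imp_mu) measurable
  have "AE \<omega> in Q. (\<integral>\<^sup>+x. ennreal (min 1 x) \<partial>N \<omega>) \<noteq> \<infinity>"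
    using campbell[OF min] nn_integral_min_finite by (intro nn_integral_noteq_infinite) auto
  then show ?thesis
    using AE_space
  proof eventually_elim
    case (elim \<omega>)
    have pos: "0 < \<gamma> k \<omega>" for k using gamma_pos elim by simp
    have "(\<Sum>k. ennreal (min 1 (\<gamma> k \<omega>))) \<noteq> \<top>"
      using elim nn_integral_N[OF _ min] by simp
    then have sm: "summable (\<lambda>k. min 1 (\<gamma> k \<omega>))"
      using pos by (intro summable_suminf_not_top) (auto simp: less_imp_le)
    then have "(\<lambda>k. min 1 (\<gamma> k \<omega>)) \<longlonglongrightarrow> 0" by (rule summable_LIMSEQ_zero)
    then have "\<forall>\<^sub>F k in sequentially. min 1 (\<gamma> k \<omega>) < 1" by (rule order_tendstoD) simp
    then have "\<forall>\<^sub>F k in sequentially. norm (\<gamma> k \<omega>) \<le> min 1 (\<gamma> k \<omega>)"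
      by eventually_elim (use pos in \<open>auto simp: min_def less_imp_le split: if_splits\<close>)
    then show ?case using sm by (rule summable_comparison_test_ev)
  qed
qed

text \<open>Independence over disjoint sets factorizes the expectation into Laplace transforms of
  Poisson variables. The sets form an infinite sequence because independence is postulated for
  sequences.\<close>

lemma laplace_simple:
  fixes A :: "nat \<Rightarrow> real set" and a :: "nat \<Rightarrow> real"
  assumes A: "\<And>i. A i \<in> sets \<mu>" and disj: "disjoint_family A"
    and fin: "\<And>i. i < d \<Longrightarrow> emeasure \<mu> (A i) < \<infinity>" and a: "\<And>i. i < d \<Longrightarrow> 0 \<le> a i"
  shows "(LINT \<omega>|Q. exp (- (\<Sum>i<d. a i * enn2real (emeasure (N \<omega>) (A i))))) =
    exp (- (\<Sum>i<d. measure \<mu> (A i) * (1 - exp (- a i))))"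
proof -
  let ?X = "\<lambda>i \<omega>. exp (- (a i * enn2real (emeasure (N \<omega>) (A i))))"
  have NA [measurable]: "(\<lambda>\<omega>. emeasure (N \<omega>) (A i)) \<in> borel_measurable Q" for i
    using prm A by (simp add: poisson_random_measure_def)
  have "Q.indep_vars (\<lambda>_. borel) (\<lambda>i \<omega>. emeasure (N \<omega>) (A i)) UNIV"
    using prm A disj by (simp add: poisson_random_measure_def image_subset_iff)
  then have "Q.indep_vars (\<lambda>_. borel) ?X UNIV"
    by (rule Q.indep_vars_compose2) measurable
  then have ind: "Q.indep_vars (\<lambda>_. borel) ?X {..<d}"
    by (rule Q.indep_vars_subset) simp
  have int: "integrable Q (?X i)" if "i < d" for i
    using a[OF that] by (intro Q.integrable_const_bound[of _ 1]) auto
  have single: "(LINT \<omega>|Q. ?X i \<omega>) = exp (- (measure \<mu> (A i) * (1 - exp (- a i))))" if i: "i < d" for i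
  proof -
    let ?m = "measure \<mu> (A i)"
    have trm: "exp (- (a i * real k)) * (?m ^ k / fact k * exp (- ?m)) = exp (- ?m) * ((?m * exp (- a i)) ^ k / fact k)" for k
      by (simp add: power_mult_distrib exp_of_nat_mult[symmetric] mult_ac)
    have "(\<lambda>k. exp (- ?m) * ((?m * exp (- a i)) ^ k / fact k)) sums (exp (- ?m) * exp (?m * exp (- a i)))"
      using exp_converges[of "?m * exp (- a i)"] by (intro sums_mult) (simp add: divide_inverse mult.commute)
    then have s: "(\<Sum>k. ennreal (exp (- ?m) * ((?m * exp (- a i)) ^ k / fact k))) = ennreal (exp (- ?m) * exp (?m * exp (- a i)))"
      by (intro suminf_ennreal_eq) auto
    have "(\<integral>\<^sup>+\<omega>. ennreal (?X i \<omega>) \<partial>Q) =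
        (\<Sum>k. ennreal (exp (- (a i * enn2real (of_nat k)))) * ennreal (?m ^ k / fact k * exp (- ?m)))"
      using count_nn_integral[OF A fin[OF i], of "\<lambda>x. ennreal (exp (- (a i * enn2real x)))"] by simp
    also have "\<dots> = (\<Sum>k. ennreal (exp (- ?m) * ((?m * exp (- a i)) ^ k / fact k)))"
    proof (intro suminf_cong)
      fix k
      have "ennreal (exp (- (a i * real k))) * ennreal (?m ^ k / fact k * exp (- ?m)) =
          ennreal (exp (- (a i * real k)) * (?m ^ k / fact k * exp (- ?m)))"
        by (rule ennreal_mult[symmetric]) auto
      then show "ennreal (exp (- (a i * enn2real (of_nat k)))) * ennreal (?m ^ k / fact k * exp (- ?m)) =
          ennreal (exp (- ?m) * ((?m * exp (- a i)) ^ k / fact k))"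
        by (simp only: trm enn2real_of_nat)
    qed
    also have "\<dots> = ennreal (exp (- (?m * (1 - exp (- a i)))))"
      unfolding s by (simp add: exp_add[symmetric] algebra_simps)
    finally show ?thesis
      by (subst integral_eq_nn_integral) auto
  qed
  have "(LINT \<omega>|Q. exp (- (\<Sum>i<d. a i * enn2real (emeasure (N \<omega>) (A i))))) = (LINT \<omega>|Q. (\<Prod>i<d. ?X i \<omega>))"
    by (simp add: exp_sum sum_negf[symmetric])
  also have "\<dots> = (\<Prod>i<d. LINT \<omega>|Q. ?X i \<omega>)"
    using ind int by (intro Q.indep_vars_lebesgue_integral) auto
  also have "\<dots> = exp (- (\<Sum>i<d. measure \<mu> (A i) * (1 - exp (- a i))))"
    by (simp add: single exp_sum sum_negf[symmetric])
  finally show ?thesis .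
qed

lemma integral_mu:
  assumes g: "g \<in> borel_measurable borel" and b: "\<And>x. x > 0 \<Longrightarrow> \<bar>g x\<bar> \<le> C * min 1 x"
  shows "integrable \<mu> g" and "(LINT x|\<mu>. g x) = (LINT y|lborel. g (exp y) * (\<alpha> / \<epsilon> * exp (- \<alpha> * y)))"
proof -
  have ln: "ln \<in> measurable \<mu> borel" by (rule borel_imp_mu) simp
  have ge: "(\<lambda>y. g (exp y)) \<in> borel_measurable borel" using g by measurable
  have pos: "0 \<le> \<alpha> / \<epsilon> * exp (- \<alpha> * y)" for y using alpha eps by simp
  have "(LINT x|\<mu>. g x) = (LINT x|\<mu>. g (exp (ln x)))"
    by (rule Bochner_Integration.integral_cong) (auto simp: space_mu)
  also have "\<dots> = (LINT y|distr \<mu> borel ln. g (exp y))"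
    using ge ln by (simp add: integral_distr)
  also have "\<dots> = (LINT y|lborel. g (exp y) * (\<alpha> / \<epsilon> * exp (- \<alpha> * y)))"
    unfolding distr_ln using ge pos by (subst integral_density) (auto simp: mult.commute)
  finally show "(LINT x|\<mu>. g x) = (LINT y|lborel. g (exp y) * (\<alpha> / \<epsilon> * exp (- \<alpha> * y)))" .
  have "integrable \<mu> (\<lambda>x. min 1 x)"
    using nn_integral_min_finite
    by (intro integrableI_nonneg borel_imp_mu) (auto intro!: AE_I2 simp: space_mu)
  then have "integrable \<mu> (\<lambda>x. C * min 1 x)" by (rule integrable_mult_right)
  then show "integrable \<mu> g"
  proof (rule Bochner_Integration.integrable_bound)
    show "AE x in \<mu>. norm (g x) \<le> norm (C * min 1 x)"
    proof (intro AE_I2)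
      fix x assume "x \<in> space \<mu>"
      then show "norm (g x) \<le> norm (C * min 1 x)" using b[of x] by (simp add: space_mu)
    qed
  qed (rule borel_imp_mu[OF g])
qed

text \<open>First for simple functions, by independence of the counts of disjoint sets; the general
  case follows by dominated convergence on both sides.\<close>

lemma laplace_functional:
  assumes g: "g \<in> borel_measurable borel" and C: "C \<ge> 0" and b: "\<And>x. x > 0 \<Longrightarrow> 0 \<le> g x \<and> g x \<le> C * x"
  shows "(LINT \<omega>|Q. exp (- (\<Sum>k. g (\<gamma> k \<omega>)))) = exp (- levy_exponent \<alpha> \<epsilon> g)"
proof -
  \<comment> \<open>Setting the function to 0 off the positive axis makes it nonnegative everywhere,
    as the approximation by simple functions requires.\<close>
  define u where "u = (\<lambda>x. if 0 < x then g x else 0)"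
  have u: "u \<in> borel_measurable borel" unfolding u_def using g by measurable
  have u_eq: "u x = g x" if "0 < x" for x using that by (simp add: u_def)
  have "\<exists>f. incseq f \<and> (\<forall>i. simple_function \<mu> (f i)) \<and> (\<forall>x. bdd_above (range (\<lambda>i. f i x))) \<and>
             (\<forall>i x. 0 \<le> f i x) \<and> u = (SUP i. f i)"
    by (rule borel_measurable_implies_simple_function_sequence_real[OF borel_imp_mu[OF u]])
      (use b in \<open>auto simp: u_def\<close>)
  then obtain f where f: "incseq f" "\<And>i. simple_function \<mu> (f i)" "\<And>x. bdd_above (range (\<lambda>i. f i x))"
    "\<And>i x. 0 \<le> f i x" "u = (SUP i. f i)" by blast
  have f_lim: "(\<lambda>i. f i x) \<longlonglongrightarrow> u x" for x
    unfolding f(5) SUP_apply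
    using f(1,3) by (intro LIMSEQ_incseq_SUP) (auto simp: incseq_def le_fun_def)
  have f_le: "f i x \<le> u x" for i x
    unfolding f(5) SUP_apply using f(3) by (intro cSUP_upper) auto
  have f_le': "f i x \<le> C * x" if "x > 0" for i x
    using f_le[of i x] b[OF that] u_eq[OF that] by linarith
  have simple: "(LINT \<omega>|Q. exp (- (\<Sum>k. f i (\<gamma> k \<omega>)))) = exp (- (LINT x|\<mu>. 1 - exp (- f i x)))" for i
  proof -
    let ?s = "f i"
    define Y where "Y = ?s ` space \<mu> - {0}"
    have finY: "finite Y" using f(2)[of i] by (simp add: Y_def simple_function_def)
    then obtain e where e: "bij_betw e {..<card Y} Y"
      using ex_bij_betw_nat_finite[OF finY] by (auto simp: atLeast0LessThan)
    let ?d = "card Y"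
    have eY: "e j \<in> Y" if "j < ?d" for j using e that by (auto simp: bij_betw_def)
    have epos: "0 < e j" if "j < ?d" for j
      using eY[OF that] f(4) unfolding Y_def by (metis DiffE image_iff insertI1 order_le_less)
    \<comment> \<open>The level sets of the nonzero values, continued by empty sets to an infinite
      disjoint family.\<close>
    define A where "A = (\<lambda>j. if j < ?d then ?s -` {e j} \<inter> space \<mu> else {})"
    have A: "A j \<in> sets \<mu>" for j
      using f(2)[of i] by (auto simp: A_def dest: simple_functionD(2))
    have disj: "disjoint_family A"
      using e by (auto simp: A_def disjoint_family_on_def bij_betw_def inj_on_def)
    \<comment> \<open>Stated for any \<open>F\<close> vanishing at 0, since it is applied to the
      identity and to 1 - exp (-y).\<close>
    have s_eq: "F (?s x) = (\<Sum>j<?d. F (e j) * indicator (A j) x)" if F: "F 0 = 0" and x: "x \<in> space \<mu>" for F :: "real \<Rightarrow> real" and x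
    proof -
      have "(\<Sum>j<?d. F (e j) * indicator (A j) x) = (\<Sum>j<?d. (if ?s x = e j then F (e j) else 0))"
        using x by (intro sum.cong) (auto simp: A_def indicator_def)
      also have "\<dots> = (\<Sum>y\<in>Y. (if ?s x = y then F y else 0))"
        by (rule sum.reindex_bij_betw[OF e])
      also have "\<dots> = F (?s x)"
        using finY x F by (cases "?s x = 0") (auto simp: Y_def sum.delta')
      finally show ?thesis by simp
    qed
    \<comment> \<open>A nonzero value of a function below \<open>C * x\<close> keeps
      \<open>x\<close> away from 0, so the level set has finite mean measure. The denominator is
      \<open>1 + C\<close> because \<open>C\<close> may be 0.\<close>
    have A_large: "e j / (1 + C) \<le> x" "0 < x" if "x \<in> A j" "j < ?d" for x j
    proof -
      have x: "x \<in> space \<mu>" "?s x = e j" using that by (auto simp: A_def)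
      then show "0 < x" by (simp add: space_mu)
      then have "e j \<le> C * x" using f_le'[of x i] x by simp
      also have "\<dots> \<le> (1 + C) * x" using \<open>0 < x\<close> by (simp add: mult_right_mono)
      finally show "e j / (1 + C) \<le> x" using C by (simp add: field_simps)
    qed
    have A_fin: "emeasure \<mu> (A j) < \<infinity>" if j: "j < ?d" for j
    proof -
      let ?x = "e j / (1 + C) / 2"
      have x: "?x > 0" using epos[OF j] C by simp
      then have "emeasure \<mu> (A j) \<le> emeasure \<mu> {?x<..}"
      proof (intro emeasure_mono subsetI)
        fix y assume "y \<in> A j"
        from A_large(1)[OF this j] have "2 * ?x \<le> y" by (simp only: mult_2 field_sum_of_halves)
        then show "y \<in> {?x<..}" using x by simp
      next
        have "{?x<..} \<subseteq> {0<..}" using x by auto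
        then show "{?x<..} \<in> sets \<mu>" by (simp add: sets_mu sets_restrict_space_iff)
      qed
      also have "\<dots> < \<infinity>" using mean[OF x] by simp
      finally show ?thesis .
    qed
    have "AE \<omega> in Q. (\<Sum>k. ?s (\<gamma> k \<omega>)) = (\<Sum>j<?d. e j * enn2real (emeasure (N \<omega>) (A j)))"
      using gamma_summable AE_space
    proof eventually_elim
      case (elim \<omega>)
      have pos: "0 < \<gamma> k \<omega>" for k using gamma_pos elim by simp
      have sm: "summable (\<lambda>k. indicat_real (A j) (\<gamma> k \<omega>))" if j: "j < ?d" for j
      proof (rule summable_comparison_test')
        show "summable (\<lambda>k. (1 + C) / e j * \<gamma> k \<omega>)" using elim by (intro summable_mult) auto
        show "norm (indicat_real (A j) (\<gamma> k \<omega>)) \<le> (1 + C) / e j * \<gamma> k \<omega>" for k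
        proof (cases "\<gamma> k \<omega> \<in> A j")
          case True
          from A_large(1)[OF True j] have "e j \<le> \<gamma> k \<omega> * (1 + C)"
            using C by (simp add: pos_divide_le_eq)
          then show ?thesis using True epos[OF j] by (simp add: pos_le_divide_eq mult.commute)
        next
          case False
          then show ?thesis using epos[OF j] C pos[of k] by simp
        qed
      qed
      have cnt: "enn2real (emeasure (N \<omega>) (A j)) = (\<Sum>k. indicat_real (A j) (\<gamma> k \<omega>))" if j: "j < ?d" for j
      proof -
        have "emeasure (N \<omega>) (A j) = (\<integral>\<^sup>+x. indicator (A j) x \<partial>N \<omega>)"
          using A sets_N by (intro nn_integral_indicator[symmetric]) auto
        also have "\<dots> = (\<Sum>k. ennreal (indicat_real (A j) (\<gamma> k \<omega>)))"
          using elim A by (subst nn_integral_N) (auto simp: ennreal_indicator)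
        also have "\<dots> = ennreal (\<Sum>k. indicat_real (A j) (\<gamma> k \<omega>))"
          using sm[OF j] by (intro suminf_ennreal2) auto
        finally show ?thesis using sm[OF j] by (simp add: suminf_nonneg)
      qed
      have "(\<Sum>k. ?s (\<gamma> k \<omega>)) = (\<Sum>k. \<Sum>j<?d. e j * indicat_real (A j) (\<gamma> k \<omega>))"
        using s_eq[of "\<lambda>y. y"] pos by (simp add: space_mu)
      also have "\<dots> = (\<Sum>j<?d. \<Sum>k. e j * indicat_real (A j) (\<gamma> k \<omega>))"
        using sm by (intro suminf_sum summable_mult) auto
      also have "\<dots> = (\<Sum>j<?d. e j * enn2real (emeasure (N \<omega>) (A j)))"
        using sm by (intro sum.cong refl) (simp add: cnt suminf_mult)
      finally show ?case .
    qed
    then have "(LINT \<omega>|Q. exp (- (\<Sum>k. ?s (\<gamma> k \<omega>)))) =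
        (LINT \<omega>|Q. exp (- (\<Sum>j<?d. e j * enn2real (emeasure (N \<omega>) (A j)))))"
    proof (intro integral_cong_AE)
      have [measurable]: "(\<lambda>\<omega>. emeasure (N \<omega>) (A j)) \<in> borel_measurable Q" for j
        using prm A by (simp add: poisson_random_measure_def)
      show "(\<lambda>\<omega>. exp (- (\<Sum>j<?d. e j * enn2real (emeasure (N \<omega>) (A j))))) \<in> borel_measurable Q"
        by measurable
      have "?s \<in> borel_measurable (restrict_space borel {0<..})"
        using borel_measurable_simple_function[OF f(2)[of i]] by (simp only: measurable_cong_sets[OF sets_mu refl])
      from measurable_compose[OF gamma_measurable this]
      show "(\<lambda>\<omega>. exp (- (\<Sum>k. ?s (\<gamma> k \<omega>)))) \<in> borel_measurable Q"
        by measurable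
    qed auto
    also have "\<dots> = exp (- (\<Sum>j<?d. measure \<mu> (A j) * (1 - exp (- e j))))"
      using A disj A_fin epos by (intro laplace_simple) (auto simp: less_imp_le)
    also have "(\<Sum>j<?d. measure \<mu> (A j) * (1 - exp (- e j))) = (LINT x|\<mu>. 1 - exp (- ?s x))"
    proof -
      have "(LINT x|\<mu>. 1 - exp (- ?s x)) = (LINT x|\<mu>. (\<Sum>j<?d. (1 - exp (- e j)) * indicat_real (A j) x))"
        using s_eq[of "\<lambda>y. 1 - exp (- y)"] by (intro Bochner_Integration.integral_cong) auto
      also have "\<dots> = (\<Sum>j<?d. (LINT x|\<mu>. (1 - exp (- e j)) * indicat_real (A j) x))"
        using A A_fin by (intro Bochner_Integration.integral_sum integrable_mult_right integrable_real_indicator) auto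
      also have "\<dots> = (\<Sum>j<?d. measure \<mu> (A j) * (1 - exp (- e j)))"
        using A by (intro sum.cong refl) (simp add: Int_absorb2 sets.sets_into_space mult.commute)
      finally show ?thesis by simp
    qed
    finally show ?thesis .
  qed
  \<comment> \<open>Two dominations are nested: Tannery over the points with the summable
    \<open>C * \<gamma> k \<omega>\<close>, and the constant 1 under the expectation.\<close>
  have lhs: "(\<lambda>i. LINT \<omega>|Q. exp (- (\<Sum>k. f i (\<gamma> k \<omega>)))) \<longlonglongrightarrow> (LINT \<omega>|Q. exp (- (\<Sum>k. g (\<gamma> k \<omega>))))"
  proof (rule integral_dominated_convergence[where w = "\<lambda>_. 1"])
    show "AE \<omega> in Q. (\<lambda>i. exp (- (\<Sum>k. f i (\<gamma> k \<omega>)))) \<longlonglongrightarrow> exp (- (\<Sum>k. g (\<gamma> k \<omega>)))"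
      using gamma_summable AE_space
    proof eventually_elim
      case (elim \<omega>)
      have pos: "0 < \<gamma> k \<omega>" for k using gamma_pos elim by simp
      have "(\<lambda>i. \<Sum>k. f i (\<gamma> k \<omega>)) \<longlonglongrightarrow> (\<Sum>k. g (\<gamma> k \<omega>))"
      proof (rule tannerys_theorem[THEN conjunct2, THEN conjunct2])
        show "(\<lambda>i. f i (\<gamma> k \<omega>)) \<longlonglongrightarrow> g (\<gamma> k \<omega>)" for k
          using f_lim[of "\<gamma> k \<omega>"] u_eq[OF pos] by simp
        show "eventually (\<lambda>(k, n). norm (f n (\<gamma> k \<omega>)) \<le> C * \<gamma> k \<omega>) (at_top \<times>\<^sub>F sequentially)"
          using f_le'[OF pos] f(4) by (intro always_eventually) auto
        show "summable (\<lambda>k. C * \<gamma> k \<omega>)" using elim by (intro summable_mult) auto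
      qed auto
      then show ?case by (intro tendsto_intros)
    qed
    have gm: "(\<lambda>\<omega>. h (\<gamma> k \<omega>)) \<in> borel_measurable Q" if "h \<in> borel_measurable \<mu>" for h :: "real \<Rightarrow> real" and k
      using that measurable_compose[OF gamma_measurable, of h borel k]
      by (simp only: measurable_cong_sets[OF sets_mu refl])
    note [measurable] = gm[OF borel_measurable_simple_function[OF f(2)]] gm[OF borel_imp_mu[OF g]]
    show "(\<lambda>\<omega>. exp (- (\<Sum>k. f i (\<gamma> k \<omega>)))) \<in> borel_measurable Q" for i by measurable
    show "(\<lambda>\<omega>. exp (- (\<Sum>k. g (\<gamma> k \<omega>)))) \<in> borel_measurable Q" by measurable
    show "AE \<omega> in Q. norm (exp (- (\<Sum>k. f i (\<gamma> k \<omega>)))) \<le> 1" for i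
      using gamma_summable AE_space
    proof eventually_elim
      case (elim \<omega>)
      have pos: "0 < \<gamma> k \<omega>" for k using gamma_pos elim by simp
      have "summable (\<lambda>k. f i (\<gamma> k \<omega>))"
      proof (rule summable_comparison_test')
        show "summable (\<lambda>k. C * \<gamma> k \<omega>)" using elim by (intro summable_mult) auto
        show "norm (f i (\<gamma> k \<omega>)) \<le> C * \<gamma> k \<omega>" for k using f_le'[OF pos] f(4) by simp
      qed
      then have "0 \<le> (\<Sum>k. f i (\<gamma> k \<omega>))" using f(4) by (intro suminf_nonneg) auto
      then show ?case by simp
    qed
  qed simp
  have bnd: "\<bar>1 - exp (- g x)\<bar> \<le> (1 + C) * min 1 x" "\<bar>1 - exp (- f i x)\<bar> \<le> (1 + C) * min 1 x" if "0 < x" for x i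
    using one_minus_exp_le[of "g x" C x] one_minus_exp_le[of "f i x" C x] that b[OF that] f(4) f_le'[OF that] C
    by (simp_all del: abs_le_iff)
  have rhs: "(\<lambda>i. LINT x|\<mu>. 1 - exp (- f i x)) \<longlonglongrightarrow> (LINT x|\<mu>. 1 - exp (- g x))"
  proof (rule integral_dominated_convergence[where w = "\<lambda>x. (1 + C) * \<bar>min 1 x\<bar>"])
    show "(\<lambda>x. 1 - exp (- g x)) \<in> borel_measurable \<mu>" using g by (intro borel_imp_mu) measurable
    show "(\<lambda>x. 1 - exp (- f i x)) \<in> borel_measurable \<mu>" for i
      using borel_measurable_simple_function[OF f(2)[of i]] by measurable
    show "integrable \<mu> (\<lambda>x. (1 + C) * \<bar>min 1 x\<bar>)"
      by (intro integrable_mult_right integrable_abs integral_mu(1)[of _ 1]) auto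
    show "AE x in \<mu>. (\<lambda>i. 1 - exp (- f i x)) \<longlonglongrightarrow> 1 - exp (- g x)"
    proof (intro AE_I2)
      fix x assume "x \<in> space \<mu>"
      then show "(\<lambda>i. 1 - exp (- f i x)) \<longlonglongrightarrow> 1 - exp (- g x)"
        using f_lim[of x] u_eq[of x] by (auto simp: space_mu intro!: tendsto_intros)
    qed
    show "AE x in \<mu>. norm (1 - exp (- f i x)) \<le> (1 + C) * \<bar>min 1 x\<bar>" for i
      using bnd(2) by (intro AE_I2) (auto simp: space_mu)
  qed
  have "(LINT \<omega>|Q. exp (- (\<Sum>k. g (\<gamma> k \<omega>)))) = exp (- (LINT x|\<mu>. 1 - exp (- g x)))"
    using lhs tendsto_exp[OF tendsto_minus[OF rhs]] unfolding simple by (rule LIMSEQ_unique)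
  also have "(LINT x|\<mu>. 1 - exp (- g x)) = levy_exponent \<alpha> \<epsilon> g"
    unfolding levy_exponent_def using g bnd(1) by (intro integral_mu(2)[of _ "1 + C"]) auto
  finally show ?thesis .
qed

end

section \<open>Sums over the random environment\<close>

text \<open>The logarithm of the rescaled depth is Gaussian with mean -ln c and standard deviation
  \<open>\<beta> * sqrt (real n)\<close>; the proof is this change of variables.\<close>

lemma trap_depth_integral:
  assumes env: "rem_environment M H" and n: "n \<ge> 1" and x: "x \<in> cube n" and \<beta>: "\<beta> > 0" and c: "c > 0"
    and F: "F \<in> borel_measurable borel"
  shows "(LINT \<omega>|M. F (trap_depth H \<beta> n \<omega> x / c)) =
    (LINT y|lborel. F (exp y) * normal_density (- ln c) (\<beta> * sqrt (real n)) y)"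
proof -
  have D: "distributed M lborel (H n x) (normal_density 0 (sqrt (real n)))"
    using env n x by (simp add: rem_environment_def)
  have "(LINT \<omega>|M. F (trap_depth H \<beta> n \<omega> x / c)) = (LINT \<omega>|M. F (exp (- \<beta> * H n x \<omega>) / c))"
    by (simp add: trap_depth_def)
  also have "\<dots> = (LINT h|lborel. normal_density 0 (sqrt (real n)) h * F (exp (- \<beta> * h) / c))"
    using F by (intro distributed_integral[OF D, symmetric]) auto
  also have "\<dots> = \<bar>- (1 / \<beta>)\<bar> *\<^sub>R (LINT y|lborel. normal_density 0 (sqrt (real n)) (- ln c / \<beta> + - (1 / \<beta>) * y) *
      F (exp (- \<beta> * (- ln c / \<beta> + - (1 / \<beta>) * y)) / c))"
    using \<beta> by (intro lborel_integral_real_affine) auto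
  also have "\<dots> = (LINT y|lborel. (1 / \<beta>) * (normal_density 0 (sqrt (real n)) (- ln c / \<beta> + - (1 / \<beta>) * y) *
      F (exp (- \<beta> * (- ln c / \<beta> + - (1 / \<beta>) * y)) / c)))"
    using \<beta> by simp
  also have "\<dots> = (LINT y|lborel. F (exp y) * normal_density (- ln c) (\<beta> * sqrt (real n)) y)"
  proof (rule Bochner_Integration.integral_cong[OF refl])
    fix y :: real
    have e: "exp (- \<beta> * (- ln c / \<beta> + - (1 / \<beta>) * y)) / c = exp y"
      using \<beta> c by (simp add: algebra_simps exp_add)
    have "- ln c / \<beta> + - (1 / \<beta>) * y = - ((y + ln c) / \<beta>)"
      using \<beta> by (simp add: field_simps)
    then have "(- ln c / \<beta> + - (1 / \<beta>) * y)\<^sup>2 = (y + ln c)\<^sup>2 / \<beta>\<^sup>2"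
      by (simp only: power2_minus power_divide)
    then have sq: "- (- ln c / \<beta> + - (1 / \<beta>) * y)\<^sup>2 / (2 * real n) = - (y + ln c)\<^sup>2 / (2 * (\<beta>\<^sup>2 * real n))"
      by simp
    have "sqrt (2 * pi * (\<beta>\<^sup>2 * real n)) = \<beta> * sqrt (2 * pi * real n)"
      using \<beta> by (simp add: real_sqrt_mult)
    then have "1 / \<beta> * normal_density 0 (sqrt (real n)) (- ln c / \<beta> + - (1 / \<beta>) * y) =
        normal_density (- ln c) (\<beta> * sqrt (real n)) y"
      using \<beta> sq by (simp add: normal_density_def power_mult_distrib)
    then show "(1 / \<beta>) * (normal_density 0 (sqrt (real n)) (- ln c / \<beta> + - (1 / \<beta>) * y) *
        F (exp (- \<beta> * (- ln c / \<beta> + - (1 / \<beta>) * y)) / c)) = F (exp y) * normal_density (- ln c) (\<beta> * sqrt (real n)) y"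
      unfolding e by (simp add: mult_ac)
  qed
  finally show ?thesis .
qed

lemma rem_measurable:
  assumes "rem_environment M H" "n \<ge> 1" "x \<in> cube n"
  shows "H n x \<in> borel_measurable M"
  using assms unfolding rem_environment_def distributed_def by auto

lemma trap_depth_tail:
  assumes env: "rem_environment M H" and n: "n \<ge> 1" and x: "x \<in> cube n" and \<beta>: "\<beta> > 0" and c: "c > 0"
  shows "measure M {\<omega>\<in>space M. trap_depth H \<beta> n \<omega> x \<ge> c} =
    (LINT y|lborel. indicat_real {0..} y * normal_density (- ln c) (\<beta> * sqrt (real n)) y)"
proof -
  have [measurable]: "H n x \<in> borel_measurable M" by (rule rem_measurable[OF env n x])
  have "measure M {\<omega>\<in>space M. trap_depth H \<beta> n \<omega> x \<ge> c} = (LINT \<omega>|M. indicat_real {\<omega>\<in>space M. trap_depth H \<beta> n \<omega> x \<ge> c} \<omega>)"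
    by (simp add: Int_def conj_commute)
  also have "\<dots> = (LINT \<omega>|M. indicat_real {1..} (trap_depth H \<beta> n \<omega> x / c))"
    using c by (intro Bochner_Integration.integral_cong) (auto simp: indicator_def)
  also have "\<dots> = (LINT y|lborel. indicat_real {1..} (exp y) * normal_density (- ln c) (\<beta> * sqrt (real n)) y)"
    by (rule trap_depth_integral[OF env n x \<beta> c]) simp
  also have "(\<lambda>y :: real. indicat_real {1..} (exp y)) = indicat_real {0..}"
    by (simp add: indicator_def fun_eq_iff)
  finally show ?thesis by (simp add: fun_eq_iff)
qed

text \<open>Above, the mixed term of the square is dropped for nonnegative \<open>y\<close>. Below,
  the integral is restricted to [0, \<open>\<sigma>\<close>], where the density is smallest at the
  right end. Such crude bounds suffice for the tail on the logarithmic scale.\<close>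

lemma gaussian_tail_bounds:
  assumes s: "\<sigma> > 0" and L: "L \<ge> 0"
  shows "(LINT y|lborel. indicat_real {0..} y * normal_density (- L) \<sigma> y) \<le> exp (- (L / \<sigma>)\<^sup>2 / 2)"
    and "exp (- (L / \<sigma> + 1)\<^sup>2 / 2) / sqrt (2 * pi) \<le> (LINT y|lborel. indicat_real {0..} y * normal_density (- L) \<sigma> y)"
proof -
  have int: "integrable lborel (\<lambda>y. indicat_real {0..} y * normal_density (- L) \<sigma> y)"
    using integrable_mult_indicator[of "{0::real..}" lborel "normal_density (- L) \<sigma>"] integrable_normal_density[OF s, of "- L"] by simp
  have "(LINT y|lborel. indicat_real {0..} y * normal_density (- L) \<sigma> y) \<le>
      (LINT y|lborel. exp (- (L / \<sigma>)\<^sup>2 / 2) * normal_density 0 \<sigma> y)"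
  proof (rule integral_mono[OF int])
    show "integrable lborel (\<lambda>y. exp (- (L / \<sigma>)\<^sup>2 / 2) * normal_density 0 \<sigma> y)"
      using integrable_normal_density[OF s] by simp
    fix y :: real
    show "indicat_real {0..} y * normal_density (- L) \<sigma> y \<le> exp (- (L / \<sigma>)\<^sup>2 / 2) * normal_density 0 \<sigma> y"
    proof (cases "y \<ge> 0")
      case True
      have "L\<^sup>2 + y\<^sup>2 \<le> (y + L)\<^sup>2" using True L by (simp add: power2_sum)
      then have "- (y + L)\<^sup>2 / (2 * \<sigma>\<^sup>2) \<le> - (L\<^sup>2 + y\<^sup>2) / (2 * \<sigma>\<^sup>2)"
        by (intro divide_right_mono) auto
      also have "\<dots> = - (L / \<sigma>)\<^sup>2 / 2 + - y\<^sup>2 / (2 * \<sigma>\<^sup>2)"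
        using s by (simp add: power_divide add_divide_distrib diff_divide_distrib)
      finally have "exp (- (y + L)\<^sup>2 / (2 * \<sigma>\<^sup>2)) \<le> exp (- (L / \<sigma>)\<^sup>2 / 2) * exp (- y\<^sup>2 / (2 * \<sigma>\<^sup>2))"
        by (simp add: exp_add[symmetric])
      then have "1 / sqrt (2 * pi * \<sigma>\<^sup>2) * exp (- (y + L)\<^sup>2 / (2 * \<sigma>\<^sup>2)) \<le>
          1 / sqrt (2 * pi * \<sigma>\<^sup>2) * (exp (- (L / \<sigma>)\<^sup>2 / 2) * exp (- y\<^sup>2 / (2 * \<sigma>\<^sup>2)))"
        by (rule mult_left_mono) simp
      then show ?thesis using True by (simp add: normal_density_def mult_ac)
    qed (simp add: normal_density_nonneg)
  qed
  also have "\<dots> = exp (- (L / \<sigma>)\<^sup>2 / 2)"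
    using integral_normal_density[OF s, of 0] by simp
  finally show "(LINT y|lborel. indicat_real {0..} y * normal_density (- L) \<sigma> y) \<le> exp (- (L / \<sigma>)\<^sup>2 / 2)" .
  let ?m = "exp (- (L / \<sigma> + 1)\<^sup>2 / 2) / sqrt (2 * pi)"
  have "?m = (LINT y|lborel. indicat_real {0..\<sigma>} y * (?m / \<sigma>))"
    using s by simp
  also have "\<dots> \<le> (LINT y|lborel. indicat_real {0..} y * normal_density (- L) \<sigma> y)"
  proof (rule integral_mono[OF _ int])
    show "integrable lborel (\<lambda>y. indicat_real {0..\<sigma>} y * (?m / \<sigma>))"
      using s by (intro integrable_mult_left integrable_real_indicator) auto
    fix y :: real
    show "indicat_real {0..\<sigma>} y * (?m / \<sigma>) \<le> indicat_real {0..} y * normal_density (- L) \<sigma> y"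
    proof (cases "y \<in> {0..\<sigma>}")
      case True
      have "(y + L)\<^sup>2 \<le> (\<sigma> + L)\<^sup>2" using True L by (intro power_mono) auto
      then have "- (\<sigma> + L)\<^sup>2 / (2 * \<sigma>\<^sup>2) \<le> - (y + L)\<^sup>2 / (2 * \<sigma>\<^sup>2)"
        by (intro divide_right_mono) auto
      moreover have "(\<sigma> + L)\<^sup>2 / \<sigma>\<^sup>2 = (L / \<sigma> + 1)\<^sup>2"
      proof -
        have "(\<sigma> + L) / \<sigma> = L / \<sigma> + 1" using s by (simp add: field_simps)
        then show ?thesis by (simp only: power_divide[symmetric])
      qed
      then have "- (\<sigma> + L)\<^sup>2 / (2 * \<sigma>\<^sup>2) = - (L / \<sigma> + 1)\<^sup>2 / 2"
        by (metis (no_types, opaque_lifting) divide_divide_eq_left minus_divide_left mult.commute)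
      ultimately have "exp (- (L / \<sigma> + 1)\<^sup>2 / 2) \<le> exp (- (y + L)\<^sup>2 / (2 * \<sigma>\<^sup>2))" by simp
      then have "1 / (sqrt (2 * pi) * \<sigma>) * exp (- (L / \<sigma> + 1)\<^sup>2 / 2) \<le> 1 / (sqrt (2 * pi) * \<sigma>) * exp (- (y + L)\<^sup>2 / (2 * \<sigma>\<^sup>2))"
        using s by (intro mult_left_mono) auto
      moreover have "sqrt (2 * pi * \<sigma>\<^sup>2) = sqrt (2 * pi) * \<sigma>" using s by (simp add: real_sqrt_mult)
      ultimately show ?thesis using True by (simp add: normal_density_def mult_ac)
    next
      case False
      then show ?thesis using s by (auto simp: indicator_def normal_density_nonneg)
    qed
  qed
  finally show "?m \<le> (LINT y|lborel. indicat_real {0..} y * normal_density (- L) \<sigma> y)" .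
qed

section \<open>Depths on the extreme time-scale by Gaussian tilting\<close>

locale extreme_rem =
  fixes M :: "'w measure" and H :: "nat \<Rightarrow> (nat \<Rightarrow> real) \<Rightarrow> 'w \<Rightarrow> real" and \<beta> \<alpha> \<epsilon> :: real and c :: "nat \<Rightarrow> real"
  assumes env: "rem_environment M H" and alpha_def: "\<alpha> = sqrt (2 * ln 2) / \<beta>"
    and beta: "\<beta> > sqrt (2 * ln 2)" and scale: "extreme_time_scale M H \<beta> c \<epsilon>"
begin

sublocale prob_space M
  using env by (simp add: rem_environment_def)

lemma beta_pos: "\<beta> > 0"
proof -
  have "0 \<le> sqrt (2 * ln 2 :: real)" by simp
  then show ?thesis using beta by linarith
qed

lemma alpha_bounds: "0 < \<alpha>" "\<alpha> < 1"
  using beta beta_pos by (auto simp: alpha_def)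

lemma c_at_top: "filterlim c at_top sequentially" and eps_pos: "\<epsilon> > 0"
  using scale by (auto simp: extreme_time_scale_def)

lemma c_gt_1: "\<forall>\<^sub>F n in sequentially. c n > 1 \<and> n \<ge> 1"
  using filterlim_at_top_dense[THEN iffD1, OF c_at_top, rule_format, of 1] eventually_ge_at_top[of 1]
  by (rule eventually_conj)

definition tail :: "nat \<Rightarrow> real" where
  "tail n = (LINT y|lborel. indicat_real {0..} y * normal_density (- ln (c n)) (\<beta> * sqrt (real n)) y)"

lemma tail_limit: "(\<lambda>n. 2 ^ n * tail n) \<longlonglongrightarrow> 1 / \<epsilon>"
proof -
  obtain a :: "nat \<Rightarrow> real" where
    a: "\<And>n x. n \<ge> 1 \<Longrightarrow> x \<in> cube n \<Longrightarrow> a n * measure M {\<omega>\<in>space M. trap_depth H \<beta> n \<omega> x \<ge> c n} = 1"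
    and lim: "(\<lambda>n. a n / 2 ^ n) \<longlonglongrightarrow> \<epsilon>"
    using scale unfolding extreme_time_scale_def by blast
  have "(\<lambda>n. 1 / (a n / 2 ^ n)) \<longlonglongrightarrow> 1 / \<epsilon>"
    using eps_pos by (intro tendsto_intros lim) auto
  moreover have "\<forall>\<^sub>F n in sequentially. 1 / (a n / 2 ^ n) = 2 ^ n * tail n"
    using c_gt_1
  proof eventually_elim
    case (elim n)
    obtain x where x: "x \<in> cube n" using cube_nonempty by blast
    have "measure M {\<omega>\<in>space M. trap_depth H \<beta> n \<omega> x \<ge> c n} = tail n"
      unfolding tail_def using elim x by (intro trap_depth_tail env beta_pos) auto
    then have *: "a n * tail n = 1" using a[of n x] x elim by simp
    then have "a n \<noteq> 0" by auto
    then have "tail n = 1 / a n" using * by (simp add: eq_divide_eq mult.commute)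
    then show ?case by simp
  qed
  ultimately show ?thesis by (rule Lim_transform_eventually)
qed

text \<open>Up to bounded terms, the tail bounds place 2 n ln 2 between the squares of
  \<open>u n\<close> and \<open>u n + 1\<close>. Hence \<open>u n\<close> grows like the square root
  of \<open>n\<close> times the critical inverse temperature, and division by \<open>\<beta>\<close>
  gives \<open>\<alpha>\<close>.\<close>

lemma log_scale_limit: "(\<lambda>n. ln (c n) / (real n * \<beta>\<^sup>2)) \<longlonglongrightarrow> \<alpha>"
proof -
  define u where "u = (\<lambda>n. ln (c n) / (\<beta> * sqrt (real n)))"
  \<comment> \<open>\<open>A\<close> and \<open>B\<close> absorb the bounds 1/(2 \<epsilon>) and
    2/\<epsilon>, which enclose the limit 1/\<epsilon> of the expected number of deep traps.\<close>
  define A where "A = 2 * ln (2 * \<epsilon>)"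
  define B where "B = 2 * ln (sqrt (2 * pi) * (2 / \<epsilon>))"
  have "\<forall>\<^sub>F n in sequentially. 1 / (2 * \<epsilon>) < 2 ^ n * tail n" "\<forall>\<^sub>F n in sequentially. 2 ^ n * tail n < 2 / \<epsilon>"
  proof -
    have "1 / (2 * \<epsilon>) < 1 / \<epsilon>" "1 / \<epsilon> < 2 / \<epsilon>" using eps_pos by (auto simp: field_simps)
    then show "\<forall>\<^sub>F n in sequentially. 1 / (2 * \<epsilon>) < 2 ^ n * tail n" "\<forall>\<^sub>F n in sequentially. 2 ^ n * tail n < 2 / \<epsilon>"
      using order_tendstoD[OF tail_limit] by blast+
  qed
  then have bounds: "\<forall>\<^sub>F n in sequentially. (u n)\<^sup>2 \<le> 2 * real n * ln 2 + A \<and> 2 * real n * ln 2 - B \<le> (u n + 1)\<^sup>2 \<and> 0 \<le> u n"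
    using c_gt_1
  proof eventually_elim
    case (elim n)
    have s: "\<beta> * sqrt (real n) > 0" using elim beta_pos by simp
    have L: "ln (c n) \<ge> 0" using elim by simp
    have "1 / (2 * \<epsilon>) \<le> 2 ^ n * exp (- (u n)\<^sup>2 / 2)"
      using elim gaussian_tail_bounds(1)[OF s L] unfolding tail_def u_def
      by (smt (verit) mult_left_mono zero_le_power)
    then have "ln (1 / (2 * \<epsilon>)) \<le> ln (2 ^ n * exp (- (u n)\<^sup>2 / 2))"
      using eps_pos by (subst ln_le_cancel_iff) auto
    then have 1: "- ln (2 * \<epsilon>) \<le> real n * ln 2 - (u n)\<^sup>2 / 2"
      using eps_pos by (simp add: ln_div ln_mult ln_realpow)
    have "2 ^ n * (exp (- (u n + 1)\<^sup>2 / 2) / sqrt (2 * pi)) \<le> 2 / \<epsilon>"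
      using elim gaussian_tail_bounds(2)[OF s L] unfolding tail_def u_def
      by (smt (verit) mult_left_mono zero_le_power)
    then have "2 ^ n * exp (- (u n + 1)\<^sup>2 / 2) \<le> sqrt (2 * pi) * (2 / \<epsilon>)"
      by (simp add: field_simps)
    then have "ln (2 ^ n * exp (- (u n + 1)\<^sup>2 / 2)) \<le> ln (sqrt (2 * pi) * (2 / \<epsilon>))"
      using eps_pos by (subst ln_le_cancel_iff) auto
    then have 2: "real n * ln 2 - (u n + 1)\<^sup>2 / 2 \<le> ln (sqrt (2 * pi) * (2 / \<epsilon>))"
      by (simp add: ln_mult ln_realpow)
    have "0 \<le> u n" unfolding u_def using s L by simp
    then show ?case using 1 2 by (simp add: A_def B_def)
  qed
  have "(\<lambda>n. u n / sqrt (real n)) \<longlonglongrightarrow> sqrt (2 * ln 2)"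
  proof (rule tendsto_sandwich)
    show "\<forall>\<^sub>F n in sequentially. sqrt (2 * ln 2 - B / real n) - 1 / sqrt (real n) \<le> u n / sqrt (real n)"
      using bounds eventually_gt_at_top[of 0]
    proof eventually_elim
      case (elim n)
      have "(2 * real n * ln 2 - B) / real n \<le> (u n + 1)\<^sup>2 / real n"
        using elim by (intro divide_right_mono) auto
      then have "2 * ln 2 - B / real n \<le> ((u n + 1) / sqrt (real n))\<^sup>2"
        using elim by (simp add: power_divide diff_divide_distrib)
      then have "sqrt (2 * ln 2 - B / real n) \<le> (u n + 1) / sqrt (real n)"
        using elim by (intro real_le_lsqrt) auto
      then show ?case by (simp add: add_divide_distrib)
    qed
    show "\<forall>\<^sub>F n in sequentially. u n / sqrt (real n) \<le> sqrt (2 * ln 2 + A / real n)"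
      using bounds eventually_gt_at_top[of 0]
    proof eventually_elim
      case (elim n)
      have "(u n)\<^sup>2 / real n \<le> (2 * real n * ln 2 + A) / real n"
        using elim by (intro divide_right_mono) auto
      then have "(u n / sqrt (real n))\<^sup>2 \<le> 2 * ln 2 + A / real n"
        using elim by (simp add: power_divide add_divide_distrib)
      then show ?case by (rule real_le_rsqrt)
    qed
    have "(\<lambda>n. sqrt (2 * ln 2 - B / real n) - 1 / sqrt (real n)) \<longlonglongrightarrow> sqrt (2 * ln 2 - 0) - 0"
    proof (intro tendsto_diff tendsto_real_sqrt tendsto_const)
      show "(\<lambda>n. B / real n) \<longlonglongrightarrow> 0" by real_asymp
      show "(\<lambda>n. 1 / sqrt (real n)) \<longlonglongrightarrow> 0" by real_asymp
    qed
    then show "(\<lambda>n. sqrt (2 * ln 2 - B / real n) - 1 / sqrt (real n)) \<longlonglongrightarrow> sqrt (2 * ln 2)" by simp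
    have "(\<lambda>n. sqrt (2 * ln 2 + A / real n)) \<longlonglongrightarrow> sqrt (2 * ln 2 + 0)"
    proof (intro tendsto_add tendsto_real_sqrt tendsto_const)
      show "(\<lambda>n. A / real n) \<longlonglongrightarrow> 0" by real_asymp
    qed
    then show "(\<lambda>n. sqrt (2 * ln 2 + A / real n)) \<longlonglongrightarrow> sqrt (2 * ln 2)" by simp
  qed
  then have "(\<lambda>n. u n / sqrt (real n) / \<beta>) \<longlonglongrightarrow> \<alpha>"
    unfolding alpha_def using beta_pos by (intro tendsto_intros) auto
  moreover have "u n / sqrt (real n) / \<beta> = ln (c n) / (real n * \<beta>\<^sup>2)" for n
    by (simp add: u_def power2_eq_square)
  ultimately show ?thesis by simp
qed

text \<open>Minus the slope at 0 of the logarithm of the Gaussian density of the log-depth.\<close>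

definition tilt :: "nat \<Rightarrow> real" where "tilt n = ln (c n) / (real n * \<beta>\<^sup>2)"

text \<open>The Gaussian density at 0. Its asymptotics are not computed from \<open>c\<close>, but
  recovered from the definition of the time-scale in \<open>norming_limit\<close>.\<close>

definition norming :: "nat \<Rightarrow> real" where
  "norming n = 1 / sqrt (2 * pi * (\<beta> * sqrt (real n))\<^sup>2) * exp (- (ln (c n))\<^sup>2 / (2 * (\<beta> * sqrt (real n))\<^sup>2))"

lemma density_tilt:
  assumes "n \<ge> 1"
  shows "normal_density (- ln (c n)) (\<beta> * sqrt (real n)) y =
    norming n * (exp (- tilt n * y) * exp (- y\<^sup>2 / (2 * (\<beta> * sqrt (real n))\<^sup>2)))"
proof -
  let ?s = "2 * (\<beta> * sqrt (real n))\<^sup>2"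
  have s: "?s = 2 * (real n * \<beta>\<^sup>2)" "?s \<noteq> 0" using assms beta_pos by (auto simp: power_mult_distrib)
  have "tilt n * y = 2 * ln (c n) * y / ?s"
    unfolding s(1) tilt_def by simp
  then have "- (y + ln (c n))\<^sup>2 / ?s = - (ln (c n))\<^sup>2 / ?s + (- tilt n * y + - y\<^sup>2 / ?s)"
    by (simp add: power2_sum add_divide_distrib diff_divide_distrib algebra_simps)
  then have "exp (- (y + ln (c n))\<^sup>2 / ?s) = exp (- (ln (c n))\<^sup>2 / ?s) * (exp (- tilt n * y) * exp (- y\<^sup>2 / ?s))"
    by (simp only: exp_add)
  then show ?thesis by (simp add: normal_density_def norming_def)
qed

text \<open>The quadratic factor is at most 1 and tends to 1, so only the exponential tilt survives.
  Near the origin and at infinity the assumed bound on \<open>F\<close> makes the tilted integrals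
  converge.\<close>

lemma tilted_limit:
  assumes F: "F \<in> borel_measurable borel" and b: "\<And>x. x > 0 \<Longrightarrow> \<bar>F x\<bar> \<le> C * min 1 x"
  shows "(\<lambda>n. LINT y|lborel. F (exp y) * (exp (- tilt n * y) * exp (- y\<^sup>2 / (2 * (\<beta> * sqrt (real n))\<^sup>2)))) \<longlonglongrightarrow>
    (LINT y|lborel. F (exp y) * exp (- \<alpha> * y))"
proof -
  \<comment> \<open>Two exponents in (0, 1) on either side of \<open>\<alpha>\<close>; the sum of
    their exponentials dominates the tilted one for both signs of \<open>y\<close>.\<close>
  define a b where "a = \<alpha> / 2" and "b = (1 + \<alpha>) / 2"
  have ab: "0 < a" "a < 1" "0 < b" "b < 1" "a < \<alpha>" "\<alpha> < b"
    using alpha_bounds by (auto simp: a_def b_def)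
  have tilt: "tilt \<longlonglongrightarrow> \<alpha>" using log_scale_limit by (simp add: tilt_def[abs_def])
  have "\<forall>\<^sub>F n in sequentially. a < tilt n \<and> tilt n < b"
    using order_tendstoD[OF tilt] ab by (intro eventually_conj) auto
  then obtain n0 where n0: "\<And>n. n \<ge> n0 \<Longrightarrow> a < tilt n \<and> tilt n < b"
    unfolding eventually_sequentially by auto
  let ?f = "\<lambda>n y. F (exp y) * (exp (- tilt n * y) * exp (- y\<^sup>2 / (2 * (\<beta> * sqrt (real n))\<^sup>2)))"
  let ?w = "\<lambda>y. \<bar>C\<bar> * (min 1 (exp y) * exp (- a * y) + min 1 (exp y) * exp (- b * y))"
  \<comment> \<open>Domination holds from \<open>n0\<close> on, hence the shifted sequence.\<close>
  have "(\<lambda>n. LINT y|lborel. ?f (n + n0) y) \<longlonglongrightarrow> (LINT y|lborel. F (exp y) * exp (- \<alpha> * y))"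
  proof (rule integral_dominated_convergence[where w = ?w])
    show "(\<lambda>y. F (exp y) * exp (- \<alpha> * y)) \<in> borel_measurable lborel" using F by measurable
    show "?f (n + n0) \<in> borel_measurable lborel" for n using F by measurable
    show "integrable lborel ?w"
      using ab by (intro integrable_mult_right Bochner_Integration.integrable_add tilted_exp_integrable)
    show "AE y in lborel. (\<lambda>n. ?f (n + n0) y) \<longlonglongrightarrow> F (exp y) * exp (- \<alpha> * y)"
    proof (intro AE_I2)
      fix y :: real
      have "(\<lambda>n. y\<^sup>2 / (2 * (\<beta> * sqrt (real n))\<^sup>2)) \<longlonglongrightarrow> 0"
      proof -
        have "y\<^sup>2 / (2 * (\<beta> * sqrt (real n))\<^sup>2) = y\<^sup>2 / (2 * \<beta>\<^sup>2) / real n" for n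
          by (simp add: power_mult_distrib)
        moreover have "(\<lambda>n. y\<^sup>2 / (2 * \<beta>\<^sup>2) / real n) \<longlonglongrightarrow> 0" by real_asymp
        ultimately show ?thesis by presburger
      qed
      then have "(\<lambda>n. exp (- (y\<^sup>2 / (2 * (\<beta> * sqrt (real n))\<^sup>2)))) \<longlonglongrightarrow> exp (- 0)"
        by (intro tendsto_intros)
      then have "(\<lambda>n. exp (- y\<^sup>2 / (2 * (\<beta> * sqrt (real n))\<^sup>2))) \<longlonglongrightarrow> 1" by simp
      moreover have "(\<lambda>n. exp (- tilt n * y)) \<longlonglongrightarrow> exp (- \<alpha> * y)"
        by (intro tendsto_intros tilt)
      ultimately have "(\<lambda>n. ?f n y) \<longlonglongrightarrow> F (exp y) * (exp (- \<alpha> * y) * 1)"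
        by (intro tendsto_mult tendsto_const)
      from LIMSEQ_ignore_initial_segment[OF this, of n0]
      show "(\<lambda>n. ?f (n + n0) y) \<longlonglongrightarrow> F (exp y) * exp (- \<alpha> * y)" by simp
    qed
    show "AE y in lborel. norm (?f (n + n0) y) \<le> ?w y" for n
    proof (intro AE_I2)
      fix y :: real
      have t: "a < tilt (n + n0)" "tilt (n + n0) < b" using n0[of "n + n0"] by auto
      have "exp (- tilt (n + n0) * y) \<le> exp (- a * y) + exp (- b * y)"
      proof (cases "y \<ge> 0")
        case True
        then have "a * y \<le> tilt (n + n0) * y" using t by (intro mult_right_mono) auto
        then have "exp (- tilt (n + n0) * y) \<le> exp (- a * y)" by simp
        then show ?thesis by (simp add: add_increasing2)
      next
        case False
        then have "b * y \<le> tilt (n + n0) * y" using t by (intro mult_right_mono_neg) auto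
        then have "exp (- tilt (n + n0) * y) \<le> exp (- b * y)" by simp
        then show ?thesis by (simp add: add_increasing)
      qed
      moreover have "exp (- y\<^sup>2 / (2 * (\<beta> * sqrt (real (n + n0)))\<^sup>2)) \<le> 1" by simp
      ultimately have 1: "exp (- tilt (n + n0) * y) * exp (- y\<^sup>2 / (2 * (\<beta> * sqrt (real (n + n0)))\<^sup>2)) \<le> (exp (- a * y) + exp (- b * y)) * 1"
        by (intro mult_mono) auto
      have 2: "\<bar>F (exp y)\<bar> \<le> \<bar>C\<bar> * min 1 (exp y)"
      proof -
        have "C * min 1 (exp y) \<le> \<bar>C\<bar> * min 1 (exp y)" by (intro mult_right_mono) auto
        moreover have "\<bar>F (exp y)\<bar> \<le> C * min 1 (exp y)" by (rule b) simp
        ultimately show ?thesis by linarith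
      qed
      have "\<bar>F (exp y)\<bar> * (exp (- tilt (n + n0) * y) * exp (- y\<^sup>2 / (2 * (\<beta> * sqrt (real (n + n0)))\<^sup>2))) \<le>
          (\<bar>C\<bar> * min 1 (exp y)) * ((exp (- a * y) + exp (- b * y)) * 1)"
        by (rule mult_mono[OF 2 1]) auto
      then show "norm (?f (n + n0) y) \<le> ?w y"
        by (simp add: abs_mult algebra_simps)
    qed
  qed
  then show ?thesis by (rule LIMSEQ_offset)
qed

text \<open>For the indicator of [1, \<infinity>) the tilted integral tends to 1/\<alpha>, while its
  product with \<open>norming\<close> is the tail, which is asymptotic to 1/\<epsilon> divided by
  2^n.\<close>

lemma norming_limit: "(\<lambda>n. 2 ^ n * norming n) \<longlonglongrightarrow> \<alpha> / \<epsilon>"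
proof -
  let ?J = "\<lambda>n. LINT y|lborel. indicat_real {1..} (exp y) * (exp (- tilt n * y) * exp (- y\<^sup>2 / (2 * (\<beta> * sqrt (real n))\<^sup>2)))"
  have "?J \<longlonglongrightarrow> (LINT y|lborel. indicat_real {1..} (exp y) * exp (- \<alpha> * y))"
    by (rule tilted_limit[where C = 1]) (auto simp: indicator_def)
  also have "(LINT y|lborel. indicat_real {1..} (exp y) * exp (- \<alpha> * y)) = 1 / \<alpha>"
  proof -
    have "indicat_real {1..} (exp y) = indicat_real {0..} y" for y :: real by (auto simp: indicator_def)
    then show ?thesis using laplace_one(2)[OF alpha_bounds(1)] by (simp add: set_lebesgue_integral_def)
  qed
  finally have J: "?J \<longlonglongrightarrow> 1 / \<alpha>" .
  have "(\<lambda>n. 2 ^ n * tail n / ?J n) \<longlonglongrightarrow> 1 / \<epsilon> / (1 / \<alpha>)"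
    using alpha_bounds by (intro tendsto_intros tail_limit J) auto
  moreover have "\<forall>\<^sub>F n in sequentially. 2 ^ n * tail n / ?J n = 2 ^ n * norming n"
  proof -
    have "0 < 1 / \<alpha>" using alpha_bounds by simp
    from order_tendstoD(1)[OF J this] eventually_ge_at_top[of 1]
    show ?thesis
  proof eventually_elim
    case (elim n) note 1 = this
    have "indicat_real {1..} (exp y) = indicat_real {0..} y" for y :: real by (auto simp: indicator_def)
    then have "tail n = (LINT y|lborel. norming n * (indicat_real {1..} (exp y) * (exp (- tilt n * y) * exp (- y\<^sup>2 / (2 * (\<beta> * sqrt (real n))\<^sup>2)))))"
      unfolding tail_def density_tilt[OF 1(2)] by (simp add: mult_ac)
    then have "tail n = norming n * ?J n" by simp
    then show ?case using 1(1) by simp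
  qed
  qed
  ultimately have "(\<lambda>n. 2 ^ n * norming n) \<longlonglongrightarrow> 1 / \<epsilon> / (1 / \<alpha>)"
    by (rule Lim_transform_eventually)
  then show ?thesis by simp
qed

text \<open>By independence the expectation is the power 2^n of 1 - \<open>e n\<close>, and 2^n
  times \<open>e n\<close> tends to the exponent. The expression \<open>1 - (1 - e n)\<close> below
  only matches the form of \<open>power_tendsto_exp\<close>.\<close>

lemma environment_laplace:
  assumes g: "g \<in> borel_measurable borel" and C: "C \<ge> 0" and b: "\<And>x. x > 0 \<Longrightarrow> 0 \<le> g x \<and> g x \<le> C * x"
  shows "(\<lambda>n. LINT \<omega>|M. exp (- (\<Sum>x\<in>cube n. g (trap_depth H \<beta> n \<omega> x / c n)))) \<longlonglongrightarrow> exp (- levy_exponent \<alpha> \<epsilon> g)"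
proof -
  let ?F = "\<lambda>x. 1 - exp (- g x)"
  define e where "e = (\<lambda>n. LINT y|lborel. ?F (exp y) * normal_density (- ln (c n)) (\<beta> * sqrt (real n)) y)"
  have Fb: "\<bar>?F x\<bar> \<le> (1 + C) * min 1 x" if "x > 0" for x
    using one_minus_exp_le[of "g x" C x] b[OF that] that C by simp
  have F: "?F \<in> borel_measurable borel" using g by measurable
  have "(\<lambda>n. (2 ^ n * norming n) * (LINT y|lborel. ?F (exp y) * (exp (- tilt n * y) * exp (- y\<^sup>2 / (2 * (\<beta> * sqrt (real n))\<^sup>2))))) \<longlonglongrightarrow>
      \<alpha> / \<epsilon> * (LINT y|lborel. ?F (exp y) * exp (- \<alpha> * y))"
    by (intro tendsto_mult norming_limit tilted_limit[OF F Fb])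
  also have "\<alpha> / \<epsilon> * (LINT y|lborel. ?F (exp y) * exp (- \<alpha> * y)) = levy_exponent \<alpha> \<epsilon> g"
  proof -
    have "\<alpha> / \<epsilon> * (LINT y|lborel. ?F (exp y) * exp (- \<alpha> * y)) = (LINT y|lborel. \<alpha> / \<epsilon> * (?F (exp y) * exp (- \<alpha> * y)))"
      by (rule integral_mult_right_zero[symmetric])
    then show ?thesis by (simp only: levy_exponent_def mult_ac)
  qed
  finally have lim1: "(\<lambda>n. (2 ^ n * norming n) * (LINT y|lborel. ?F (exp y) * (exp (- tilt n * y) * exp (- y\<^sup>2 / (2 * (\<beta> * sqrt (real n))\<^sup>2))))) \<longlonglongrightarrow> levy_exponent \<alpha> \<epsilon> g" .
  have "\<forall>\<^sub>F n in sequentially. (2 ^ n * norming n) * (LINT y|lborel. ?F (exp y) * (exp (- tilt n * y) * exp (- y\<^sup>2 / (2 * (\<beta> * sqrt (real n))\<^sup>2)))) = real (2 ^ n) * (1 - (1 - e n))"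
    using eventually_ge_at_top[of 1]
  proof eventually_elim
    case (elim n)
    have "e n = (LINT y|lborel. norming n * (?F (exp y) * (exp (- tilt n * y) * exp (- y\<^sup>2 / (2 * (\<beta> * sqrt (real n))\<^sup>2)))))"
      unfolding e_def density_tilt[OF elim] by (simp only: mult.left_commute)
    also have "\<dots> = norming n * (LINT y|lborel. ?F (exp y) * (exp (- tilt n * y) * exp (- y\<^sup>2 / (2 * (\<beta> * sqrt (real n))\<^sup>2))))"
      by (rule integral_mult_right_zero)
    finally show ?case by simp
  qed
  with lim1 have lim: "(\<lambda>n. real (2 ^ n) * (1 - (1 - e n))) \<longlonglongrightarrow> levy_exponent \<alpha> \<epsilon> g"
    by (rule Lim_transform_eventually)
  have expect: "(LINT \<omega>|M. exp (- g (trap_depth H \<beta> n \<omega> x / c n))) = 1 - e n"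
    if "n \<ge> 1" "c n > 0" "x \<in> cube n" for n x
  proof -
    have [measurable]: "H n x \<in> borel_measurable M" by (rule rem_measurable[OF env that(1,3)])
    have meas: "(\<lambda>\<omega>. exp (- g (trap_depth H \<beta> n \<omega> x / c n))) \<in> borel_measurable M"
      unfolding trap_depth_def using g by measurable
    have pos: "0 \<le> g (trap_depth H \<beta> n \<omega> x / c n)" for \<omega>
      using b that(2) by (simp add: trap_depth_def)
    have "e n = (LINT \<omega>|M. ?F (trap_depth H \<beta> n \<omega> x / c n))"
      unfolding e_def using trap_depth_integral[OF env that(1,3) beta_pos that(2) F] by simp
    also have "\<dots> = 1 - (LINT \<omega>|M. exp (- g (trap_depth H \<beta> n \<omega> x / c n)))"
      using meas pos by (subst Bochner_Integration.integral_diff) (auto simp: prob_space intro!: integrable_const_bound[of _ 1])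
    finally show ?thesis by simp
  qed
  have e01: "0 \<le> 1 - e n \<and> 1 - e n \<le> 1" if n: "n \<ge> 1" "c n > 0" for n
  proof -
    obtain x where x: "x \<in> cube n" using cube_nonempty by blast
    have [measurable]: "H n x \<in> borel_measurable M" by (rule rem_measurable[OF env n(1) x])
    have meas: "(\<lambda>\<omega>. exp (- g (trap_depth H \<beta> n \<omega> x / c n))) \<in> borel_measurable M"
      unfolding trap_depth_def using g by measurable
    have pos: "0 \<le> g (trap_depth H \<beta> n \<omega> x / c n)" for \<omega>
      using b n(2) by (simp add: trap_depth_def)
    have "(LINT \<omega>|M. exp (- g (trap_depth H \<beta> n \<omega> x / c n))) \<le> (LINT \<omega>|M. 1)"
      using meas pos by (intro integral_mono integrable_const_bound[of _ 1]) auto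
    moreover have "0 \<le> (LINT \<omega>|M. exp (- g (trap_depth H \<beta> n \<omega> x / c n)))"
      by (intro Bochner_Integration.integral_nonneg) simp
    ultimately show ?thesis unfolding expect[OF n x] by (simp add: prob_space)
  qed
  have "filterlim (\<lambda>n. 2 ^ n :: nat) at_top sequentially" by real_asymp
  moreover have "\<forall>\<^sub>F n in sequentially. 0 \<le> 1 - e n \<and> 1 - e n \<le> 1"
    using c_gt_1 by eventually_elim (rule e01, auto)
  moreover have "0 \<le> levy_exponent \<alpha> \<epsilon> g"
    unfolding levy_exponent_def using b alpha_bounds eps_pos
    by (intro Bochner_Integration.integral_nonneg mult_nonneg_nonneg) auto
  ultimately have "(\<lambda>n. (1 - e n) ^ 2 ^ n) \<longlonglongrightarrow> exp (- levy_exponent \<alpha> \<epsilon> g)"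
    using lim by (intro power_tendsto_exp)
  moreover have "\<forall>\<^sub>F n in sequentially. (1 - e n) ^ 2 ^ n = (LINT \<omega>|M. exp (- (\<Sum>x\<in>cube n. g (trap_depth H \<beta> n \<omega> x / c n))))"
    using c_gt_1
  proof eventually_elim
    case (elim n)
    then have n: "n \<ge> 1" "c n > 0" by auto
    let ?X = "\<lambda>x \<omega>. exp (- g (trap_depth H \<beta> n \<omega> x / c n))"
    have "indep_vars (\<lambda>_. borel) (H n) (cube n)"
      using env n by (simp add: rem_environment_def)
    then have "indep_vars (\<lambda>_. borel) (\<lambda>x \<omega>. exp (- g (exp (- \<beta> * H n x \<omega>) / c n))) (cube n)"
      by (rule indep_vars_compose2) (use g in measurable)
    then have ind: "indep_vars (\<lambda>_. borel) ?X (cube n)" by (simp add: trap_depth_def)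
    have int: "integrable M (?X x)" if x: "x \<in> cube n" for x
    proof -
      have [measurable]: "H n x \<in> borel_measurable M" by (rule rem_measurable[OF env n(1) x])
      have "?X x \<in> borel_measurable M" unfolding trap_depth_def using g by measurable
      moreover have "0 \<le> g (trap_depth H \<beta> n \<omega> x / c n)" for \<omega>
        using b n(2) by (simp add: trap_depth_def)
      ultimately show ?thesis by (intro integrable_const_bound[of _ 1]) auto
    qed
    have "(LINT \<omega>|M. exp (- (\<Sum>x\<in>cube n. g (trap_depth H \<beta> n \<omega> x / c n)))) = (LINT \<omega>|M. (\<Prod>x\<in>cube n. ?X x \<omega>))"
      by (simp add: exp_sum sum_negf[symmetric])
    also have "\<dots> = (\<Prod>x\<in>cube n. LINT \<omega>|M. ?X x \<omega>)"
      using ind int by (intro indep_vars_lebesgue_integral) auto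
    also have "\<dots> = (1 - e n) ^ 2 ^ n"
      using expect[OF n] by (simp add: card_cube)
    finally show ?case by simp
  qed
  ultimately show ?thesis by (rule Lim_transform_eventually)
qed

end

text \<open>A monomial is a list of coordinates with repetitions, so multiplication is concatenation
  and moments are indexed by lists.\<close>

inductive coord_poly :: "((nat \<Rightarrow> real) \<Rightarrow> real) \<Rightarrow> bool" where
  mono: "coord_poly (\<lambda>u. a * prod_list (map u l))"
| add: "coord_poly f \<Longrightarrow> coord_poly g \<Longrightarrow> coord_poly (\<lambda>u. f u + g u)"

lemma coord_poly_mult: "coord_poly f \<Longrightarrow> coord_poly g \<Longrightarrow> coord_poly (\<lambda>u. f u * g u)"
proof (induction rule: coord_poly.induct)
  case (mono a l)
  from mono.prems show ?case
  proof (induction rule: coord_poly.induct)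
    case (mono b m)
    have "(\<lambda>u. a * prod_list (map u l) * (b * prod_list (map u m))) = (\<lambda>u. (a * b) * prod_list (map u (l @ m)))"
      by (simp add: fun_eq_iff mult_ac)
    then show ?case by (simp only: coord_poly.mono)
  next
    case (add f g)
    then show ?case by (simp only: distrib_left coord_poly.add)
  qed
next
  case (add f f')
  then show ?case by (simp only: distrib_right coord_poly.add)
qed

lemma coord_poly_continuous: "coord_poly f \<Longrightarrow> continuous_on S f"
proof (induction rule: coord_poly.induct)
  case (mono a l)
  have "continuous_on S (\<lambda>u :: nat \<Rightarrow> real. prod_list (map u l))"
    by (induction l)
      (auto intro!: continuous_on_mult continuous_on_product_then_coordinatewise[OF continuous_on_id])
  then show ?case by (intro continuous_intros)
qed (intro continuous_intros)

text \<open>Infinitely many coordinates serve any finite number of sums at once; Tychonoff still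
  gives compactness.\<close>

definition unit_box :: "(nat \<Rightarrow> real) set" where "unit_box = {u. \<forall>i. 0 \<le> u i \<and> u i \<le> 1}"

lemma compact_unit_box: "compact unit_box"
proof -
  have "unit_box = PiE UNIV (\<lambda>_. {0..1})" by (auto simp: unit_box_def)
  moreover have "compactin (product_topology (\<lambda>_. euclidean) UNIV) (PiE UNIV (\<lambda>_ :: nat. {0..1 :: real}))"
    by (simp add: compactin_PiE)
  ultimately show ?thesis by (simp add: euclidean_product_topology)
qed

interpretation box: function_ring_on "Collect coord_poly" unit_box
proof
  show "compact unit_box" by (rule compact_unit_box)
  show "(\<lambda>_. a) \<in> Collect coord_poly" for a using coord_poly.mono[of a "[]"] by simp
  show "\<exists>f\<in>Collect coord_poly. f x \<noteq> f y" if "x \<noteq> y" for x y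
  proof -
    from that have "\<exists>i. x i \<noteq> y i" by (auto simp: fun_eq_iff)
    then obtain i where "x i \<noteq> y i" ..
    then show ?thesis using coord_poly.mono[of 1 "[i]"] by (intro bexI[of _ "\<lambda>u. u i"]) auto
  qed
qed (auto simp: coord_poly_continuous coord_poly_mult intro: coord_poly.add)

text \<open>Continuity is given on the box only, so \<open>h\<close> is extended by 0 off this
  closed set.\<close>

lemma unit_box_measurable:
  assumes "\<And>i. (\<lambda>\<omega>. U \<omega> i) \<in> borel_measurable M" "\<And>\<omega>. \<omega> \<in> space M \<Longrightarrow> U \<omega> \<in> unit_box"
    and h: "continuous_on unit_box h"
  shows "(\<lambda>\<omega>. h (U \<omega>) :: real) \<in> borel_measurable M"
proof -
  have "U \<in> borel_measurable M" by (rule measurable_coordinatewise_then_product) (rule assms(1))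
  moreover have "(\<lambda>u. indicat_real unit_box u *\<^sub>R h u) \<in> borel_measurable borel"
    by (intro borel_measurable_continuous_on_indicator h borel_closed compact_imp_closed compact_unit_box)
  ultimately have "(\<lambda>\<omega>. indicat_real unit_box (U \<omega>) *\<^sub>R h (U \<omega>)) \<in> borel_measurable M"
    by (rule measurable_compose)
  then show ?thesis
    by (rule measurable_cong[THEN iffD1, rotated]) (simp add: assms(2))
qed

lemma (in prob_space) unit_box_integrable:
  assumes "\<And>i. (\<lambda>\<omega>. U \<omega> i) \<in> borel_measurable M" "\<And>\<omega>. \<omega> \<in> space M \<Longrightarrow> U \<omega> \<in> unit_box"
    and h: "continuous_on unit_box h"
  shows "integrable M (\<lambda>\<omega>. h (U \<omega>) :: real)"
proof -
  have "bounded (h ` unit_box)"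
    by (intro compact_imp_bounded compact_continuous_image h compact_unit_box)
  then obtain B where "\<And>u. u \<in> unit_box \<Longrightarrow> \<bar>h u\<bar> \<le> B" by (auto simp: bounded_iff)
  then show ?thesis
    using assms(2) by (intro integrable_const_bound[of _ B] unit_box_measurable[OF assms]) auto
qed

lemma (in prob_space) integral_abs_diff_le:
  assumes "integrable M f" "integrable M g" "\<And>\<omega>. \<omega> \<in> space M \<Longrightarrow> \<bar>f \<omega> - g \<omega>\<bar> \<le> h \<omega>" "integrable M h"
  shows "\<bar>(LINT \<omega>|M. f \<omega>) - (LINT \<omega>|M. g \<omega>)\<bar> \<le> (LINT \<omega>|M. h \<omega> :: real)"
proof -
  have "\<bar>(LINT \<omega>|M. f \<omega>) - (LINT \<omega>|M. g \<omega>)\<bar> = \<bar>LINT \<omega>|M. f \<omega> - g \<omega>\<bar>"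
    using assms by simp
  also have "\<dots> \<le> (LINT \<omega>|M. \<bar>f \<omega> - g \<omega>\<bar>)" by (rule integral_abs_bound)
  also have "\<dots> \<le> (LINT \<omega>|M. h \<omega>)" using assms by (intro integral_mono) auto
  finally show ?thesis .
qed

text \<open>Polynomials are handled by linearity and the rest by uniform approximation.
  Measurability and range are asked for eventually, because the time-scale need not be positive for
  small \<open>n\<close>.\<close>

lemma unit_box_moments_imp_limit:
  fixes M :: "'w measure" and Q :: "'g measure" and U :: "nat \<Rightarrow> 'w \<Rightarrow> nat \<Rightarrow> real"
  assumes M: "prob_space M" and Q: "prob_space Q"
    and U: "\<forall>\<^sub>F n in sequentially. (\<forall>i. (\<lambda>\<omega>. U n \<omega> i) \<in> borel_measurable M) \<and> (\<forall>\<omega>\<in>space M. U n \<omega> \<in> unit_box)"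
    and V: "\<And>i. (\<lambda>\<omega>. V \<omega> i) \<in> borel_measurable Q" "\<And>\<omega>. \<omega> \<in> space Q \<Longrightarrow> V \<omega> \<in> unit_box"
    and moments: "\<And>l. (\<lambda>n. LINT \<omega>|M. prod_list (map (U n \<omega>) l)) \<longlonglongrightarrow> (LINT \<omega>|Q. prod_list (map (V \<omega>) l))"
    and h: "continuous_on unit_box (h :: _ \<Rightarrow> real)"
  shows "(\<lambda>n. LINT \<omega>|M. h (U n \<omega>)) \<longlonglongrightarrow> (LINT \<omega>|Q. h (V \<omega>))"
proof (rule tendstoI)
  interpret M: prob_space M by fact
  interpret Q: prob_space Q by fact
  fix e :: real assume e: "e > 0"
  have iQ: "integrable Q (\<lambda>\<omega>. k (V \<omega>) :: real)" if "continuous_on unit_box k" for k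
    by (rule Q.unit_box_integrable[where U = V and h = k, OF V that])
  have iM: "integrable M (\<lambda>\<omega>. k (U n \<omega>) :: real)"
    if "continuous_on unit_box k" "(\<forall>i. (\<lambda>\<omega>. U n \<omega> i) \<in> borel_measurable M) \<and> (\<forall>\<omega>\<in>space M. U n \<omega> \<in> unit_box)" for k n
    using that by (intro M.unit_box_integrable[where U = "U n" and h = k]) auto
  have poly: "(\<lambda>n. LINT \<omega>|M. f (U n \<omega>)) \<longlonglongrightarrow> (LINT \<omega>|Q. f (V \<omega>))" if "coord_poly f" for f
    using that
  proof (induction rule: coord_poly.induct)
    case (mono a l)
    show ?case using tendsto_mult[OF tendsto_const[of a] moments[of l]] by simp
  next
    case (add f g)
    have lim: "(\<lambda>n. (LINT \<omega>|M. f (U n \<omega>)) + (LINT \<omega>|M. g (U n \<omega>))) \<longlonglongrightarrow> (LINT \<omega>|Q. f (V \<omega>)) + (LINT \<omega>|Q. g (V \<omega>))"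
      by (intro tendsto_add add.IH)
    have ev: "\<forall>\<^sub>F n in sequentially. (LINT \<omega>|M. f (U n \<omega>)) + (LINT \<omega>|M. g (U n \<omega>)) = (LINT \<omega>|M. f (U n \<omega>) + g (U n \<omega>))"
      using U
    proof eventually_elim
      case (elim n)
      from iM[OF coord_poly_continuous[OF add.hyps(1)] this] iM[OF coord_poly_continuous[OF add.hyps(2)] this]
      show ?case by (rule Bochner_Integration.integral_add[symmetric])
    qed
    have eq: "(LINT \<omega>|Q. f (V \<omega>) + g (V \<omega>)) = (LINT \<omega>|Q. f (V \<omega>)) + (LINT \<omega>|Q. g (V \<omega>))"
      using iQ[OF coord_poly_continuous[OF add.hyps(1)]] iQ[OF coord_poly_continuous[OF add.hyps(2)]]
      by (rule Bochner_Integration.integral_add)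
    show ?case unfolding eq by (rule Lim_transform_eventually[OF lim ev])
  qed
  obtain f where f: "coord_poly f" and hf: "\<And>u. u \<in> unit_box \<Longrightarrow> \<bar>h u - f u\<bar> < e / 3"
    using box.Stone_Weierstrass_basic[OF h, of "e / 3"] e by auto
  have cf: "continuous_on unit_box f" by (rule coord_poly_continuous[OF f])
  have "\<forall>\<^sub>F n in sequentially. dist (LINT \<omega>|M. f (U n \<omega>)) (LINT \<omega>|Q. f (V \<omega>)) < e / 3"
    using poly[OF f] e by (intro tendstoD) auto
  then show "\<forall>\<^sub>F n in sequentially. dist (LINT \<omega>|M. h (U n \<omega>)) (LINT \<omega>|Q. h (V \<omega>)) < e"
    using U
  proof eventually_elim
    case (elim n)
    have "\<bar>(LINT \<omega>|M. h (U n \<omega>)) - (LINT \<omega>|M. f (U n \<omega>))\<bar> \<le> (LINT \<omega>|M. e / 3)"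
    proof (rule M.integral_abs_diff_le[OF iM[OF h elim(2)] iM[OF cf elim(2)]])
      show "\<bar>h (U n \<omega>) - f (U n \<omega>)\<bar> \<le> e / 3" if "\<omega> \<in> space M" for \<omega>
        using hf[of "U n \<omega>"] elim(2) that by auto
    qed simp
    moreover have "\<bar>(LINT \<omega>|Q. h (V \<omega>)) - (LINT \<omega>|Q. f (V \<omega>))\<bar> \<le> (LINT \<omega>|Q. e / 3)"
    proof (rule Q.integral_abs_diff_le[OF iQ[OF h] iQ[OF cf]])
      show "\<bar>h (V \<omega>) - f (V \<omega>)\<bar> \<le> e / 3" if "\<omega> \<in> space Q" for \<omega>
        using hf[of "V \<omega>"] V(2) that by auto
    qed simp
    ultimately show ?case
    proof -
      have tri: "\<bar>a - b\<bar> < e" if "\<bar>a - a'\<bar> \<le> e / 3" "\<bar>b - b'\<bar> \<le> e / 3" "\<bar>a' - b'\<bar> < e / 3" for a b a' b' :: real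
        using that by linarith
      show ?thesis
        using elim(1) \<open>\<bar>(LINT \<omega>|M. h (U n \<omega>)) - (LINT \<omega>|M. f (U n \<omega>))\<bar> \<le> (LINT \<omega>|M. e / 3)\<close>
          \<open>\<bar>(LINT \<omega>|Q. h (V \<omega>)) - (LINT \<omega>|Q. f (V \<omega>))\<bar> \<le> (LINT \<omega>|Q. e / 3)\<close>
        unfolding dist_real_def by (intro tri) (simp_all add: M.prob_space Q.prob_space)
    qed
  qed
qed

text \<open>Sums are encoded as u = exp (-w). The clipping keeps \<open>- ln u\<close> away from 0
  and infinity, where a function of positive vectors need not extend continuously.\<close>

definition clip :: "real \<Rightarrow> real \<Rightarrow> real" where "clip b u = max b (min (1 - b) u)"

text \<open>A continuous majorant of the event that the clipping acts: it is 1 within distance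
  \<open>b\<close> of an endpoint and 0 beyond 2b. Continuity lets its expectation pass to the
  limit.\<close>

definition edge_weight :: "real \<Rightarrow> real \<Rightarrow> real" where
  "edge_weight b u = min 1 (max 0 (2 - min u (1 - u) / b))"

lemma edge_weight_bounds: "0 \<le> edge_weight b u" "edge_weight b u \<le> 1"
  by (auto simp: edge_weight_def)

lemma edge_weight_one: "b > 0 \<Longrightarrow> \<not> (b \<le> u \<and> u \<le> 1 - b) \<Longrightarrow> edge_weight b u = 1"
proof -
  assume b: "b > 0" "\<not> (b \<le> u \<and> u \<le> 1 - b)"
  then have "min u (1 - u) \<le> b" by auto
  then have "min u (1 - u) / b \<le> 1" using b by simp
  then show ?thesis by (simp add: edge_weight_def)
qed

lemma edge_weight_tendsto:
  assumes u: "0 < u" "u < 1"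
  shows "(\<lambda>k. edge_weight (1 / (real k + 3)) u) \<longlonglongrightarrow> 0"
proof (rule tendsto_eventually)
  have "\<forall>\<^sub>F k in sequentially. 2 / min u (1 - u) \<le> real k"
    using filterlim_real_sequentially by (simp add: filterlim_at_top)
  then show "\<forall>\<^sub>F k in sequentially. edge_weight (1 / (real k + 3)) u = 0"
  proof eventually_elim
    case (elim k)
    have m: "0 < min u (1 - u)" using u by simp
    have "2 \<le> real k * min u (1 - u)" using elim m by (simp add: pos_divide_le_eq)
    also have "\<dots> \<le> min u (1 - u) / (1 / (real k + 3))" using m by (simp add: algebra_simps)
    finally show ?case by (simp add: edge_weight_def)
  qed
qed

section \<open>Joint convergence of sums over the depths\<close>

locale rem_limit = extreme_rem M H \<beta> \<alpha> \<epsilon> c + stable_points Q \<mu> \<gamma> \<alpha> \<epsilon>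
  for M :: "'w measure" and H :: "nat \<Rightarrow> (nat \<Rightarrow> real) \<Rightarrow> 'w \<Rightarrow> real" and \<beta> \<alpha> \<epsilon> :: real and c :: "nat \<Rightarrow> real"
    and Q :: "'g measure" and \<mu> :: "real measure" and \<gamma> :: "nat \<Rightarrow> 'g \<Rightarrow> real"
begin

definition env_sum :: "(real \<Rightarrow> real) \<Rightarrow> nat \<Rightarrow> 'w \<Rightarrow> real" where
  "env_sum g n \<omega> = (\<Sum>x\<in>cube n. g (trap_depth H \<beta> n \<omega> x / c n))"

text \<open>Almost surely the points are summable; the default value 1 keeps all sums positive.\<close>

definition mark_sum :: "(real \<Rightarrow> real) \<Rightarrow> 'g \<Rightarrow> real" where
  "mark_sum g \<omega> = (if summable (\<lambda>k. \<gamma> k \<omega>) then \<Sum>k. g (\<gamma> k \<omega>) else 1)"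

text \<open>The linear bound gives summability and a finite exponent; strict positivity keeps the
  sums positive, so that quotients are continuous.\<close>

definition admissible :: "(real \<Rightarrow> real) \<Rightarrow> bool" where
  "admissible g \<longleftrightarrow> g \<in> borel_measurable borel \<and> (\<forall>x>0. 0 < g x \<and> g x \<le> x)"

lemma env_sum_measurable: "n \<ge> 1 \<Longrightarrow> g \<in> borel_measurable borel \<Longrightarrow> env_sum g n \<in> borel_measurable M"
proof -
  assume n: "n \<ge> 1" and g: "g \<in> borel_measurable borel"
  have "(\<lambda>\<omega>. g (trap_depth H \<beta> n \<omega> x / c n)) \<in> borel_measurable M" if "x \<in> cube n" for x
  proof -
    have [measurable]: "H n x \<in> borel_measurable M" by (rule rem_measurable[OF env n that])
    show ?thesis unfolding trap_depth_def using g by measurable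
  qed
  then show ?thesis unfolding env_sum_def[abs_def] by (intro borel_measurable_sum) auto
qed

lemma env_sum_pos: "c n > 0 \<Longrightarrow> admissible g \<Longrightarrow> 0 < env_sum g n \<omega>"
  unfolding env_sum_def admissible_def by (intro sum_pos) (auto simp: trap_depth_def)

lemma admissible_summable:
  assumes "admissible g" "\<omega> \<in> space Q" "summable (\<lambda>k. \<gamma> k \<omega>)"
  shows "summable (\<lambda>k. g (\<gamma> k \<omega>))"
proof (rule summable_comparison_test'[OF assms(3)])
  show "norm (g (\<gamma> k \<omega>)) \<le> \<gamma> k \<omega>" for k
    using assms gamma_pos[of \<omega> k] by (auto simp: admissible_def less_imp_le)
qed

lemma mark_sum_pos:
  assumes g: "admissible g" and w: "\<omega> \<in> space Q"
  shows "0 < mark_sum g \<omega>"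
  using g w gamma_pos[OF w] admissible_summable[OF g w]
  by (auto simp: mark_sum_def admissible_def intro!: suminf_pos)

lemma mark_sum_measurable: "g \<in> borel_measurable borel \<Longrightarrow> mark_sum g \<in> borel_measurable Q"
proof -
  assume g [measurable]: "g \<in> borel_measurable borel"
  \<comment> \<open>Summability is rewritten as finiteness of an extended sum, whose measurability
    is evident.\<close>
  have "Measurable.pred Q (\<lambda>\<omega>. (\<Sum>k. ennreal (\<gamma> k \<omega>)) \<noteq> \<top>)" by measurable
  then have [measurable]: "Measurable.pred Q (\<lambda>\<omega>. summable (\<lambda>k. \<gamma> k \<omega>))"
  proof (rule measurable_cong[THEN iffD1, rotated])
    fix \<omega> assume "\<omega> \<in> space Q"
    then have pos: "0 \<le> \<gamma> k \<omega>" for k using gamma_pos[of \<omega> k] by simp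
    show "((\<Sum>k. ennreal (\<gamma> k \<omega>)) \<noteq> \<top>) = summable (\<lambda>k. \<gamma> k \<omega>)"
    proof
      assume "(\<Sum>k. ennreal (\<gamma> k \<omega>)) \<noteq> \<top>"
      then show "summable (\<lambda>k. \<gamma> k \<omega>)" by (rule summable_suminf_not_top[OF pos])
    next
      assume "summable (\<lambda>k. \<gamma> k \<omega>)"
      then show "(\<Sum>k. ennreal (\<gamma> k \<omega>)) \<noteq> \<top>" by (simp only: suminf_ennreal2[OF pos] ennreal_neq_top not_False_eq_True)
    qed
  qed
  show ?thesis unfolding mark_sum_def[abs_def] by measurable
qed

lemma mark_sum_laplace:
  assumes "g \<in> borel_measurable borel" "C \<ge> 0" "\<And>x. x > 0 \<Longrightarrow> 0 \<le> g x \<and> g x \<le> C * x"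
  shows "(LINT \<omega>|Q. exp (- mark_sum g \<omega>)) = exp (- levy_exponent \<alpha> \<epsilon> g)"
proof -
  have "(LINT \<omega>|Q. exp (- mark_sum g \<omega>)) = (LINT \<omega>|Q. exp (- (\<Sum>k. g (\<gamma> k \<omega>))))"
  proof (rule integral_cong_AE)
    have [measurable]: "g \<in> borel_measurable borel" by fact
    show "(\<lambda>\<omega>. exp (- (\<Sum>k. g (\<gamma> k \<omega>)))) \<in> borel_measurable Q" by measurable
    show "(\<lambda>\<omega>. exp (- mark_sum g \<omega>)) \<in> borel_measurable Q"
      using mark_sum_measurable[OF assms(1)] by measurable
    show "AE \<omega> in Q. exp (- mark_sum g \<omega>) = exp (- (\<Sum>k. g (\<gamma> k \<omega>)))"
      using gamma_summable by eventually_elim (simp add: mark_sum_def)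
  qed
  then show ?thesis using laplace_functional[OF assms] by simp
qed

definition env_vec :: "(nat \<Rightarrow> real \<Rightarrow> real) \<Rightarrow> nat \<Rightarrow> 'w \<Rightarrow> nat \<Rightarrow> real" where
  "env_vec g n \<omega> i = env_sum (g i) n \<omega>"

definition mark_vec :: "(nat \<Rightarrow> real \<Rightarrow> real) \<Rightarrow> 'g \<Rightarrow> nat \<Rightarrow> real" where
  "mark_vec g \<omega> i = mark_sum (g i) \<omega>"

text \<open>A product of exponentials of sums is the exponential of the sum for the added functions.
  Hence mixed moments are again Laplace functionals.\<close>

lemma exp_vec_limit:
  assumes g: "\<And>i. admissible (g i)" and h: "continuous_on unit_box (h :: _ \<Rightarrow> real)"
  shows "(\<lambda>n. LINT \<omega>|M. h (\<lambda>i. exp (- env_vec g n \<omega> i))) \<longlonglongrightarrow> (LINT \<omega>|Q. h (\<lambda>i. exp (- mark_vec g \<omega> i)))"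
proof (rule unit_box_moments_imp_limit[OF prob_space_axioms Q.prob_space_axioms _ _ _ _ h])
  have gm: "g i \<in> borel_measurable borel" for i using g by (simp add: admissible_def)
  show "\<forall>\<^sub>F n in sequentially. (\<forall>i. (\<lambda>\<omega>. exp (- env_vec g n \<omega> i)) \<in> borel_measurable M) \<and>
      (\<forall>\<omega>\<in>space M. (\<lambda>i. exp (- env_vec g n \<omega> i)) \<in> unit_box)"
    using c_gt_1
  proof eventually_elim
    case (elim n)
    have "0 < env_vec g n \<omega> i" for \<omega> i using elim env_sum_pos[OF _ g] by (simp add: env_vec_def)
    then show ?case
      using env_sum_measurable[OF _ gm] elim by (auto simp: unit_box_def env_vec_def less_imp_le)
  qed
  show "(\<lambda>\<omega>. exp (- mark_vec g \<omega> i)) \<in> borel_measurable Q" for i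
    using mark_sum_measurable[OF gm] by (simp add: mark_vec_def)
  show "(\<lambda>i. exp (- mark_vec g \<omega> i)) \<in> unit_box" if "\<omega> \<in> space Q" for \<omega>
    using mark_sum_pos[OF g that] by (auto simp: unit_box_def mark_vec_def less_imp_le)
  fix l :: "nat list"
  define G where "G = (\<lambda>x. sum_list (map (\<lambda>i. g i x) l))"
  have G: "G \<in> borel_measurable borel"
    unfolding G_def by (induction l) (use gm in \<open>auto intro!: borel_measurable_add\<close>)
  have Gb: "0 \<le> G x \<and> G x \<le> real (length l) * x" if "x > 0" for x
    unfolding G_def
  proof (induction l)
    case (Cons a l)
    have "0 < g a x" "g a x \<le> x" using g[of a] that by (auto simp: admissible_def)
    then show ?case using Cons by (simp add: distrib_right)
  qed simp
  have env_G: "prod_list (map (\<lambda>i. exp (- env_vec g n \<omega> i)) l) = exp (- env_sum G n \<omega>)" for n \<omega>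
    unfolding G_def env_vec_def by (induction l) (auto simp: env_sum_def sum.distrib exp_add[symmetric])
  have mark_G: "prod_list (map (\<lambda>i. exp (- mark_vec g \<omega> i)) l) = exp (- mark_sum G \<omega>)"
    if "\<omega> \<in> space Q" "summable (\<lambda>k. \<gamma> k \<omega>)" for \<omega>
  proof -
    have "summable (\<lambda>k. sum_list (map (\<lambda>i. g i (\<gamma> k \<omega>)) l)) \<and>
        prod_list (map (\<lambda>i. exp (- mark_vec g \<omega> i)) l) = exp (- (\<Sum>k. sum_list (map (\<lambda>i. g i (\<gamma> k \<omega>)) l)))"
      using that(2) admissible_summable[OF g that]
      by (induction l) (auto simp: mark_vec_def mark_sum_def exp_add[symmetric] suminf_add[symmetric] intro!: summable_add)
    then show ?thesis using that by (simp add: mark_sum_def G_def)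
  qed
  have "(LINT \<omega>|Q. prod_list (map (\<lambda>i. exp (- mark_vec g \<omega> i)) l)) = (LINT \<omega>|Q. exp (- mark_sum G \<omega>))"
  proof (rule integral_cong_AE)
    show "(\<lambda>\<omega>. prod_list (map (\<lambda>i. exp (- mark_vec g \<omega> i)) l)) \<in> borel_measurable Q"
      unfolding mark_vec_def by (induction l) (use mark_sum_measurable[OF gm] in \<open>auto intro!: borel_measurable_times\<close>)
    show "(\<lambda>\<omega>. exp (- mark_sum G \<omega>)) \<in> borel_measurable Q"
      using mark_sum_measurable[OF G] by measurable
    show "AE \<omega> in Q. prod_list (map (\<lambda>i. exp (- mark_vec g \<omega> i)) l) = exp (- mark_sum G \<omega>)"
      using gamma_summable AE_space by eventually_elim (rule mark_G)
  qed
  also have "\<dots> = exp (- levy_exponent \<alpha> \<epsilon> G)"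
    by (rule mark_sum_laplace[OF G _ Gb]) auto
  finally show "(\<lambda>n. LINT \<omega>|M. prod_list (map (\<lambda>i. exp (- env_vec g n \<omega> i)) l)) \<longlonglongrightarrow>
      (LINT \<omega>|Q. prod_list (map (\<lambda>i. exp (- mark_vec g \<omega> i)) l))"
    unfolding env_G using environment_laplace[OF G _ Gb] by (simp add: env_sum_def)
qed

definition positive_vecs :: "(nat \<Rightarrow> real) set" where "positive_vecs = {w. \<forall>i. 0 < w i}"

lemma positive_vecs_measurable:
  assumes "\<And>i. (\<lambda>\<omega>. W \<omega> i) \<in> borel_measurable R" "\<And>\<omega>. \<omega> \<in> space R \<Longrightarrow> W \<omega> \<in> positive_vecs"
    and F: "continuous_on positive_vecs F"
  shows "(\<lambda>\<omega>. F (W \<omega>) :: real) \<in> borel_measurable R"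
proof -
  have "positive_vecs = (\<Inter>i. (\<lambda>w. w i) -` {0<..})" by (auto simp: positive_vecs_def)
  also have "\<dots> \<in> sets borel"
    by (intro sets.countable_INT) (auto intro!: borel_open open_vimage)
  finally have P: "positive_vecs \<in> sets borel" .
  have "W \<in> borel_measurable R" by (rule measurable_coordinatewise_then_product) (rule assms(1))
  moreover have "(\<lambda>u. indicat_real positive_vecs u *\<^sub>R F u) \<in> borel_measurable borel"
    by (intro borel_measurable_continuous_on_indicator F P)
  ultimately have "(\<lambda>\<omega>. indicat_real positive_vecs (W \<omega>) *\<^sub>R F (W \<omega>)) \<in> borel_measurable R"
    by (rule measurable_compose)
  then show ?thesis
    by (rule measurable_cong[THEN iffD1, rotated]) (simp add: assms(2))
qed

text \<open>Joint convergence in law: the coordinates are clipped away from 0 and infinity, at the price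
  of a small probability that is again controlled by the limit.\<close>

theorem joint_limit:
  assumes g: "\<And>i. admissible (g i)" and F: "continuous_on positive_vecs (F :: _ \<Rightarrow> real)"
    and K: "\<And>w. w \<in> positive_vecs \<Longrightarrow> \<bar>F w\<bar> \<le> K"
    and dep: "\<And>v w. v \<in> positive_vecs \<Longrightarrow> w \<in> positive_vecs \<Longrightarrow> (\<And>i. i < d \<Longrightarrow> v i = w i) \<Longrightarrow> F v = F w"
  shows "(\<lambda>n. LINT \<omega>|M. F (env_vec g n \<omega>)) \<longlonglongrightarrow> (LINT \<omega>|Q. F (mark_vec g \<omega>))"
proof (rule tendstoI)
  fix e :: real assume e: "e > 0"
  have gm: "g i \<in> borel_measurable borel" for i using g by (simp add: admissible_def)
  have "\<bar>F (\<lambda>_. 1)\<bar> \<le> K" by (rule K) (simp add: positive_vecs_def)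
  then have K0: "0 \<le> K" by linarith
  define D where "D = (\<lambda>b (u :: nat \<Rightarrow> real). \<Sum>i<d. edge_weight b (u i))"
  define h where "h = (\<lambda>b (u :: nat \<Rightarrow> real). F (\<lambda>i. - ln (clip b (u i))))"
  define V where "V = (\<lambda>\<omega> i. exp (- mark_vec g \<omega> i))"
  define U where "U = (\<lambda>n \<omega> i. exp (- env_vec g n \<omega> i))"
  have coord: "continuous_on S (\<lambda>u :: nat \<Rightarrow> real. u i)" for S i
    by (rule continuous_on_product_then_coordinatewise[OF continuous_on_id])
  have clip: "0 < clip b u" "clip b u < 1" if "0 < b" "b < 1/2" for b u
    using that by (auto simp: clip_def)
  have D_cont: "continuous_on S (D b)" if "b > 0" for S b
    unfolding D_def edge_weight_def using that
    by (intro continuous_on_sum continuous_on_min continuous_on_max continuous_on_diff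
        continuous_on_divide continuous_on_const coord) auto
  have h_pos: "(\<lambda>i. - ln (clip b (u i))) \<in> positive_vecs" if "0 < b" "b < 1/2" for b u
    using clip[OF that] by (simp add: positive_vecs_def)
  have h_cont: "continuous_on S (h b)" if b: "0 < b" "b < 1/2" for S b
    unfolding h_def
  proof (rule continuous_on_compose2[OF F])
    have cc: "continuous_on S (\<lambda>u :: nat \<Rightarrow> real. clip b (u i))" for i
      unfolding clip_def
      by (intro continuous_on_min continuous_on_max continuous_on_const coord)
    show "continuous_on S (\<lambda>u. (\<lambda>i. - ln (clip b (u i))))"
      using clip[OF b] by (intro continuous_on_coordinatewise_then_product continuous_on_minus continuous_on_ln cc) (auto simp: less_imp_neq[symmetric])
    show "(\<lambda>u i. - ln (clip b (u i))) ` S \<subseteq> positive_vecs"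
      using h_pos[OF b] by auto
  qed
  \<comment> \<open>Either the clipping leaves the first \<open>d\<close> coordinates alone and both
    values agree, or \<open>D\<close> is at least 1 and the trivial bound \<open>2 * K\<close>
    applies.\<close>
  have key: "\<bar>F w - h b (\<lambda>i. exp (- w i))\<bar> \<le> 2 * K * D b (\<lambda>i. exp (- w i))"
    if b: "0 < b" "b < 1/2" and w: "w \<in> positive_vecs" for b w
  proof (cases "\<forall>i<d. b \<le> exp (- w i) \<and> exp (- w i) \<le> 1 - b")
    case True
    then have "F w = h b (\<lambda>i. exp (- w i))"
      unfolding h_def by (intro dep w h_pos b) (auto simp: clip_def)
    moreover have "0 \<le> D b (\<lambda>i. exp (- w i))"
      unfolding D_def by (intro sum_nonneg edge_weight_bounds)
    ultimately show ?thesis using K0 by simp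
  next
    case False
    then obtain i where i: "i < d" "\<not> (b \<le> exp (- w i) \<and> exp (- w i) \<le> 1 - b)" by auto
    have "1 = edge_weight b (exp (- w i))" using edge_weight_one[OF b(1) i(2)] by simp
    also have "\<dots> \<le> D b (\<lambda>i. exp (- w i))"
      unfolding D_def using i(1) edge_weight_bounds
      by (intro member_le_sum[where f = "\<lambda>i. edge_weight b (exp (- w i))"]) auto
    finally have "2 * K * 1 \<le> 2 * K * D b (\<lambda>i. exp (- w i))" using K0 by (intro mult_left_mono) auto
    moreover have "\<bar>h b (\<lambda>i. exp (- w i))\<bar> \<le> K" unfolding h_def by (intro K h_pos b)
    ultimately show ?thesis using K[OF w] by linarith
  qed
  have mark_vec_pos: "mark_vec g \<omega> \<in> positive_vecs" if "\<omega> \<in> space Q" for \<omega>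
    using mark_sum_pos[OF g that] by (simp add: positive_vecs_def mark_vec_def)
  have V: "(\<lambda>\<omega>. V \<omega> i) \<in> borel_measurable Q" "\<omega> \<in> space Q \<Longrightarrow> V \<omega> \<in> unit_box" for i \<omega>
    using mark_sum_measurable[OF gm] mark_vec_pos
    by (auto simp: V_def unit_box_def mark_vec_def positive_vecs_def less_imp_le)
  have iQ: "integrable Q (\<lambda>\<omega>. k (V \<omega>) :: real)" if "continuous_on unit_box k" for k
    by (rule Q.unit_box_integrable[where U = V and h = k, OF V that])
  have "(\<lambda>k. LINT \<omega>|Q. D (1 / (real k + 3)) (V \<omega>)) \<longlonglongrightarrow> (LINT \<omega>|Q. 0)"
  proof (rule integral_dominated_convergence[where w = "\<lambda>_. real d"])
    show "(\<lambda>\<omega>. D (1 / (real k + 3)) (V \<omega>)) \<in> borel_measurable Q" for k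
      by (rule borel_measurable_integrable[OF iQ[OF D_cont]]) simp
    show "AE \<omega> in Q. (\<lambda>k. D (1 / (real k + 3)) (V \<omega>)) \<longlonglongrightarrow> 0"
    proof (intro AE_I2)
      fix \<omega> assume "\<omega> \<in> space Q"
      then have "(\<lambda>k. edge_weight (1 / (real k + 3)) (V \<omega> i)) \<longlonglongrightarrow> 0" for i
        using mark_vec_pos by (intro edge_weight_tendsto) (auto simp: V_def positive_vecs_def)
      then show "(\<lambda>k. D (1 / (real k + 3)) (V \<omega>)) \<longlonglongrightarrow> 0"
        unfolding D_def by (intro tendsto_null_sum)
    qed
    show "AE \<omega> in Q. norm (D (1 / (real k + 3)) (V \<omega>)) \<le> real d" for k
    proof (intro AE_I2)
      fix \<omega>
      have "\<bar>D (1 / (real k + 3)) (V \<omega>)\<bar> \<le> (\<Sum>i<d. 1)"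
        unfolding D_def using edge_weight_bounds by (intro order_trans[OF sum_abs] sum_mono) auto
      then show "norm (D (1 / (real k + 3)) (V \<omega>)) \<le> real d" by simp
    qed
  qed auto
  \<comment> \<open>Multiplied by \<open>2 * K\<close> this threshold falls below e/4;
    \<open>K + 1\<close> avoids division by 0.\<close>
  then have "\<forall>\<^sub>F k in sequentially. (LINT \<omega>|Q. D (1 / (real k + 3)) (V \<omega>)) < e / (8 * (K + 1))"
    using e K0 by (intro order_tendstoD) auto
  then obtain k where k: "(LINT \<omega>|Q. D (1 / (real k + 3)) (V \<omega>)) < e / (8 * (K + 1))"
    using eventually_sequentially by auto
  \<comment> \<open>The shift by 3 makes \<open>b\<close> smaller than 1/2, so that a nonempty
    interval survives the clipping.\<close>
  define b where "b = 1 / (real k + 3)"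
  have b: "0 < b" "b < 1/2" by (auto simp: b_def field_simps)
  have small: "2 * K * x < e / 4" if "x < e / (8 * (K + 1))" "0 \<le> x" for x
  proof -
    have "2 * K * x \<le> 2 * (K + 1) * x" using that by (intro mult_right_mono) auto
    also have "\<dots> < 2 * (K + 1) * (e / (8 * (K + 1)))" using that K0 by (intro mult_strict_left_mono) auto
    also have "\<dots> = e / 4" using K0 by (simp add: field_simps)
    finally show ?thesis .
  qed
  have D0: "0 \<le> D b u" for u unfolding D_def by (intro sum_nonneg edge_weight_bounds)
  have lim_D: "(\<lambda>n. LINT \<omega>|M. D b (U n \<omega>)) \<longlonglongrightarrow> (LINT \<omega>|Q. D b (V \<omega>))"
    unfolding U_def V_def by (rule exp_vec_limit[OF g D_cont[OF b(1)]])
  have lim_h: "(\<lambda>n. LINT \<omega>|M. h b (U n \<omega>)) \<longlonglongrightarrow> (LINT \<omega>|Q. h b (V \<omega>))"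
    unfolding U_def V_def by (rule exp_vec_limit[OF g h_cont[OF b]])
  have Qdiff: "\<bar>(LINT \<omega>|Q. F (mark_vec g \<omega>)) - (LINT \<omega>|Q. h b (V \<omega>))\<bar> < e / 4"
  proof -
    have "\<bar>(LINT \<omega>|Q. F (mark_vec g \<omega>)) - (LINT \<omega>|Q. h b (V \<omega>))\<bar> \<le> (LINT \<omega>|Q. 2 * K * D b (V \<omega>))"
    proof (rule Q.integral_abs_diff_le)
      have "(\<lambda>\<omega>. F (mark_vec g \<omega>)) \<in> borel_measurable Q"
        using mark_vec_pos mark_sum_measurable[OF gm]
        by (intro positive_vecs_measurable[where W = "mark_vec g" and F = F] F) (auto simp: mark_vec_def)
      then show "integrable Q (\<lambda>\<omega>. F (mark_vec g \<omega>))"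
        using mark_vec_pos K by (intro Q.integrable_const_bound[of _ K]) auto
      show "integrable Q (\<lambda>\<omega>. h b (V \<omega>))" by (intro iQ h_cont b)
      show "integrable Q (\<lambda>\<omega>. 2 * K * D b (V \<omega>))"
        by (intro integrable_mult_right iQ D_cont b)
      show "\<bar>F (mark_vec g \<omega>) - h b (V \<omega>)\<bar> \<le> 2 * K * D b (V \<omega>)" if "\<omega> \<in> space Q" for \<omega>
        unfolding V_def by (intro key b mark_vec_pos that)
    qed
    also have "\<dots> = 2 * K * (LINT \<omega>|Q. D b (V \<omega>))" by simp
    also have "\<dots> < e / 4"
      using k D0 unfolding b_def[symmetric] by (intro small) (auto intro!: Bochner_Integration.integral_nonneg)
    finally show ?thesis .
  qed
  have "\<forall>\<^sub>F n in sequentially. (LINT \<omega>|M. D b (U n \<omega>)) < e / (8 * (K + 1))"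
    using lim_D k unfolding b_def[symmetric] by (rule order_tendstoD(2))
  moreover have "\<forall>\<^sub>F n in sequentially. dist (LINT \<omega>|M. h b (U n \<omega>)) (LINT \<omega>|Q. h b (V \<omega>)) < e / 4"
    using lim_h e by (intro tendstoD) auto
  ultimately show "\<forall>\<^sub>F n in sequentially. dist (LINT \<omega>|M. F (env_vec g n \<omega>)) (LINT \<omega>|Q. F (mark_vec g \<omega>)) < e"
    using c_gt_1
  proof eventually_elim
    case (elim n)
    have env_pos: "env_vec g n \<omega> \<in> positive_vecs" for \<omega>
      using env_sum_pos[OF _ g] elim by (simp add: positive_vecs_def env_vec_def)
    have U: "(\<lambda>\<omega>. U n \<omega> i) \<in> borel_measurable M" "U n \<omega> \<in> unit_box" for i \<omega>
      using env_sum_measurable[OF _ gm] elim env_pos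
      by (auto simp: U_def unit_box_def env_vec_def positive_vecs_def less_imp_le)
    have iM: "integrable M (\<lambda>\<omega>. k (U n \<omega>) :: real)" if "continuous_on unit_box k" for k
      by (rule unit_box_integrable[where U = "U n" and h = k, OF U that])
    have "\<bar>(LINT \<omega>|M. F (env_vec g n \<omega>)) - (LINT \<omega>|M. h b (U n \<omega>))\<bar> \<le> (LINT \<omega>|M. 2 * K * D b (U n \<omega>))"
    proof (rule integral_abs_diff_le)
      have "(\<lambda>\<omega>. F (env_vec g n \<omega>)) \<in> borel_measurable M"
        using env_pos env_sum_measurable[OF _ gm] elim
        by (intro positive_vecs_measurable[where W = "env_vec g n" and F = F] F) (auto simp: env_vec_def)
      then show "integrable M (\<lambda>\<omega>. F (env_vec g n \<omega>))"
        using env_pos K by (intro integrable_const_bound[of _ K]) auto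
      show "integrable M (\<lambda>\<omega>. h b (U n \<omega>))" by (intro iM h_cont b)
      show "integrable M (\<lambda>\<omega>. 2 * K * D b (U n \<omega>))"
        by (intro integrable_mult_right iM D_cont b)
      show "\<bar>F (env_vec g n \<omega>) - h b (U n \<omega>)\<bar> \<le> 2 * K * D b (U n \<omega>)" for \<omega>
        unfolding U_def by (intro key b env_pos)
    qed
    also have "\<dots> = 2 * K * (LINT \<omega>|M. D b (U n \<omega>))" by simp
    also have "\<dots> < e / 4"
      using elim D0 by (intro small) (auto intro!: Bochner_Integration.integral_nonneg)
    finally show ?case using elim(2) Qdiff unfolding dist_real_def by linarith
  qed
qed

end

section \<open>Convergence of the correlation function\<close>

lemma cts_step_bounds: "x < y \<Longrightarrow> 0 \<le> cts_step x y u \<and> cts_step x y u \<le> 1"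
  by (auto simp: cts_step_def field_simps)

lemma cts_step_Lipschitz:
  assumes "x < y"
  shows "\<bar>cts_step x y u - cts_step x y v\<bar> \<le> min 1 (\<bar>u - v\<bar> / (y - x))"
proof -
  have eq: "cts_step x y u = max 0 (min 1 ((y - u) / (y - x)))" for u
    using assms by (auto simp: cts_step_def max_def min_def field_simps)
  have "\<bar>cts_step x y u - cts_step x y v\<bar> \<le> \<bar>(y - u) / (y - x) - (y - v) / (y - x)\<bar>"
    unfolding eq by linarith
  also have "\<dots> = \<bar>u - v\<bar> / (y - x)"
    using assms by (simp add: diff_divide_distrib[symmetric] abs_minus_commute)
  finally have "\<bar>cts_step x y u - cts_step x y v\<bar> \<le> \<bar>u - v\<bar> / (y - x)" .
  moreover have "\<bar>cts_step x y u - cts_step x y v\<bar> \<le> 1"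
    using cts_step_bounds[OF assms, of u] cts_step_bounds[OF assms, of v] by linarith
  ultimately show ?thesis by simp
qed

lemma cts_step_continuous: "x < y \<Longrightarrow> continuous_on S (cts_step x y)"
  by (rule continuous_on_subset[OF uniformly_continuous_imp_continuous[OF cts_step_uniformly_continuous] subset_UNIV])

lemma cts_step_measurable: "x < y \<Longrightarrow> cts_step x y \<in> borel_measurable borel"
  by (intro borel_measurable_continuous_onI cts_step_continuous)

text \<open>It feeds bounds on squares into first moments: the linear quantity is traded for its
  square at an additive cost, and no root of a random bound has to be integrated.\<close>

lemma le_add_square: "0 \<le> u \<Longrightarrow> 0 < \<eta> \<Longrightarrow> u \<le> \<eta> + u\<^sup>2 / \<eta>" for u \<eta> :: real
proof -
  assume *: "0 \<le> u" "0 < \<eta>"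
  show ?thesis
  proof (cases "u \<le> \<eta>")
    case True
    then show ?thesis using * by (simp add: add_increasing2)
  next
    case False
    then have "\<eta> * u \<le> u * u" using * by (intro mult_right_mono) auto
    then have "u \<le> u\<^sup>2 / \<eta>" using * by (simp add: pos_le_divide_eq power2_eq_square mult.commute)
    then show ?thesis using * by linarith
  qed
qed

text \<open>Ramp functions determine weak convergence. Variables that are not measurable, which can
  happen only for finitely many \<open>n\<close>, are replaced by constants.\<close>

lemma (in prob_space) weak_conv_distrI:
  fixes X :: "nat \<Rightarrow> 'a \<Rightarrow> real"
  assumes X: "\<forall>\<^sub>F n in sequentially. X n \<in> borel_measurable M" and L: "real_distribution L"
    and lim: "\<And>x y. x < y \<Longrightarrow> (\<lambda>n. LINT \<omega>|M. cts_step x y (X n \<omega>)) \<longlonglongrightarrow> integral\<^sup>L L (cts_step x y)"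
  shows "weak_conv_m (\<lambda>n. distr M borel (X n)) L"
proof -
  define Y where "Y = (\<lambda>n. if X n \<in> borel_measurable M then X n else (\<lambda>_. 0))"
  have Y: "Y n \<in> borel_measurable M" for n by (simp add: Y_def)
  have YX: "\<forall>\<^sub>F n in sequentially. Y n = X n"
    using X by eventually_elim (simp add: Y_def)
  have "weak_conv_m (\<lambda>n. distr M borel (Y n)) L"
  proof (rule integral_cts_step_conv_imp_weak_conv)
    show "real_distribution (distr M borel (Y n))" for n
      by (rule real_distribution_distr[OF Y])
    show "real_distribution L" by fact
    fix x y :: real assume xy: "x < y"
    have "\<forall>\<^sub>F n in sequentially. (LINT \<omega>|M. cts_step x y (X n \<omega>)) = integral\<^sup>L (distr M borel (Y n)) (cts_step x y)"
      using YX
    proof eventually_elim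
      case (elim n)
      then show ?case using integral_distr[OF Y cts_step_measurable[OF xy], of n] by simp
    qed
    with lim[OF xy] show "(\<lambda>n. integral\<^sup>L (distr M borel (Y n)) (cts_step x y)) \<longlonglongrightarrow> integral\<^sup>L L (cts_step x y)"
      by (rule Lim_transform_eventually)
  qed
  then have lim: "(\<lambda>n. cdf (distr M borel (Y n)) x) \<longlonglongrightarrow> cdf L x" if "isCont (cdf L) x" for x
    using that by (simp add: weak_conv_m_def weak_conv_def)
  have ev: "\<forall>\<^sub>F n in sequentially. cdf (distr M borel (Y n)) x = cdf (distr M borel (X n)) x" for x
    using YX by eventually_elim simp
  show ?thesis
    unfolding weak_conv_m_def weak_conv_def
    by (intro allI impI Lim_transform_eventually[OF lim ev])
qed

text \<open>Tightness provides a limit along a subsequence, and the assumed convergence of all ramp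
  integrals ties the full sequence to it. The limit law is thus produced without being
  identified.\<close>

lemma (in prob_space) bounded_limit_law:
  fixes X :: "nat \<Rightarrow> 'a \<Rightarrow> real"
  assumes X: "\<forall>\<^sub>F n in sequentially. X n \<in> borel_measurable M \<and> (\<forall>\<omega>\<in>space M. 0 \<le> X n \<omega> \<and> X n \<omega> \<le> 1)"
    and conv: "\<And>x y. x < y \<Longrightarrow> convergent (\<lambda>n. LINT \<omega>|M. cts_step x y (X n \<omega>))"
  obtains L where "real_distribution L" "weak_conv_m (\<lambda>n. distr M borel (X n)) L"
    and "\<And>x y. x < y \<Longrightarrow> (\<lambda>n. LINT \<omega>|M. cts_step x y (X n \<omega>)) \<longlonglongrightarrow> integral\<^sup>L L (cts_step x y)"
proof -
  define good where "good = (\<lambda>n. X n \<in> borel_measurable M \<and> (\<forall>\<omega>\<in>space M. 0 \<le> X n \<omega> \<and> X n \<omega> \<le> 1))"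
  define Y where "Y = (\<lambda>n. if good n then X n else (\<lambda>_. 0))"
  have Y: "Y n \<in> borel_measurable M" and Y01: "\<omega> \<in> space M \<Longrightarrow> 0 \<le> Y n \<omega> \<and> Y n \<omega> \<le> 1" for n \<omega>
    by (auto simp: Y_def good_def)
  have YX: "\<forall>\<^sub>F n in sequentially. Y n = X n"
    using X by eventually_elim (simp add: Y_def good_def)
  have rd: "real_distribution (distr M borel (Y n))" for n
    by (rule real_distribution_distr[OF Y])
  have "measure (distr M borel (Y n)) {-1<..1} = 1" for n
  proof -
    have "Y n -` {-1<..1} \<inter> space M = space M" using Y01[of _ n] by force
    then show ?thesis using Y by (simp add: measure_distr prob_space)
  qed
  then have "tight (\<lambda>n. distr M borel (Y n))"
    unfolding tight_def using rd by (intro conjI allI impI exI[of _ "-1"] exI[of _ 1]) auto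
  from tight_imp_convergent_subsubsequence[OF this strict_mono_id]
  obtain r L where r: "strict_mono r" and L: "real_distribution L"
    and w: "weak_conv_m ((\<lambda>n. distr M borel (Y n)) \<circ> id \<circ> r) L" by blast
  have lim: "(\<lambda>n. LINT \<omega>|M. cts_step x y (X n \<omega>)) \<longlonglongrightarrow> integral\<^sup>L L (cts_step x y)" if xy: "x < y" for x y
  proof -
    have "(\<lambda>n. integral\<^sup>L (((\<lambda>n. distr M borel (Y n)) \<circ> id \<circ> r) n) (cts_step x y)) \<longlonglongrightarrow> integral\<^sup>L L (cts_step x y)"
    proof (rule weak_conv_imp_integral_bdd_continuous_conv[OF _ L w])
      show "real_distribution (((\<lambda>n. distr M borel (Y n)) \<circ> id \<circ> r) n)" for n using rd by simp
      show "isCont (cts_step x y) u" for u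
        using cts_step_continuous[OF xy, of UNIV] by (simp add: continuous_on_eq_continuous_at)
      show "norm (cts_step x y u) \<le> 1" for u using cts_step_bounds[OF xy, of u] by simp
    qed
    moreover have "integral\<^sup>L (((\<lambda>n. distr M borel (Y n)) \<circ> id \<circ> r) n) (cts_step x y) = (LINT \<omega>|M. cts_step x y (Y (r n) \<omega>))" for n
      using integral_distr[OF Y cts_step_measurable[OF xy], of "r n"] by simp
    ultimately have sub: "(\<lambda>n. LINT \<omega>|M. cts_step x y (Y (r n) \<omega>)) \<longlonglongrightarrow> integral\<^sup>L L (cts_step x y)" by simp
    obtain a where a: "(\<lambda>n. LINT \<omega>|M. cts_step x y (X n \<omega>)) \<longlonglongrightarrow> a"
      using conv[OF xy] by (auto simp: convergent_def)
    have "\<forall>\<^sub>F n in sequentially. (LINT \<omega>|M. cts_step x y (X n \<omega>)) = (LINT \<omega>|M. cts_step x y (Y n \<omega>))"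
      using YX by eventually_elim simp
    with a have "(\<lambda>n. LINT \<omega>|M. cts_step x y (Y n \<omega>)) \<longlonglongrightarrow> a" by (rule Lim_transform_eventually)
    from LIMSEQ_subseq_LIMSEQ[OF this r] have "(\<lambda>n. LINT \<omega>|M. cts_step x y (Y (r n) \<omega>)) \<longlonglongrightarrow> a"
      by (simp add: o_def)
    from LIMSEQ_unique[OF this sub] a show ?thesis by simp
  qed
  have "\<forall>\<^sub>F n in sequentially. X n \<in> borel_measurable M" using X by eventually_elim simp
  from that[OF L weak_conv_distrI[OF this L lim] lim] show thesis .
qed

lemma convergent_approx:
  fixes a :: "nat \<Rightarrow> real"
  assumes "\<And>e. e > 0 \<Longrightarrow> \<exists>z. convergent z \<and> (\<forall>\<^sub>F n in sequentially. \<bar>a n - z n\<bar> \<le> e)"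
  shows "convergent a"
proof -
  have "Cauchy a"
    unfolding Cauchy_def
  proof (intro allI impI)
    fix e :: real assume e: "e > 0"
    obtain z where z: "convergent z" and az: "\<forall>\<^sub>F n in sequentially. \<bar>a n - z n\<bar> \<le> e / 4"
      using assms[of "e / 4"] e by auto
    obtain N1 where N1: "\<And>n. n \<ge> N1 \<Longrightarrow> \<bar>a n - z n\<bar> \<le> e / 4"
      using az by (auto simp: eventually_sequentially)
    have "e / 4 > 0" using e by simp
    with convergent_Cauchy[OF z] obtain N2 where N2: "\<And>m n. m \<ge> N2 \<Longrightarrow> n \<ge> N2 \<Longrightarrow> dist (z m) (z n) < e / 4"
      unfolding Cauchy_def by blast
    have "dist (a m) (a n) < e" if "m \<ge> max N1 N2" "n \<ge> max N1 N2" for m n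
      using N1[of m] N1[of n] N2[of m n] that e unfolding dist_real_def by (auto simp: abs_if split: if_splits)
    then show "\<exists>N. \<forall>m\<ge>N. \<forall>n\<ge>N. dist (a m) (a n) < e" by blast
  qed
  then show ?thesis by (rule Cauchy_convergent)
qed

text \<open>The factor \<open>1 / (1 + l * x)\<close> comes from the Laplace transform in the age, the factor
  \<open>exp (- s / x)\<close> is the probability to stay for a time \<open>s\<close> in a trap of depth \<open>x\<close>.\<close>

definition cut :: "real \<Rightarrow> real \<Rightarrow> real" where "cut l x = x / (1 + l * x)"

definition cut_stay :: "real \<Rightarrow> real \<Rightarrow> real \<Rightarrow> real" where
  "cut_stay l s x = x * exp (- s / x) / (1 + l * x)"

section \<open>Quotients of sums and the stationary correlation\<close>

context rem_limit
begin

lemma admissible_id: "admissible (\<lambda>x. x)"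
  by (simp add: admissible_def)

lemma admissible_cut: "l \<ge> 0 \<Longrightarrow> admissible (cut l)"
  unfolding admissible_def
proof (intro conjI allI impI)
  fix x :: real assume *: "l \<ge> 0" "x > 0"
  then have "1 \<le> 1 + l * x" by simp
  then show "0 < cut l x" "cut l x \<le> x"
    using * unfolding cut_def by (auto intro!: divide_pos_pos add_pos_nonneg simp: divide_le_eq mult_le_cancel_left1)
qed (simp add: cut_def[abs_def])

lemma admissible_cut_stay:
  assumes "l \<ge> 0" "s \<ge> 0"
  shows "admissible (cut_stay l s)"
  unfolding admissible_def
proof (intro conjI allI impI)
  fix x :: real assume x: "x > 0"
  have c: "0 < cut l x" "cut l x \<le> x" using admissible_cut[OF assms(1)] x by (auto simp: admissible_def)
  have eq: "cut_stay l s x = cut l x * exp (- s / x)" by (simp add: cut_stay_def cut_def)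
  have e1: "exp (- s / x) \<le> 1" using assms x by simp
  show "0 < cut_stay l s x" unfolding eq using c by simp
  have "cut l x * exp (- s / x) \<le> cut l x * 1" using c e1 by (intro mult_left_mono) auto
  then show "cut_stay l s x \<le> x" unfolding eq using c by linarith
qed (simp add: cut_stay_def[abs_def])

lemma ratio_limit:
  assumes g: "admissible g1" "admissible g2" and \<phi>: "continuous_on {0<..} \<phi>"
    and K: "\<And>u. u > 0 \<Longrightarrow> \<bar>\<phi> u\<bar> \<le> K"
  shows "(\<lambda>n. LINT \<omega>|M. \<phi> (env_sum g1 n \<omega> / env_sum g2 n \<omega>)) \<longlonglongrightarrow> (LINT \<omega>|Q. \<phi> (mark_sum g1 \<omega> / mark_sum g2 \<omega>) :: real)"
proof -
  let ?g = "\<lambda>i :: nat. if i = 0 then g1 else g2"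
  let ?F = "\<lambda>w :: nat \<Rightarrow> real. \<phi> (w 0 / w 1)"
  have "(\<lambda>n. LINT \<omega>|M. ?F (env_vec ?g n \<omega>)) \<longlonglongrightarrow> (LINT \<omega>|Q. ?F (mark_vec ?g \<omega>))"
  proof (rule joint_limit[where d = 2 and K = K])
    show "admissible (?g i)" for i using g by simp
    have coord: "continuous_on S (\<lambda>u :: nat \<Rightarrow> real. u i)" for S i
      by (rule continuous_on_product_then_coordinatewise[OF continuous_on_id])
    show "continuous_on positive_vecs ?F"
    proof (rule continuous_on_compose2[OF \<phi>])
      show "continuous_on positive_vecs (\<lambda>w :: nat \<Rightarrow> real. w 0 / w 1)"
        by (intro continuous_on_divide coord) (auto simp: positive_vecs_def less_imp_neq[symmetric])
    qed (auto simp: positive_vecs_def)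
  qed (auto simp: positive_vecs_def intro!: K)
  then show ?thesis by (simp add: env_vec_def mark_vec_def)
qed

text \<open>The gap tends to 0 while the total depth converges in law. Once the prefactor is below a
  fixed 1/(k + 1), the truncated expectation is controlled by its limit over the Poisson points,
  which is small for large \<open>k\<close>.\<close>

lemma gap_vanish:
  assumes K: "K \<ge> 0"
  shows "(\<lambda>n. LINT \<omega>|M. min 1 (K * cube_gap n * env_sum (\<lambda>x. x) n \<omega>)) \<longlonglongrightarrow> 0"
proof (rule tendstoI)
  fix e :: real assume e: "e > 0"
  let ?B = "mark_sum (\<lambda>x. x)"
  have B_meas: "?B \<in> borel_measurable Q" by (rule mark_sum_measurable) simp
  have B_pos: "0 < ?B \<omega>" if "\<omega> \<in> space Q" for \<omega> using mark_sum_pos[OF admissible_id that] .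
  have "(\<lambda>k. LINT \<omega>|Q. min 1 (1 / (real k + 1) * ?B \<omega>)) \<longlonglongrightarrow> (LINT \<omega>|Q. 0)"
  proof (rule integral_dominated_convergence[where w = "\<lambda>_. 1"])
    show "AE \<omega> in Q. (\<lambda>k. min 1 (1 / (real k + 1) * ?B \<omega>)) \<longlonglongrightarrow> 0"
    proof (intro AE_I2)
      fix \<omega> assume "\<omega> \<in> space Q"
      have "(\<lambda>k. 1 / (real k + 1)) \<longlonglongrightarrow> 0" by real_asymp
      then have "(\<lambda>k. min 1 (1 / (real k + 1) * ?B \<omega>)) \<longlonglongrightarrow> min 1 (0 * ?B \<omega>)"
        by (intro tendsto_min tendsto_mult tendsto_const)
      then show "(\<lambda>k. min 1 (1 / (real k + 1) * ?B \<omega>)) \<longlonglongrightarrow> 0" by simp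
    qed
    show "AE \<omega> in Q. norm (min 1 (1 / (real k + 1) * ?B \<omega>)) \<le> 1" for k
      using B_pos by (intro AE_I2) (auto simp: less_imp_le)
    show "(\<lambda>\<omega>. min 1 (1 / (real k + 1) * ?B \<omega>)) \<in> borel_measurable Q" for k
      using B_meas by measurable
  qed auto
  then have "\<forall>\<^sub>F k in sequentially. (LINT \<omega>|Q. min 1 (1 / (real k + 1) * ?B \<omega>)) < e"
    using e by (intro order_tendstoD) auto
  then obtain k where k: "(LINT \<omega>|Q. min 1 (1 / (real k + 1) * ?B \<omega>)) < e"
    using eventually_sequentially by auto
  let ?d = "1 / (real k + 1)"
  have lim: "(\<lambda>n. LINT \<omega>|M. min 1 (?d * env_sum (\<lambda>x. x) n \<omega>)) \<longlonglongrightarrow> (LINT \<omega>|Q. min 1 (?d * ?B \<omega>))"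
  proof -
    have "(\<lambda>n. LINT \<omega>|M. min 1 (?d * env_vec (\<lambda>_ x. x) n \<omega> 0)) \<longlonglongrightarrow> (LINT \<omega>|Q. min 1 (?d * mark_vec (\<lambda>_ x. x) \<omega> 0))"
    proof (rule joint_limit[where d = 1 and K = 1 and F = "\<lambda>w. min 1 (?d * w 0)"])
      show "continuous_on positive_vecs (\<lambda>w :: nat \<Rightarrow> real. min 1 (?d * w 0))"
        by (intro continuous_on_min continuous_on_mult continuous_on_const
            continuous_on_product_then_coordinatewise[OF continuous_on_id])
      show "\<bar>min 1 (?d * w 0)\<bar> \<le> 1" if "w \<in> positive_vecs" for w :: "nat \<Rightarrow> real"
      proof -
        have "0 \<le> ?d * w 0" using that by (simp add: positive_vecs_def less_imp_le)
        then show ?thesis by (simp add: abs_le_iff)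
      qed
    qed (auto simp: admissible_id)
    then show ?thesis by (simp add: env_vec_def mark_vec_def)
  qed
  have "\<forall>\<^sub>F n in sequentially. K * cube_gap n < ?d"
    using tendsto_mult[OF tendsto_const[of K] cube_gap_tendsto] by (intro order_tendstoD) auto
  then show "\<forall>\<^sub>F n in sequentially. dist (LINT \<omega>|M. min 1 (K * cube_gap n * env_sum (\<lambda>x. x) n \<omega>)) 0 < e"
    using order_tendstoD(2)[OF lim k] c_gt_1
  proof eventually_elim
    case (elim n)
    have B [measurable]: "env_sum (\<lambda>x. x) n \<in> borel_measurable M" using elim by (intro env_sum_measurable) auto
    have pos: "0 < env_sum (\<lambda>x. x) n \<omega>" for \<omega> using elim by (intro env_sum_pos admissible_id) auto
    have Kg: "0 \<le> K * cube_gap n" using K cube_gap_nonneg by simp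
    have "(LINT \<omega>|M. min 1 (K * cube_gap n * env_sum (\<lambda>x. x) n \<omega>)) \<le> (LINT \<omega>|M. min 1 (?d * env_sum (\<lambda>x. x) n \<omega>))"
    proof (rule integral_mono)
      show "integrable M (\<lambda>\<omega>. min 1 (K * cube_gap n * env_sum (\<lambda>x. x) n \<omega>))"
        using pos Kg by (intro integrable_const_bound[of _ 1]) (auto simp: less_imp_le)
      show "integrable M (\<lambda>\<omega>. min 1 (?d * env_sum (\<lambda>x. x) n \<omega>))"
        using pos by (intro integrable_const_bound[of _ 1]) (auto simp: less_imp_le)
      fix \<omega>
      have "K * cube_gap n * env_sum (\<lambda>x. x) n \<omega> \<le> ?d * env_sum (\<lambda>x. x) n \<omega>"
        using elim pos[of \<omega>] by (intro mult_right_mono) auto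
      then show "min 1 (K * cube_gap n * env_sum (\<lambda>x. x) n \<omega>) \<le> min 1 (?d * env_sum (\<lambda>x. x) n \<omega>)"
        by (simp only: min.mono order_refl)
    qed
    moreover have "0 \<le> (LINT \<omega>|M. min 1 (K * cube_gap n * env_sum (\<lambda>x. x) n \<omega>))"
      using Kg pos by (intro Bochner_Integration.integral_nonneg) (auto simp: less_imp_le)
    ultimately show ?case using elim by (simp add: dist_real_def)
  qed
qed

text \<open>Tannery, dominated by the points themselves. If these are not summable, both sides are
  the default value 1.\<close>

lemma mark_cut_limit:
  assumes w: "\<omega> \<in> space Q"
  shows "((\<lambda>t. mark_sum (cut (1 / (2 * t))) \<omega>) \<longlongrightarrow> mark_sum (\<lambda>x. x) \<omega>) at_top"
proof (cases "summable (\<lambda>k. \<gamma> k \<omega>)")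
  case True
  have pos: "0 < \<gamma> k \<omega>" for k using gamma_pos[OF w] .
  have "((\<lambda>t. \<Sum>k. cut (1 / (2 * t)) (\<gamma> k \<omega>)) \<longlongrightarrow> (\<Sum>k. \<gamma> k \<omega>)) at_top"
  proof (rule tannerys_theorem[THEN conjunct2, THEN conjunct2])
    show "((\<lambda>t. cut (1 / (2 * t)) (\<gamma> k \<omega>)) \<longlongrightarrow> \<gamma> k \<omega>) at_top" for k
    proof -
      have "((\<lambda>t :: real. 1 / (2 * t)) \<longlongrightarrow> 0) at_top" by real_asymp
      then have "((\<lambda>t. cut (1 / (2 * t)) (\<gamma> k \<omega>)) \<longlongrightarrow> \<gamma> k \<omega> / (1 + 0 * \<gamma> k \<omega>)) at_top"
        unfolding cut_def by (intro tendsto_intros) auto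
      then show ?thesis by simp
    qed
    have "\<forall>\<^sub>F t in at_top. \<forall>k. norm (cut (1 / (2 * t)) (\<gamma> k \<omega>)) \<le> \<gamma> k \<omega>"
      using eventually_gt_at_top[of 0]
    proof eventually_elim
      case (elim t)
      then have "admissible (cut (1 / (2 * t)))" by (intro admissible_cut) simp
      then show ?case using pos by (auto simp: admissible_def less_imp_le)
    qed
    then show "eventually (\<lambda>(k, t). norm (cut (1 / (2 * t)) (\<gamma> k \<omega>)) \<le> \<gamma> k \<omega>) (prod_filter at_top at_top)"
      unfolding eventually_prod_filter
      by (intro exI[of _ "\<lambda>_. True"] exI[of _ "\<lambda>t. \<forall>k. norm (cut (1 / (2 * t)) (\<gamma> k \<omega>)) \<le> \<gamma> k \<omega>"]) auto
  qed (use True in auto)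
  then show ?thesis using True by (simp add: mark_sum_def)
qed (simp add: mark_sum_def)

lemma C_sta_measurable: "C_sta \<gamma> s \<in> borel_measurable Q"
  unfolding C_sta_def[abs_def] by measurable

lemma C_sta_eq:
  assumes s: "s \<ge> 0" and w: "\<omega> \<in> space Q" and sm: "summable (\<lambda>k. \<gamma> k \<omega>)"
  shows "C_sta \<gamma> s \<omega> = mark_sum (cut_stay 0 s) \<omega> / mark_sum (\<lambda>x. x) \<omega>"
proof -
  have "summable (\<lambda>k. cut_stay 0 s (\<gamma> k \<omega>))"
    by (rule admissible_summable[OF admissible_cut_stay w sm]) (use s in auto)
  then have "(\<Sum>k. cut_stay 0 s (\<gamma> k \<omega>) / (\<Sum>l. \<gamma> l \<omega>)) = (\<Sum>k. cut_stay 0 s (\<gamma> k \<omega>)) / (\<Sum>l. \<gamma> l \<omega>)"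
    by (rule suminf_divide)
  then show ?thesis using sm by (simp add: C_sta_def mark_sum_def cut_stay_def)
qed

lemma C_sta_integral:
  assumes s: "s \<ge> 0" and xy: "x < y"
  shows "(LINT \<omega>|Q. cts_step x y (mark_sum (cut_stay 0 s) \<omega> / mark_sum (\<lambda>x. x) \<omega>)) =
    integral\<^sup>L (distr Q borel (C_sta \<gamma> s)) (cts_step x y)"
proof -
  note [measurable] = cts_step_measurable[OF xy] C_sta_measurable
  have [measurable]: "mark_sum (cut_stay 0 s) \<in> borel_measurable Q" "mark_sum (\<lambda>x. x) \<in> borel_measurable Q"
    using admissible_cut_stay[of 0 s] s by (auto intro!: mark_sum_measurable simp: admissible_def)
  have "(LINT \<omega>|Q. cts_step x y (mark_sum (cut_stay 0 s) \<omega> / mark_sum (\<lambda>x. x) \<omega>)) = (LINT \<omega>|Q. cts_step x y (C_sta \<gamma> s \<omega>))"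
  proof (rule integral_cong_AE)
    show "AE \<omega> in Q. cts_step x y (mark_sum (cut_stay 0 s) \<omega> / mark_sum (\<lambda>x. x) \<omega>) = cts_step x y (C_sta \<gamma> s \<omega>)"
      using gamma_summable AE_space by eventually_elim (simp add: C_sta_eq[OF s])
  qed measurable
  then show ?thesis by (simp add: integral_distr)
qed

lemma real_distribution_C_sta: "real_distribution (distr Q borel (C_sta \<gamma> s))"
  by (rule Q.real_distribution_distr[OF C_sta_measurable])

lemma equilibrium_limit:
  assumes s: "s \<ge> 0" and xy: "x < y"
  shows "(\<lambda>n. LINT \<omega>|M. cts_step x y (env_sum (cut_stay 0 s) n \<omega> / env_sum (\<lambda>x. x) n \<omega>)) \<longlonglongrightarrow>
    integral\<^sup>L (distr Q borel (C_sta \<gamma> s)) (cts_step x y)"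
  unfolding C_sta_integral[OF s xy, symmetric]
  using s cts_step_bounds[OF xy]
  by (intro ratio_limit[where K = 1] admissible_cut_stay admissible_id cts_step_continuous xy) auto

end

lemma (in trap_chain) uniform_sum_eq_overlap:
  "(\<Sum>x\<in>cube n. cube_uniform n \<omega> x * semi t f x) = overlap f t"
  by (simp add: cube_uniform_def card_cube overlap_def sum_divide_distrib)

lemma (in rem_limit) trap_sums:
  assumes "trap_chain n (\<lambda>x. trap_depth H \<beta> n \<omega> x / c n) p"
  shows "trap_chain.mass n (\<lambda>x. trap_depth H \<beta> n \<omega> x / c n) = env_sum (\<lambda>x. x) n \<omega>"
    and "trap_chain.cut_mass n (\<lambda>x. trap_depth H \<beta> n \<omega> x / c n) l = env_sum (cut l) n \<omega>"
    and "(\<Sum>x\<in>cube n. trap_depth H \<beta> n \<omega> x / c n * exp (- s / (trap_depth H \<beta> n \<omega> x / c n)) /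
      (1 + l * (trap_depth H \<beta> n \<omega> x / c n))) = env_sum (cut_stay l s) n \<omega>"
  using trap_chain.mass_def[OF assms] trap_chain.cut_mass_def[OF assms]
  by (simp_all add: env_sum_def cut_def cut_stay_def)

section \<open>The correlation function in terms of sums over the environment\<close>

context rem_limit
begin

lemma trap_sum_0:
  "(\<Sum>x\<in>cube n. trap_depth H \<beta> n \<omega> x / c n * exp (- s / (trap_depth H \<beta> n \<omega> x / c n))) = env_sum (cut_stay 0 s) n \<omega>"
  by (simp add: env_sum_def cut_stay_def)

text \<open>The Gibbs start is invariant, so the age disappears already at finite volume.\<close>

lemma gibbs_correlation:
  assumes n: "n \<ge> 1" and c: "c n > 0" and w: "\<omega> \<in> space M" and dyn: "rem_dynamics M H \<beta> (gibbs H \<beta>) P X"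
    and ts: "t \<ge> 0" "s \<ge> 0"
  shows "correlation P X c n t s \<omega> = env_sum (cut_stay 0 s) n \<omega> / env_sum (\<lambda>x. x) n \<omega>"
proof -
  let ?\<tau> = "\<lambda>x. trap_depth H \<beta> n \<omega> x / c n"
  let ?f = "\<lambda>z. exp (- s / ?\<tau> z)"
  obtain p where p: "trap_chain n ?\<tau> p"
    and C: "\<And>t s. 0 \<le> t \<Longrightarrow> 0 \<le> s \<Longrightarrow> correlation P X c n t s \<omega> =
      (\<Sum>x\<in>cube n. gibbs H \<beta> n \<omega> x * kernel_app (cube n) (p t) (\<lambda>z. exp (- s / ?\<tau> z)) x)"
    using correlation_eq[where n = n and c = c, OF n dyn w c] by blast
  interpret T: trap_chain n ?\<tau> p by (rule p)
  have g: "gibbs H \<beta> n \<omega> x = ?\<tau> x / T.mass" for x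
    using c by (simp add: gibbs_def T.mass_def sum_divide_distrib[symmetric])
  have "correlation P X c n t s \<omega> = T.ip (\<lambda>_. 1) (T.semi t ?f) / T.mass"
    unfolding C[OF ts] T.ip_def g sum_divide_distrib by simp
  also have "\<dots> = T.ip (\<lambda>_. 1) ?f / T.mass"
    using ts by (simp add: T.ip_one_semi)
  also have "T.ip (\<lambda>_. 1) ?f = env_sum (cut_stay 0 s) n \<omega>"
    unfolding T.ip_def trap_sum_0[symmetric] by simp
  finally show ?thesis by (simp add: trap_sums(1)[OF p])
qed

text \<open>The estimates for the trap chain in terms of sums with a known joint limit. In this form
  the transition function, obtained separately for each environment, no longer occurs.\<close>

lemma uniform_correlation:
  assumes n: "n \<ge> 1" and c: "c n > 0" and w: "\<omega> \<in> space M" and dyn: "rem_dynamics M H \<beta> cube_uniform P X"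
    and s: "s \<ge> 0"
  shows "t \<ge> 0 \<Longrightarrow> 0 \<le> correlation P X c n t s \<omega> \<and> correlation P X c n t s \<omega> \<le> 1"
    and "continuous_on {0..} (\<lambda>t. correlation P X c n t s \<omega>)"
    and "t > 0 \<Longrightarrow> (correlation P X c n t s \<omega> - env_sum (cut_stay 0 s) n \<omega> / env_sum (\<lambda>x. x) n \<omega>)\<^sup>2 \<le>
      exp 1 * (env_sum (\<lambda>x. x) n \<omega> / env_sum (cut (1 / (2 * t))) n \<omega> - 1 + 1 / t * cube_gap n * env_sum (\<lambda>x. x) n \<omega>)"
    and "t > 0 \<Longrightarrow> t \<le> r \<Longrightarrow> r \<le> t + d \<Longrightarrow> m \<ge> 1 \<Longrightarrow> 2 * real m * d \<le> t \<Longrightarrow>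
      (correlation P X c n r s \<omega> - correlation P X c n t s \<omega>)\<^sup>2 \<le>
      exp 1 / real m * (env_sum (\<lambda>x. x) n \<omega> / env_sum (cut (1 / t)) n \<omega> + 2 / t * cube_gap n * env_sum (\<lambda>x. x) n \<omega>)"
    and "l > 0 \<Longrightarrow> \<bar>(LINT t:{0..}|lborel. exp (- l * t) * correlation P X c n t s \<omega>)
        - env_sum (cut_stay l s) n \<omega> / (l * env_sum (cut l) n \<omega>)\<bar> \<le> cube_gap n * env_sum (\<lambda>x. x) n \<omega>"
proof -
  let ?\<tau> = "\<lambda>x. trap_depth H \<beta> n \<omega> x / c n"
  let ?f = "\<lambda>z. exp (- s / ?\<tau> z)"
  obtain p where p: "trap_chain n ?\<tau> p"
    and C': "\<And>t s. 0 \<le> t \<Longrightarrow> 0 \<le> s \<Longrightarrow> correlation P X c n t s \<omega> =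
      (\<Sum>x\<in>cube n. cube_uniform n \<omega> x * kernel_app (cube n) (p t) (\<lambda>z. exp (- s / ?\<tau> z)) x)"
    using correlation_eq[where n = n and c = c, OF n dyn w c] by blast
  interpret T: trap_chain n ?\<tau> p by (rule p)
  have C: "correlation P X c n t s \<omega> = T.overlap ?f t" if "t \<ge> 0" for t
    using C'[OF that s] T.uniform_sum_eq_overlap by simp
  note sums = trap_sums[OF p] trap_sum_0
  have f: "0 \<le> ?f x" "?f x \<le> 1" if "x \<in> cube n" for x
  proof -
    have "- s / ?\<tau> x \<le> 0" using T.tau_pos[OF that] s by (intro divide_nonpos_pos) auto
    then have "exp (- s / ?\<tau> x) \<le> exp 0" by (simp only: exp_le_cancel_iff)
    then show "0 \<le> ?f x" "?f x \<le> 1" by (simp_all only: exp_ge_zero exp_zero)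
  qed
  have nn: "0 \<le> T.overlap ?f t" if "t \<ge> 0" for t
    unfolding T.overlap_def using that by (intro divide_nonneg_nonneg sum_nonneg T.semi_nonneg) auto
  show "t \<ge> 0 \<Longrightarrow> 0 \<le> correlation P X c n t s \<omega> \<and> correlation P X c n t s \<omega> \<le> 1"
    using T.overlap_bound[of t ?f 1] f nn by (simp add: C abs_le_iff)
  show "continuous_on {0..} (\<lambda>t. correlation P X c n t s \<omega>)"
    using T.overlap_continuous[of ?f] by (rule continuous_on_cong[THEN iffD1, rotated 2]) (auto simp: C)
  show "t > 0 \<Longrightarrow> (correlation P X c n t s \<omega> - env_sum (cut_stay 0 s) n \<omega> / env_sum (\<lambda>x. x) n \<omega>)\<^sup>2 \<le>
      exp 1 * (env_sum (\<lambda>x. x) n \<omega> / env_sum (cut (1 / (2 * t))) n \<omega> - 1 + 1 / t * cube_gap n * env_sum (\<lambda>x. x) n \<omega>)"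
    using T.overlap_equilibrium[where f = ?f and t = t, OF f] unfolding sums by (simp add: C)
  show "t > 0 \<Longrightarrow> t \<le> r \<Longrightarrow> r \<le> t + d \<Longrightarrow> m \<ge> 1 \<Longrightarrow> 2 * real m * d \<le> t \<Longrightarrow>
      (correlation P X c n r s \<omega> - correlation P X c n t s \<omega>)\<^sup>2 \<le>
      exp 1 / real m * (env_sum (\<lambda>x. x) n \<omega> / env_sum (cut (1 / t)) n \<omega> + 2 / t * cube_gap n * env_sum (\<lambda>x. x) n \<omega>)"
    using T.overlap_increment[where f = ?f and t = t and r = r and d = d and m = m, OF f] unfolding sums by (simp add: C)
  assume l: "l > 0"
  have "(LINT t:{0..}|lborel. exp (- l * t) * correlation P X c n t s \<omega>) = (LINT t:{0..}|lborel. exp (- l * t) * T.overlap ?f t)"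
    by (rule set_lebesgue_integral_cong) (auto simp: C)
  then show "\<bar>(LINT t:{0..}|lborel. exp (- l * t) * correlation P X c n t s \<omega>)
        - env_sum (cut_stay l s) n \<omega> / (l * env_sum (cut l) n \<omega>)\<bar> \<le> cube_gap n * env_sum (\<lambda>x. x) n \<omega>"
    using T.overlap_resolvent[where f = ?f, OF l f] unfolding sums by simp
qed

text \<open>The Euler scheme also shows that the correlation function is a measurable function of the
  environment, although the transition functions are only given pointwise.\<close>

lemma uniform_correlation_measurable:
  assumes n: "n \<ge> 1" and c: "c n > 0" and dyn: "rem_dynamics M H \<beta> cube_uniform P X" and t: "t > 0" and s: "s \<ge> 0"
  shows "correlation P X c n t s \<in> borel_measurable M"
proof -
  let ?\<tau> = "\<lambda>\<omega> x. trap_depth H \<beta> n \<omega> x / c n"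
  let ?E = "\<lambda>m \<omega>. kernel_app (cube n) (euler_step (cube n) (trap_rate n (?\<tau> \<omega>)) (t / real m))"
  let ?u = "\<lambda>m \<omega>. \<Sum>x\<in>cube n. cube_uniform n \<omega> x * (?E m \<omega> ^^ m) (\<lambda>z. exp (- s / ?\<tau> \<omega> z)) x"
  have tau: "(\<lambda>\<omega>. ?\<tau> \<omega> x) \<in> borel_measurable M" if "x \<in> cube n" for x
  proof -
    have [measurable]: "H n x \<in> borel_measurable M" by (rule rem_measurable[OF env n that])
    show ?thesis unfolding trap_depth_def by measurable
  qed
  have rate: "(\<lambda>\<omega>. trap_rate n (?\<tau> \<omega>) x y) \<in> borel_measurable M" if "x \<in> cube n" for x y
    unfolding trap_rate_def using tau[OF that] by measurable
  have step: "(\<lambda>\<omega>. euler_step (cube n) (trap_rate n (?\<tau> \<omega>)) h x y) \<in> borel_measurable M" if x: "x \<in> cube n" for x y h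
  proof -
    have "(\<lambda>\<omega>. generator (cube n) (trap_rate n (?\<tau> \<omega>)) x y) \<in> borel_measurable M"
      unfolding generator_def using rate[OF x] by (cases "x = y") (auto intro!: borel_measurable_sum)
    then show ?thesis unfolding euler_step_def by measurable
  qed
  have pow: "(\<lambda>\<omega>. (?E m \<omega> ^^ j) (\<lambda>z. exp (- s / ?\<tau> \<omega> z)) x) \<in> borel_measurable M" if "x \<in> cube n" for m j x
    using that
  proof (induction j arbitrary: x)
    case 0
    have [measurable]: "(\<lambda>\<omega>. ?\<tau> \<omega> x) \<in> borel_measurable M" by (rule tau[OF 0])
    show ?case by (simp only: funpow.simps(1) id_apply) measurable
  next
    case (Suc j)
    have "(\<lambda>\<omega>. \<Sum>y\<in>cube n. euler_step (cube n) (trap_rate n (?\<tau> \<omega>)) (t / real m) x y *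
        (?E m \<omega> ^^ j) (\<lambda>z. exp (- s / ?\<tau> \<omega> z)) y) \<in> borel_measurable M"
      using Suc by (intro borel_measurable_sum borel_measurable_times step Suc.IH)
    moreover have "(?E m \<omega> ^^ Suc j) (\<lambda>z. exp (- s / ?\<tau> \<omega> z)) x =
        (\<Sum>y\<in>cube n. euler_step (cube n) (trap_rate n (?\<tau> \<omega>)) (t / real m) x y *
          (?E m \<omega> ^^ j) (\<lambda>z. exp (- s / ?\<tau> \<omega> z)) y)" for \<omega>
      by (subst funpow.simps(2), subst comp_apply, subst kernel_app_def) (rule refl)
    ultimately show ?case by (simp only:)
  qed
  have u: "?u m \<in> borel_measurable M" for m
    unfolding cube_uniform_def by (intro borel_measurable_sum borel_measurable_times borel_measurable_const pow)
  show ?thesis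
  proof (rule borel_measurable_LIMSEQ_real[OF _ u])
    fix \<omega> assume w: "\<omega> \<in> space M"
    obtain p where p: "trap_chain n (?\<tau> \<omega>) p"
      and C: "\<And>t s. 0 \<le> t \<Longrightarrow> 0 \<le> s \<Longrightarrow> correlation P X c n t s \<omega> =
        (\<Sum>x\<in>cube n. cube_uniform n \<omega> x * kernel_app (cube n) (p t) (\<lambda>z. exp (- s / ?\<tau> \<omega> z)) x)"
      using correlation_eq[where n = n and c = c, OF n dyn w c] by blast
    interpret T: trap_chain n "?\<tau> \<omega>" p by (rule p)
    have ts: "correlation P X c n t s \<omega> = (\<Sum>x\<in>cube n. cube_uniform n \<omega> x * T.semi t (\<lambda>z. exp (- s / ?\<tau> \<omega> z)) x)"
      using C t s by simp
    show "(\<lambda>m. ?u m \<omega>) \<longlonglongrightarrow> correlation P X c n t s \<omega>"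
      unfolding ts by (intro tendsto_sum tendsto_mult tendsto_const T.euler_limit t)
  qed
qed

lemma env_ratio_ge_1:
  assumes "c n > 0" "l \<ge> 0"
  shows "1 \<le> env_sum (\<lambda>x. x) n \<omega> / env_sum (cut l) n \<omega>"
proof -
  have "env_sum (cut l) n \<omega> \<le> env_sum (\<lambda>x. x) n \<omega>"
    unfolding env_sum_def using admissible_cut[OF assms(2)] assms(1)
    by (intro sum_mono) (simp add: admissible_def trap_depth_def)
  then show ?thesis using env_sum_pos[OF assms(1) admissible_cut[OF assms(2)]] by simp
qed

lemma mark_ratio_ge_1:
  assumes "l \<ge> 0" and w: "\<omega> \<in> space Q"
  shows "1 \<le> mark_sum (\<lambda>x. x) \<omega> / mark_sum (cut l) \<omega>"
proof -
  have "mark_sum (cut l) \<omega> \<le> mark_sum (\<lambda>x. x) \<omega>"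
  proof (cases "summable (\<lambda>k. \<gamma> k \<omega>)")
    case True
    have "(\<Sum>k. cut l (\<gamma> k \<omega>)) \<le> (\<Sum>k. \<gamma> k \<omega>)"
      using admissible_cut[OF assms(1)] gamma_pos[OF w]
      by (intro suminf_le True admissible_summable[OF admissible_cut[OF assms(1)] w]) (auto simp: admissible_def)
    then show ?thesis using True by (simp add: mark_sum_def)
  qed (simp add: mark_sum_def)
  then show ?thesis using mark_sum_pos[OF admissible_cut[OF assms(1)] w] by simp
qed

end

lemma min_add_le:
  fixes f u a b \<eta> :: real
  assumes "f \<le> min 1 u" "u \<le> \<eta> + a + b" "0 \<le> a" "0 \<le> b" "0 < \<eta>"
  shows "f \<le> \<eta> + min 1 a + min 1 b"
  using assms by linarith

lemma (in prob_space) cts_step_integrable: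
  assumes "x < y" "f \<in> borel_measurable M"
  shows "integrable M (\<lambda>\<omega>. cts_step x y (f \<omega>))"
proof (rule integrable_const_bound[of _ 1])
  show "AE \<omega> in M. norm (cts_step x y (f \<omega>)) \<le> 1"
    using cts_step_bounds[OF assms(1)] by simp
  show "(\<lambda>\<omega>. cts_step x y (f \<omega>)) \<in> borel_measurable M"
    by (rule measurable_compose[OF assms(2) cts_step_measurable[OF assms(1)]])
qed

lemma (in prob_space) min_1_integrable:
  fixes f :: "'a \<Rightarrow> real"
  assumes "f \<in> borel_measurable M" "\<And>\<omega>. 0 \<le> f \<omega>"
  shows "integrable M (\<lambda>\<omega>. min 1 (f \<omega>))"
proof (rule integrable_const_bound[of _ 1])
  show "AE \<omega> in M. norm (min 1 (f \<omega>)) \<le> 1"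
    using assms(2) by simp
  show "(\<lambda>\<omega>. min 1 (f \<omega>)) \<in> borel_measurable M"
    by (intro borel_measurable_min borel_measurable_const assms(1))
qed

section \<open>Limit laws for the two starts\<close>

context rem_limit
begin

lemma cut_measurable: "cut l \<in> borel_measurable borel" "cut_stay l s \<in> borel_measurable borel"
  by (simp_all add: cut_def[abs_def] cut_stay_def[abs_def])

lemma increment_constant_vanish:
  assumes A: "A \<ge> 0" and l: "l \<ge> 0"
  shows "(\<lambda>m. LINT \<omega>|Q. min 1 (A / (real m + 1) * (mark_sum (\<lambda>x. x) \<omega> / mark_sum (cut l) \<omega>))) \<longlonglongrightarrow> 0"
proof -
  have meas [measurable]: "mark_sum (\<lambda>x. x) \<in> borel_measurable Q" "mark_sum (cut l) \<in> borel_measurable Q"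
    using admissible_cut[OF l] by (auto intro!: mark_sum_measurable simp: admissible_def)
  have "(\<lambda>m. LINT \<omega>|Q. min 1 (A / (real m + 1) * (mark_sum (\<lambda>x. x) \<omega> / mark_sum (cut l) \<omega>))) \<longlonglongrightarrow> (LINT \<omega>|Q. 0)"
  proof (rule integral_dominated_convergence[where w = "\<lambda>_. 1"])
    show "AE \<omega> in Q. (\<lambda>m. min 1 (A / (real m + 1) * (mark_sum (\<lambda>x. x) \<omega> / mark_sum (cut l) \<omega>))) \<longlonglongrightarrow> 0"
    proof (intro AE_I2)
      fix \<omega>
      have "(\<lambda>m. A / (real m + 1)) \<longlonglongrightarrow> 0" by real_asymp
      then have "(\<lambda>m. min 1 (A / (real m + 1) * (mark_sum (\<lambda>x. x) \<omega> / mark_sum (cut l) \<omega>))) \<longlonglongrightarrow>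
          min 1 (0 * (mark_sum (\<lambda>x. x) \<omega> / mark_sum (cut l) \<omega>))"
        by (intro tendsto_min tendsto_mult tendsto_const)
      then show "(\<lambda>m. min 1 (A / (real m + 1) * (mark_sum (\<lambda>x. x) \<omega> / mark_sum (cut l) \<omega>))) \<longlonglongrightarrow> 0" by simp
    qed
    show "AE \<omega> in Q. norm (min 1 (A / (real m + 1) * (mark_sum (\<lambda>x. x) \<omega> / mark_sum (cut l) \<omega>))) \<le> 1" for m
    proof (intro AE_I2)
      fix \<omega> assume "\<omega> \<in> space Q"
      then have "0 \<le> A / (real m + 1) * (mark_sum (\<lambda>x. x) \<omega> / mark_sum (cut l) \<omega>)"
        using A mark_ratio_ge_1[OF l] by (intro mult_nonneg_nonneg) (auto intro: order_trans[OF zero_le_one])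
      then show "norm (min 1 (A / (real m + 1) * (mark_sum (\<lambda>x. x) \<omega> / mark_sum (cut l) \<omega>))) \<le> 1" by simp
    qed
    show "(\<lambda>\<omega>. min 1 (A / (real m + 1) * (mark_sum (\<lambda>x. x) \<omega> / mark_sum (cut l) \<omega>))) \<in> borel_measurable Q" for m
      by measurable
  qed auto
  then show ?thesis by simp
qed

lemma equilibrium_constant_vanish:
  assumes A: "A \<ge> 0"
  shows "((\<lambda>t. LINT \<omega>|Q. min 1 (A * max 0 (mark_sum (\<lambda>x. x) \<omega> / mark_sum (cut (1 / (2 * t))) \<omega> - 1))) \<longlongrightarrow> 0) at_top"
proof -
  \<comment> \<open>The inner maximum keeps the integrand in [0, 1] also for those \<open>t\<close>
    at which the quotient is not known to be at least 1.\<close>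
  let ?f = "\<lambda>t \<omega>. min 1 (A * max 0 (mark_sum (\<lambda>x. x) \<omega> / mark_sum (cut (1 / (2 * t))) \<omega> - 1))"
  have meas [measurable]: "mark_sum (\<lambda>x. x) \<in> borel_measurable Q" "mark_sum (cut l) \<in> borel_measurable Q" for l
    by (auto intro!: mark_sum_measurable simp: cut_def[abs_def])
  have "((\<lambda>t. LINT \<omega>|Q. ?f t \<omega>) \<longlongrightarrow> (LINT \<omega>|Q. 0)) at_top"
  proof (rule integral_dominated_convergence_at_top[where w = "\<lambda>_. 1"])
    show "AE \<omega> in Q. ((\<lambda>t. ?f t \<omega>) \<longlongrightarrow> 0) at_top"
    proof (intro AE_I2)
      fix \<omega> assume w: "\<omega> \<in> space Q"
      have pos: "mark_sum (\<lambda>x. x) \<omega> \<noteq> 0" using mark_sum_pos[OF admissible_id w] by simp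
      have "((\<lambda>t. ?f t \<omega>) \<longlongrightarrow> min 1 (A * max 0 (mark_sum (\<lambda>x. x) \<omega> / mark_sum (\<lambda>x. x) \<omega> - 1))) at_top"
        by (intro tendsto_min tendsto_mult tendsto_max tendsto_diff tendsto_divide tendsto_const mark_cut_limit[OF w] pos)
      then show "((\<lambda>t. ?f t \<omega>) \<longlongrightarrow> 0) at_top" using pos by simp
    qed
    show "\<forall>\<^sub>F t in at_top. AE \<omega> in Q. norm (?f t \<omega>) \<le> 1"
      using A by (intro always_eventually allI AE_I2) (simp add: abs_le_iff)
    show "?f t \<in> borel_measurable Q" for t by measurable
  qed auto
  then show ?thesis by simp
qed

text \<open>Ramps are Lipschitz, so the squared distance to the Gibbs average enters through
  \<open>le_add_square\<close> as a truncated expectation. In the limit of large \<open>n\<close>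
  its gap term vanishes and the quotient is replaced by the one over the Poisson points.\<close>

lemma limit_at_equilibrium:
  assumes dyn: "rem_dynamics M H \<beta> cube_uniform P X" and t: "t > 0" and s: "s \<ge> 0" and xy: "x < y" and \<eta>: "\<eta> > 0"
    and lim: "(\<lambda>n. LINT \<omega>|M. cts_step x y (correlation P X c n t s \<omega>)) \<longlonglongrightarrow> a"
  shows "\<bar>a - integral\<^sup>L (distr Q borel (C_sta \<gamma> s)) (cts_step x y)\<bar> \<le> \<eta> +
    (LINT \<omega>|Q. min 1 (exp 1 / ((y - x)\<^sup>2 * \<eta>) * max 0 (mark_sum (\<lambda>x. x) \<omega> / mark_sum (cut (1 / (2 * t))) \<omega> - 1)))"
proof -
  \<comment> \<open>Squaring the Lipschitz quotient gives the square of \<open>y - x\<close>,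
    \<open>le_add_square\<close> the factor \<open>\<eta>\<close>, and
    \<open>overlap_equilibrium\<close> the numerator.\<close>
  define A where "A = exp 1 / ((y - x)\<^sup>2 * \<eta>)"
  have A: "A > 0" using xy \<eta> by (simp add: A_def)
  let ?l = "1 / (2 * t)"
  have l: "?l \<ge> 0" using t by simp
  let ?B = "env_sum (\<lambda>x. x)" and ?R = "\<lambda>n \<omega>. env_sum (cut_stay 0 s) n \<omega> / env_sum (\<lambda>x. x) n \<omega>"
  let ?C = "\<lambda>n \<omega>. correlation P X c n t s \<omega>"
  let ?q = "\<lambda>u. min 1 (A * max 0 (u - 1))"
  let ?h = "\<lambda>n \<omega>. \<eta> + ?q (?B n \<omega> / env_sum (cut ?l) n \<omega>) + min 1 (A * (1 / t) * cube_gap n * ?B n \<omega>)"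
  have q1: "(\<lambda>n. LINT \<omega>|M. ?q (?B n \<omega> / env_sum (cut ?l) n \<omega>)) \<longlonglongrightarrow>
      (LINT \<omega>|Q. ?q (mark_sum (\<lambda>x. x) \<omega> / mark_sum (cut ?l) \<omega>))"
  proof (rule ratio_limit[where K = 1 and \<phi> = ?q, OF admissible_id admissible_cut[OF l]])
    show "continuous_on {0<..} ?q"
      by (intro continuous_on_min continuous_on_mult continuous_on_max continuous_on_diff continuous_on_const continuous_on_id)
    have "0 \<le> A * max 0 (u - 1)" for u using A by (intro mult_nonneg_nonneg) auto
    then show "\<bar>?q u\<bar> \<le> 1" for u by simp
  qed
  have q2: "(\<lambda>n. LINT \<omega>|M. min 1 (A * (1 / t) * cube_gap n * ?B n \<omega>)) \<longlonglongrightarrow> 0"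
    using A t by (intro gap_vanish) auto
  have bound: "\<forall>\<^sub>F n in sequentially. \<bar>(LINT \<omega>|M. cts_step x y (?C n \<omega>)) - (LINT \<omega>|M. cts_step x y (?R n \<omega>))\<bar> \<le>
      \<eta> + (LINT \<omega>|M. ?q (?B n \<omega> / env_sum (cut ?l) n \<omega>)) + (LINT \<omega>|M. min 1 (A * (1 / t) * cube_gap n * ?B n \<omega>))"
    using c_gt_1
  proof eventually_elim
    case (elim n)
    then have n: "n \<ge> 1" "c n > 0" by auto
    have Bm: "?B n \<in> borel_measurable M" "env_sum (cut_stay 0 s) n \<in> borel_measurable M" "env_sum (cut ?l) n \<in> borel_measurable M"
      by (rule env_sum_measurable[OF n(1)], simp add: cut_measurable)+
    have Bpos: "0 < ?B n \<omega>" for \<omega> using env_sum_pos[OF n(2) admissible_id] .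
    have gapnn: "0 \<le> A * (1 / t) * cube_gap n * ?B n \<omega>" for \<omega>
      using A t cube_gap_nonneg[of n] Bpos[of \<omega>] by simp
    have i1: "integrable M (\<lambda>\<omega>. ?q (?B n \<omega> / env_sum (cut ?l) n \<omega>))"
    proof (rule min_1_integrable)
      show "(\<lambda>\<omega>. A * max 0 (?B n \<omega> / env_sum (cut ?l) n \<omega> - 1)) \<in> borel_measurable M"
        by (intro borel_measurable_times borel_measurable_max borel_measurable_diff borel_measurable_divide borel_measurable_const Bm)
      show "0 \<le> A * max 0 (?B n \<omega> / env_sum (cut ?l) n \<omega> - 1)" for \<omega>
        using A by (intro mult_nonneg_nonneg) auto
    qed
    have i2: "integrable M (\<lambda>\<omega>. min 1 (A * (1 / t) * cube_gap n * ?B n \<omega>))"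
      by (rule min_1_integrable[OF borel_measurable_times[OF borel_measurable_const Bm(1)] gapnn])
    have "\<bar>(LINT \<omega>|M. cts_step x y (?C n \<omega>)) - (LINT \<omega>|M. cts_step x y (?R n \<omega>))\<bar> \<le> (LINT \<omega>|M. ?h n \<omega>)"
    proof (rule integral_abs_diff_le)
      show "integrable M (\<lambda>\<omega>. cts_step x y (?C n \<omega>))"
        by (rule cts_step_integrable[OF xy uniform_correlation_measurable[where n = n, OF n dyn t s]])
      show "integrable M (\<lambda>\<omega>. cts_step x y (?R n \<omega>))"
        by (rule cts_step_integrable[OF xy borel_measurable_divide[OF Bm(2,1)]])
      show "integrable M (?h n)"
        by (rule Bochner_Integration.integrable_add[OF Bochner_Integration.integrable_add[OF integrable_const i1] i2])
      fix \<omega> assume w: "\<omega> \<in> space M"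
      let ?u = "\<bar>?C n \<omega> - ?R n \<omega>\<bar> / (y - x)"
      have sq: "(?C n \<omega> - ?R n \<omega>)\<^sup>2 \<le> exp 1 * (?B n \<omega> / env_sum (cut ?l) n \<omega> - 1 + 1 / t * cube_gap n * ?B n \<omega>)"
        by (rule uniform_correlation(3)[where n = n, OF n w dyn s t])
      have "?u \<le> \<eta> + ?u\<^sup>2 / \<eta>" using xy \<eta> by (intro le_add_square) auto
      also have "?u\<^sup>2 / \<eta> = (?C n \<omega> - ?R n \<omega>)\<^sup>2 / ((y - x)\<^sup>2 * \<eta>)"
        by (simp add: power_divide)
      also have "\<dots> \<le> exp 1 * (?B n \<omega> / env_sum (cut ?l) n \<omega> - 1 + 1 / t * cube_gap n * ?B n \<omega>) / ((y - x)\<^sup>2 * \<eta>)"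
        using \<eta> by (intro divide_right_mono sq) auto
      also have "\<dots> = A * (?B n \<omega> / env_sum (cut ?l) n \<omega> - 1) + A * (1 / t) * cube_gap n * ?B n \<omega>"
        by (simp add: A_def distrib_left add_divide_distrib mult.assoc)
      finally have u: "?u \<le> \<eta> + A * (?B n \<omega> / env_sum (cut ?l) n \<omega> - 1) + A * (1 / t) * cube_gap n * ?B n \<omega>" by simp
      have "\<bar>cts_step x y (?C n \<omega>) - cts_step x y (?R n \<omega>)\<bar> \<le> min 1 ?u"
        by (rule cts_step_Lipschitz[OF xy])
      moreover have mx: "max 0 (?B n \<omega> / env_sum (cut ?l) n \<omega> - 1) = ?B n \<omega> / env_sum (cut ?l) n \<omega> - 1"
        using env_ratio_ge_1[where n = n, OF n(2) l, of \<omega>] by linarith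
      moreover have "0 \<le> A * (?B n \<omega> / env_sum (cut ?l) n \<omega> - 1)"
        using A env_ratio_ge_1[where n = n, OF n(2) l, of \<omega>] by (intro mult_nonneg_nonneg) auto
      ultimately show "\<bar>cts_step x y (?C n \<omega>) - cts_step x y (?R n \<omega>)\<bar> \<le> ?h n \<omega>"
        unfolding mx by (intro min_add_le[OF _ u _ gapnn \<eta>])
    qed
    also have "\<dots> = \<eta> + (LINT \<omega>|M. ?q (?B n \<omega> / env_sum (cut ?l) n \<omega>)) + (LINT \<omega>|M. min 1 (A * (1 / t) * cube_gap n * ?B n \<omega>))"
      using Bochner_Integration.integral_add[OF Bochner_Integration.integrable_add[OF integrable_const i1] i2]
        Bochner_Integration.integral_add[OF integrable_const i1, of \<eta>] by (simp add: prob_space)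
    finally show ?case .
  qed
  have lhs: "(\<lambda>n. \<bar>(LINT \<omega>|M. cts_step x y (?C n \<omega>)) - (LINT \<omega>|M. cts_step x y (?R n \<omega>))\<bar>) \<longlonglongrightarrow>
      \<bar>a - integral\<^sup>L (distr Q borel (C_sta \<gamma> s)) (cts_step x y)\<bar>"
    by (intro tendsto_rabs tendsto_diff lim equilibrium_limit s xy)
  have rhs: "(\<lambda>n. \<eta> + (LINT \<omega>|M. ?q (?B n \<omega> / env_sum (cut ?l) n \<omega>)) + (LINT \<omega>|M. min 1 (A * (1 / t) * cube_gap n * ?B n \<omega>))) \<longlonglongrightarrow>
      \<eta> + (LINT \<omega>|Q. ?q (mark_sum (\<lambda>x. x) \<omega> / mark_sum (cut ?l) \<omega>)) + 0"
    by (rule tendsto_add[OF tendsto_add[OF tendsto_const q1] q2])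
  from tendsto_le[OF sequentially_bot rhs lhs bound] show ?thesis
    unfolding A_def[symmetric] add_0_right .
qed

text \<open>At a fixed age the correlation function is close to a fixed rational function of
  finitely many sums, whose law converges by \<open>joint_limit\<close>. The order of choices
  matters: \<open>m\<close> comes from the limiting law, it fixes the window \<open>d\<close>, the
  window fixes the polynomial, and \<open>n\<close> is taken large last.\<close>

lemma correlation_law_converges:
  assumes dyn: "rem_dynamics M H \<beta> cube_uniform P X" and t: "t > 0" and s: "s \<ge> 0" and xy: "x < y"
  shows "convergent (\<lambda>n. LINT \<omega>|M. cts_step x y (correlation P X c n t s \<omega>))"
proof (rule convergent_approx)
  fix e :: real assume e: "e > 0"
  \<comment> \<open>Five errors of this size occur: the additive cost of
    \<open>le_add_square\<close>, the inversion, and three truncated remainders.\<close>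
  define \<eta> where "\<eta> = e / 6"
  have \<eta>: "\<eta> > 0" using e by (simp add: \<eta>_def)
  define A where "A = exp 1 / ((y - x)\<^sup>2 * \<eta>)"
  have A: "A > 0" using xy \<eta> by (simp add: A_def)
  let ?l = "1 / t"
  have l: "?l \<ge> 0" using t by simp
  let ?B = "env_sum (\<lambda>x. x)"
  let ?C = "\<lambda>n t \<omega>. correlation P X c n t s \<omega>"
  have "\<forall>\<^sub>F m in sequentially. (LINT \<omega>|Q. min 1 (A / (real m + 1) * (mark_sum (\<lambda>x. x) \<omega> / mark_sum (cut ?l) \<omega>))) < \<eta>"
    using increment_constant_vanish[of A ?l] A l \<eta> by (intro order_tendstoD) auto
  then obtain m' where m': "(LINT \<omega>|Q. min 1 (A / (real m' + 1) * (mark_sum (\<lambda>x. x) \<omega> / mark_sum (cut ?l) \<omega>))) < \<eta>"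
    using eventually_sequentially by auto
  define m where "m = Suc m'"
  have m: "m \<ge> 1" "real m = real m' + 1" by (auto simp: m_def)
  \<comment> \<open>The longest window on which the increment bound with \<open>m\<close> steps is
    available.\<close>
  define d where "d = t / (2 * real m)"
  have d: "d > 0" "2 * real m * d \<le> t" using t m by (auto simp: d_def)
  \<comment> \<open>The Lipschitz factor \<open>1 / (y - x)\<close> turns this into
    \<open>\<eta>\<close>.\<close>
  define \<eta>1 where "\<eta>1 = \<eta> * (y - x)"
  have \<eta>1: "\<eta>1 > 0" using \<eta> xy by (simp add: \<eta>1_def)
  obtain J :: nat and a :: "nat \<Rightarrow> real" where inv: "\<And>(u :: real \<Rightarrow> real) \<rho>. continuous_on {0..} u \<Longrightarrow> (\<And>r. r \<ge> 0 \<Longrightarrow> \<bar>u r\<bar> \<le> 1) \<Longrightarrow>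
      (\<And>r. t \<le> r \<Longrightarrow> r \<le> t + d \<Longrightarrow> \<bar>u r - u t\<bar> \<le> \<rho>) \<Longrightarrow>
      \<bar>u t - (\<Sum>j\<le>J. a j * (LINT r:{0..}|lborel. exp (- (real j + 1) * r) * u r))\<bar> \<le> \<rho> + \<eta>1"
  proof -
    obtain J :: nat and a :: "nat \<Rightarrow> real" where "\<forall>(u :: real \<Rightarrow> real) \<rho>. continuous_on {0..} u \<longrightarrow> (\<forall>r\<ge>0. \<bar>u r\<bar> \<le> 1) \<longrightarrow>
        (\<forall>r. t \<le> r \<longrightarrow> r \<le> t + d \<longrightarrow> \<bar>u r - u t\<bar> \<le> \<rho>) \<longrightarrow>
        \<bar>u t - (\<Sum>j\<le>J. a j * (LINT r:{0..}|lborel. exp (- (real j + 1) * r) * u r))\<bar> \<le> \<rho> + \<eta>1"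
      using laplace_inversion[OF less_imp_le[OF t] d(1) \<eta>1] by (elim exE)
    then show thesis by (intro that[of a J]) (drule spec, drule spec, auto)
  qed
  \<comment> \<open>The total weight of the inversion multiplies the resolvent error. It may be
    huge, but it is fixed before \<open>n\<close>, so the gap beats it.\<close>
  define S where "S = (\<Sum>j\<le>J. \<bar>a j\<bar>)"
  have S: "S \<ge> 0" by (simp add: S_def sum_nonneg)
  \<comment> \<open>Even coordinates carry the numerators and odd ones the denominators of the
    Laplace transforms, at the parameter \<open>j + 1\<close> for the pair with number
    \<open>j\<close>.\<close>
  define g where "g = (\<lambda>i :: nat. if even i then cut_stay (real (i div 2) + 1) s else cut (real (i div 2) + 1))"
  have g: "admissible (g i)" for i
    unfolding g_def using s by (auto intro!: admissible_cut_stay admissible_cut)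
  define G where "G = (\<lambda>w :: nat \<Rightarrow> real. \<Sum>j\<le>J. a j * (w (2 * j) / ((real j + 1) * w (2 * j + 1))))"
  let ?z = "\<lambda>n. LINT \<omega>|M. cts_step x y (G (env_vec g n \<omega>))"
  have coord: "continuous_on V (\<lambda>u :: nat \<Rightarrow> real. u i)" for V i
    by (rule continuous_on_product_then_coordinatewise[OF continuous_on_id])
  have G_cont: "continuous_on positive_vecs G"
    unfolding G_def
    by (intro continuous_on_sum continuous_on_mult continuous_on_divide continuous_on_const coord)
      (auto simp: positive_vecs_def less_imp_neq[symmetric] add_nonneg_pos[THEN less_imp_neq, symmetric])
  have FG_cont: "continuous_on positive_vecs (\<lambda>w. cts_step x y (G w))"
    by (rule continuous_on_compose2[OF cts_step_continuous[OF xy, of UNIV] G_cont]) simp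
  have z: "convergent ?z"
  proof (rule convergentI)
    show "?z \<longlonglongrightarrow> (LINT \<omega>|Q. cts_step x y (G (mark_vec g \<omega>)))"
    proof (rule joint_limit[where d = "2 * J + 2" and K = 1 and F = "\<lambda>w. cts_step x y (G w)", OF g FG_cont])
      show "\<bar>cts_step x y (G w)\<bar> \<le> 1" for w using cts_step_bounds[OF xy, of "G w"] by simp
      show "cts_step x y (G v) = cts_step x y (G w)" if "\<And>i. i < 2 * J + 2 \<Longrightarrow> v i = w i" for v w
        using that by (simp add: G_def)
    qed
  qed
  have q1: "(\<lambda>n. LINT \<omega>|M. min 1 (A / real m * (?B n \<omega> / env_sum (cut ?l) n \<omega>))) \<longlonglongrightarrow>
      (LINT \<omega>|Q. min 1 (A / real m * (mark_sum (\<lambda>x. x) \<omega> / mark_sum (cut ?l) \<omega>)))"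
  proof (rule ratio_limit[where K = 1 and \<phi> = "\<lambda>u. min 1 (A / real m * u)", OF admissible_id admissible_cut[OF l]])
    show "continuous_on {0<..} (\<lambda>u. min 1 (A / real m * u))"
      by (intro continuous_on_min continuous_on_mult continuous_on_const continuous_on_id)
    have "0 \<le> A / real m * u" if "u > 0" for u using A that by (intro mult_nonneg_nonneg) auto
    then show "\<bar>min 1 (A / real m * u)\<bar> \<le> 1" if "u > 0" for u using that by simp
  qed
  have q2: "(\<lambda>n. LINT \<omega>|M. min 1 (A / real m * (2 / t) * cube_gap n * ?B n \<omega>)) \<longlonglongrightarrow> 0"
    using A t by (intro gap_vanish) auto
  have q3: "(\<lambda>n. LINT \<omega>|M. min 1 (S / (y - x) * cube_gap n * ?B n \<omega>)) \<longlonglongrightarrow> 0"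
    using S xy by (intro gap_vanish) auto
  have "\<forall>\<^sub>F n in sequentially. \<bar>(LINT \<omega>|M. cts_step x y (?C n t \<omega>)) - ?z n\<bar> \<le> e"
    using c_gt_1 order_tendstoD(2)[OF q1 m'[folded m(2)]] order_tendstoD(2)[OF q2 \<eta>] order_tendstoD(2)[OF q3 \<eta>]
  proof eventually_elim
    case (elim n)
    then have n: "n \<ge> 1" "c n > 0" by auto
    have Bm: "?B n \<in> borel_measurable M" "env_sum (cut ?l) n \<in> borel_measurable M"
      by (rule env_sum_measurable[OF n(1)], simp add: cut_measurable)+
    have gm: "env_sum (g i) n \<in> borel_measurable M" for i
      by (rule env_sum_measurable[OF n(1)]) (simp add: g_def cut_measurable)
    have Bpos: "0 < ?B n \<omega>" for \<omega> using env_sum_pos[OF n(2) admissible_id] .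
    have ratio: "1 \<le> ?B n \<omega> / env_sum (cut ?l) n \<omega>" for \<omega> by (rule env_ratio_ge_1[OF n(2) l])
    define r1 where "r1 = (\<lambda>\<omega>. A / real m * (?B n \<omega> / env_sum (cut ?l) n \<omega>))"
    define r2 where "r2 = (\<lambda>\<omega>. A / real m * (2 / t) * cube_gap n * ?B n \<omega>)"
    define r3 where "r3 = (\<lambda>\<omega>. S / (y - x) * cube_gap n * ?B n \<omega>)"
    have rm: "r1 \<in> borel_measurable M" "r2 \<in> borel_measurable M" "r3 \<in> borel_measurable M"
      unfolding r1_def r2_def r3_def
      by (intro borel_measurable_times borel_measurable_divide borel_measurable_const Bm)+
    have "0 \<le> A / real m" using A by simp
    then have "0 \<le> r1 \<omega>" for \<omega>
      unfolding r1_def by (rule mult_nonneg_nonneg[OF _ order_trans[OF zero_le_one ratio]])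
    moreover have "0 \<le> r2 \<omega>" "0 \<le> r3 \<omega>" for \<omega>
      using A t S xy cube_gap_nonneg[of n] Bpos[of \<omega>] by (simp_all add: r2_def r3_def)
    ultimately have r0: "0 \<le> r1 \<omega>" "0 \<le> r2 \<omega>" "0 \<le> r3 \<omega>" for \<omega> by auto
    have ri: "integrable M (\<lambda>\<omega>. min 1 (r1 \<omega>))" "integrable M (\<lambda>\<omega>. min 1 (r2 \<omega>))" "integrable M (\<lambda>\<omega>. min 1 (r3 \<omega>))"
      by (rule min_1_integrable[OF rm(1) r0(1)] min_1_integrable[OF rm(2) r0(2)] min_1_integrable[OF rm(3) r0(3)])+
    have "\<bar>(LINT \<omega>|M. cts_step x y (?C n t \<omega>)) - ?z n\<bar> \<le> (LINT \<omega>|M. 2 * \<eta> + min 1 (r1 \<omega>) + min 1 (r2 \<omega>) + min 1 (r3 \<omega>))"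
    proof (rule integral_abs_diff_le)
      show "integrable M (\<lambda>\<omega>. cts_step x y (?C n t \<omega>))"
        by (rule cts_step_integrable[OF xy uniform_correlation_measurable[where n = n, OF n dyn t s]])
      have "(\<lambda>\<omega>. G (env_vec g n \<omega>)) \<in> borel_measurable M"
        unfolding G_def env_vec_def
        by (intro borel_measurable_sum borel_measurable_times borel_measurable_divide borel_measurable_const gm)
      then show "integrable M (\<lambda>\<omega>. cts_step x y (G (env_vec g n \<omega>)))"
        by (rule cts_step_integrable[OF xy])
      show "integrable M (\<lambda>\<omega>. 2 * \<eta> + min 1 (r1 \<omega>) + min 1 (r2 \<omega>) + min 1 (r3 \<omega>))"
        by (intro Bochner_Integration.integrable_add ri integrable_const)
      fix \<omega> assume w: "\<omega> \<in> space M"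
      note uc = uniform_correlation[where n = n, OF n w dyn s]
      define V where "V = exp 1 / real m * (?B n \<omega> / env_sum (cut ?l) n \<omega> + 2 / t * cube_gap n * ?B n \<omega>)"
      have V: "V / ((y - x)\<^sup>2 * \<eta>) = r1 \<omega> + r2 \<omega>"
        by (simp add: V_def r1_def r2_def A_def distrib_left add_divide_distrib mult_ac)
      \<comment> \<open>The increment bound at \<open>r = t\<close> shows that \<open>V\<close> is
        nonnegative.\<close>
      have "0 \<le> (?C n t \<omega> - ?C n t \<omega>)\<^sup>2" by simp
      also have "\<dots> \<le> V"
        unfolding V_def using t d m by (intro uc(4)[where d = d]) auto
      finally have V0: "0 \<le> V" .
      have incr: "\<bar>?C n r \<omega> - ?C n t \<omega>\<bar> \<le> sqrt V" if "t \<le> r" "r \<le> t + d" for r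
      proof -
        have "(?C n r \<omega> - ?C n t \<omega>)\<^sup>2 \<le> V"
          unfolding V_def by (rule uc(4)[OF t that m(1) d(2)])
        then have "sqrt ((?C n r \<omega> - ?C n t \<omega>)\<^sup>2) \<le> sqrt V" by (rule real_sqrt_le_mono)
        then show ?thesis by (simp only: real_sqrt_abs)
      qed
      have i1: "\<bar>?C n t \<omega> - (\<Sum>j\<le>J. a j * (LINT r:{0..}|lborel. exp (- (real j + 1) * r) * ?C n r \<omega>))\<bar> \<le> sqrt V + \<eta>1"
        by (rule inv[OF uc(2) _ incr]) (use uc(1) in \<open>auto simp: abs_le_iff intro: order_trans\<close>)
      have "\<bar>(\<Sum>j\<le>J. a j * (LINT r:{0..}|lborel. exp (- (real j + 1) * r) * ?C n r \<omega>)) - G (env_vec g n \<omega>)\<bar> \<le>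
          (\<Sum>j\<le>J. \<bar>a j\<bar> * (cube_gap n * ?B n \<omega>))"
        unfolding G_def sum_subtractf[symmetric] right_diff_distrib[symmetric]
      proof (intro order_trans[OF sum_abs] sum_mono)
        fix j
        have "\<bar>(LINT r:{0..}|lborel. exp (- (real j + 1) * r) * ?C n r \<omega>) -
            env_vec g n \<omega> (2 * j) / ((real j + 1) * env_vec g n \<omega> (2 * j + 1))\<bar> \<le> cube_gap n * ?B n \<omega>"
          using uc(5)[of "real j + 1"] by (simp add: env_vec_def g_def)
        then show "\<bar>a j * ((LINT r:{0..}|lborel. exp (- (real j + 1) * r) * ?C n r \<omega>) -
            env_vec g n \<omega> (2 * j) / ((real j + 1) * env_vec g n \<omega> (2 * j + 1)))\<bar> \<le> \<bar>a j\<bar> * (cube_gap n * ?B n \<omega>)"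
          unfolding abs_mult by (rule mult_left_mono) simp
      qed
      also have "\<dots> = S * (cube_gap n * ?B n \<omega>)" by (simp add: S_def sum_distrib_right)
      finally have i2: "\<bar>?C n t \<omega> - G (env_vec g n \<omega>)\<bar> \<le> sqrt V + \<eta>1 + S * (cube_gap n * ?B n \<omega>)"
        using i1 by linarith
      let ?u = "\<bar>?C n t \<omega> - G (env_vec g n \<omega>)\<bar> / (y - x)"
      have "?u \<le> (sqrt V + \<eta>1 + S * (cube_gap n * ?B n \<omega>)) / (y - x)"
        using xy by (intro divide_right_mono i2) auto
      also have "\<dots> = sqrt V / (y - x) + \<eta> + r3 \<omega>"
        using xy by (simp add: add_divide_distrib \<eta>1_def r3_def)
      also have "sqrt V / (y - x) \<le> \<eta> + (sqrt V / (y - x))\<^sup>2 / \<eta>"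
        using xy \<eta> V0 by (intro le_add_square) auto
      also have "(sqrt V / (y - x))\<^sup>2 / \<eta> = r1 \<omega> + r2 \<omega>"
        unfolding V[symmetric] using V0 by (simp add: power_divide)
      finally have u: "?u \<le> 2 * \<eta> + r1 \<omega> + r2 \<omega> + r3 \<omega>" by simp
      have "\<bar>cts_step x y (?C n t \<omega>) - cts_step x y (G (env_vec g n \<omega>))\<bar> \<le> min 1 ?u"
        by (rule cts_step_Lipschitz[OF xy])
      then show "\<bar>cts_step x y (?C n t \<omega>) - cts_step x y (G (env_vec g n \<omega>))\<bar> \<le>
          2 * \<eta> + min 1 (r1 \<omega>) + min 1 (r2 \<omega>) + min 1 (r3 \<omega>)"
        using u r0[of \<omega>] \<eta> by linarith
    qed
    also have "\<dots> = 2 * \<eta> + (LINT \<omega>|M. min 1 (r1 \<omega>)) + (LINT \<omega>|M. min 1 (r2 \<omega>)) + (LINT \<omega>|M. min 1 (r3 \<omega>))"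
      using ri by (simp add: prob_space)
    also have "\<dots> \<le> 2 * \<eta> + \<eta> + \<eta> + \<eta>"
      using elim unfolding r1_def r2_def r3_def by linarith
    finally show ?case using \<eta> by (simp add: \<eta>_def)
  qed
  with z show "\<exists>z. convergent z \<and> (\<forall>\<^sub>F n in sequentially. \<bar>(LINT \<omega>|M. cts_step x y (?C n t \<omega>)) - z n\<bar> \<le> e)"
    by blast
qed

theorem gibbs_limit:
  assumes dyn: "rem_dynamics M H \<beta> (gibbs H \<beta>) P X" and t: "t \<ge> 0" and s: "s \<ge> 0"
  shows "weak_conv_m (\<lambda>n. distr M borel (correlation P X c n t s)) (distr Q borel (C_sta \<gamma> s))"
proof (rule weak_conv_distrI[OF _ real_distribution_C_sta])
  have eq: "\<forall>\<^sub>F n in sequentially. n \<ge> 1 \<and> (\<forall>\<omega>\<in>space M. correlation P X c n t s \<omega> = env_sum (cut_stay 0 s) n \<omega> / env_sum (\<lambda>x. x) n \<omega>)"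
    using c_gt_1
  proof eventually_elim
    case (elim n)
    then show ?case using gibbs_correlation[where n = n, OF _ _ _ dyn t s] by auto
  qed
  then show "\<forall>\<^sub>F n in sequentially. correlation P X c n t s \<in> borel_measurable M"
  proof eventually_elim
    case (elim n)
    have "(\<lambda>\<omega>. env_sum (cut_stay 0 s) n \<omega> / env_sum (\<lambda>x. x) n \<omega>) \<in> borel_measurable M"
      using admissible_cut_stay[of 0 s] s elim
      by (intro borel_measurable_divide env_sum_measurable) (auto simp: admissible_def)
    then show ?case by (rule measurable_cong[THEN iffD1, rotated]) (use elim in auto)
  qed
  fix x y :: real assume xy: "x < y"
  have "\<forall>\<^sub>F n in sequentially. (LINT \<omega>|M. cts_step x y (env_sum (cut_stay 0 s) n \<omega> / env_sum (\<lambda>x. x) n \<omega>)) =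
      (LINT \<omega>|M. cts_step x y (correlation P X c n t s \<omega>))"
    using eq by eventually_elim (auto intro!: Bochner_Integration.integral_cong)
  with equilibrium_limit[OF s xy]
  show "(\<lambda>n. LINT \<omega>|M. cts_step x y (correlation P X c n t s \<omega>)) \<longlonglongrightarrow> integral\<^sup>L (distr Q borel (C_sta \<gamma> s)) (cts_step x y)"
    by (rule Lim_transform_eventually)
qed

theorem uniform_limit_law:
  assumes dyn: "rem_dynamics M H \<beta> cube_uniform P X" and s: "s \<ge> 0"
  shows "\<exists>L :: real \<Rightarrow> real measure.
    (\<forall>t>0. real_distribution (L t) \<and> weak_conv_m (\<lambda>n. distr M borel (correlation P X c n t s)) (L t)) \<and>
    (\<forall>x. isCont (cdf (distr Q borel (C_sta \<gamma> s))) x \<longrightarrow>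
      ((\<lambda>t. cdf (L t) x) \<longlongrightarrow> cdf (distr Q borel (C_sta \<gamma> s)) x) at_top)"
proof -
  let ?D = "distr Q borel (C_sta \<gamma> s)"
  define good where "good = (\<lambda>t L. real_distribution L \<and> weak_conv_m (\<lambda>n. distr M borel (correlation P X c n t s)) L \<and>
    (\<forall>x y. x < y \<longrightarrow> (\<lambda>n. LINT \<omega>|M. cts_step x y (correlation P X c n t s \<omega>)) \<longlonglongrightarrow> integral\<^sup>L L (cts_step x y)))"
  have "\<exists>L. good t L" if t: "t > 0" for t
  proof -
    have "\<forall>\<^sub>F n in sequentially. correlation P X c n t s \<in> borel_measurable M \<and>
        (\<forall>\<omega>\<in>space M. 0 \<le> correlation P X c n t s \<omega> \<and> correlation P X c n t s \<omega> \<le> 1)"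
      using c_gt_1
    proof eventually_elim
      case (elim n)
      then show ?case
        using uniform_correlation_measurable[where n = n, OF _ _ dyn t s]
          uniform_correlation(1)[where n = n, OF _ _ _ dyn s, of _ t] t by auto
    qed
    from bounded_limit_law[OF this correlation_law_converges[OF dyn t s]] show ?thesis
      unfolding good_def by metis
  qed
  then obtain L0 where L0: "\<And>t. t > 0 \<Longrightarrow> good t (L0 t)" by metis
  \<comment> \<open>The filler for nonpositive ages makes every \<open>L t\<close> a distribution,
    so that an arbitrary sequence of ages may be inserted.\<close>
  define L where "L = (\<lambda>t. if t > 0 then L0 t else ?D)"
  have L: "good t (L t)" if "t > 0" for t using L0[OF that] that by (simp add: L_def)
  have rd: "real_distribution (L t)" for t
    using L0 real_distribution_C_sta by (auto simp: L_def good_def)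
  have conv: "((\<lambda>t. integral\<^sup>L (L t) (cts_step x y)) \<longlongrightarrow> integral\<^sup>L ?D (cts_step x y)) at_top" if xy: "x < y" for x y
  proof (rule tendstoI)
    fix e :: real assume e: "e > 0"
    define A where "A = exp 1 / ((y - x)\<^sup>2 * (e / 2))"
    have "A \<ge> 0" using e by (simp add: A_def)
    have "\<forall>\<^sub>F t in at_top. (LINT \<omega>|Q. min 1 (A * max 0 (mark_sum (\<lambda>x. x) \<omega> / mark_sum (cut (1 / (2 * t))) \<omega> - 1))) < e / 2"
      using equilibrium_constant_vanish[OF \<open>A \<ge> 0\<close>] e by (intro order_tendstoD) auto
    then show "\<forall>\<^sub>F t in at_top. dist (integral\<^sup>L (L t) (cts_step x y)) (integral\<^sup>L ?D (cts_step x y)) < e"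
      using eventually_gt_at_top[of 0]
    proof eventually_elim
      case (elim t)
      have lim: "(\<lambda>n. LINT \<omega>|M. cts_step x y (correlation P X c n t s \<omega>)) \<longlonglongrightarrow> integral\<^sup>L (L t) (cts_step x y)"
        using L[OF elim(2)] xy by (simp add: good_def)
      have "e / 2 > 0" using e by simp
      from limit_at_equilibrium[OF dyn elim(2) s xy this lim] elim(1) show ?case
        unfolding A_def[symmetric] dist_real_def by linarith
    qed
  qed
  have "((\<lambda>t. cdf (L t) x) \<longlongrightarrow> cdf ?D x) at_top" if x: "isCont (cdf ?D) x" for x
  \<comment> \<open>Weak convergence is a statement about sequences of laws, so the limit over real
    ages is tested along sequences.\<close>
  proof (rule tendsto_at_topI_sequentially)
    fix T :: "nat \<Rightarrow> real" assume T: "filterlim T at_top sequentially"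
    have "weak_conv_m (\<lambda>k. L (T k)) ?D"
    proof (rule integral_cts_step_conv_imp_weak_conv[OF rd real_distribution_C_sta])
      fix x y :: real assume "x < y"
      from filterlim_compose[OF conv[OF this] T]
      show "(\<lambda>k. integral\<^sup>L (L (T k)) (cts_step x y)) \<longlonglongrightarrow> integral\<^sup>L ?D (cts_step x y)" .
    qed
    then show "(\<lambda>k. cdf (L (T k)) x) \<longlonglongrightarrow> cdf ?D x"
      using x by (simp add: weak_conv_m_def weak_conv_def)
  qed
  then show ?thesis using L rd by (intro exI[of _ L]) (auto simp: good_def)
qed

end

theorem theorem1p7:
  fixes M :: "'w measure" and H :: "nat \<Rightarrow> (nat \<Rightarrow> real) \<Rightarrow> 'w \<Rightarrow> real"
    and \<beta> \<beta>\<^sub>c \<alpha> \<epsilon> :: real and c :: "nat \<Rightarrow> real"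
    and Q :: "'g measure" and \<mu> :: "real measure" and \<gamma> :: "nat \<Rightarrow> 'g \<Rightarrow> real"
  assumes environment: "rem_environment M H"
    and beta_c: "\<beta>\<^sub>c = sqrt (2 * ln 2)"
    and alpha: "\<alpha> = \<beta>\<^sub>c / \<beta>"
    and low_temperature: "\<beta> > \<beta>\<^sub>c"
    and time_scale: "extreme_time_scale M H \<beta> c \<epsilon>"
    and mean_measure: "sets \<mu> = sets (restrict_space borel {0<..})"
      "\<And>x. x > 0 \<Longrightarrow> emeasure \<mu> {x<..} = ennreal (x powr (- \<alpha>) / \<epsilon>)"
    and marks: "poisson_marks Q \<mu> \<gamma>"
  shows
    "(\<forall>(P :: nat \<Rightarrow> 'w \<Rightarrow> 'p measure) X.
        rem_dynamics M H \<beta> (gibbs H \<beta>) P X \<longrightarrow>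
       (\<forall>s>0. \<forall>t>0.
          weak_conv_m (\<lambda>n. distr M borel (correlation P X c n t s))
            (distr Q borel (C_sta \<gamma> s)))) \<and>
     (\<forall>(P :: nat \<Rightarrow> 'w \<Rightarrow> 'p measure) X.
        rem_dynamics M H \<beta> cube_uniform P X \<longrightarrow>
       (\<forall>s\<ge>0. \<exists>L :: real \<Rightarrow> real measure.
          (\<forall>t>0. real_distribution (L t) \<and>
             weak_conv_m (\<lambda>n. distr M borel (correlation P X c n t s)) (L t)) \<and>
          (\<forall>x. isCont (cdf (distr Q borel (C_sta \<gamma> s))) x \<longrightarrow>
             ((\<lambda>t. cdf (L t) x) \<longlongrightarrow>
               cdf (distr Q borel (C_sta \<gamma> s)) x) at_top)))"
proof -
  interpret E: extreme_rem M H \<beta> \<alpha> \<epsilon> c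
    by unfold_locales (use environment beta_c alpha low_temperature time_scale in auto)
  \<comment> \<open>The bounds on \<open>\<alpha>\<close> and \<open>\<epsilon>\<close> proved for
    the environment discharge the assumptions on the Poisson side.\<close>
  interpret rem_limit M H \<beta> \<alpha> \<epsilon> c Q \<mu> \<gamma>
    by unfold_locales (use E.alpha_bounds E.eps_pos mean_measure marks in auto)
  show ?thesis
    by (intro conjI allI impI)
      ((rule gibbs_limit; simp), (rule uniform_limit_law; assumption))
qed

end
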